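(* Let $X$ be an $r$-convex Banach function space over $(\Omega,\Sigma,\mu)$, and let $Y$ be an $r$-concave Banach function space over $(\Omega',\Sigma',\nu)$ such that $X$ and $Y'$ are order continuous. Let $T:X\to Y$ be an operator. The following are equivalent. (i) There is a constant $K>0$ such that for each pair of matrices of elements $(x_{i,j})_{i=1,j=1}^{n,m}$ in $X$ and $(y'_{i,j})_{i=1,j=1}^{n,m}$ in $Y'$, the following inequality holds: $$\sum_{i=1}^n\sum_{j=1}^m\big|\langle Tx_{i,j},y'_{i,j}\rangle\big|\le K\,\Big\|\Big(\sum_{i=1}^n\big(\sum_{j=1}^m|x_{i,j}|^q\big)^{\frac rq}\Big)^{\frac1r}\Big\|_X\,\Big\|\Big(\sum_{i=1}^n\big(\sum_{j=1}^m|y'_{i,j}|^{p'}\big)^{\frac{r'}{p'}}\Big)^{\frac1{r'}}\Big\|_{Y'}.$$ (ii) There is a constant $K>0$ such that for each matrix of elements $(x_{i,j})_{i=1,j=1}^{n,m}$ in $X$, the following inequality holds: $$\Big\|\Big(\sum_{i=1}^n\big(\sum_{j=1}^m|Tx_{i,j}|^p\big)^{\frac rp}\Big)^{\frac1r}\Big\|_Y\le K\,\Big\|\Big(\sum_{i=1}^n\big(\sum_{j=1}^m|x_{i,j}|^q\big)^{\frac rq}\Big)^{\frac1r}\Big\|_X.$$ (iii) There are functions $f$ and $g$ such that $T$ factors as $T=M_g\circ\hat T\circ M_f$, with multiplication operators $M_f:X\to L_r(\mu)$ and $M_g:L_r(\nu)\to Y$, where $\hat T:L_r(\mu)\to L_r(\nu)$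 is $(p,q)$-regular.
   Context: A Banach function space over a measure space is a Banach lattice of (a.e. classes of) measurable functions. $Y'$ denotes the dual of $Y$, identified with a space of measurable functions through $\langle y,y'\rangle=\int yy'\,d\nu$ (an $r$-concave space is order continuous). $M_h$ denotes the operator of multiplication by the function $h$. Primes on exponents denote conjugates: $1/p+1/p'=1$, $1/r+1/r'=1$. "Operator" means bounded linear operator. For exponents $p,q\in(0,\infty]$, a linear map $S:E\to F$ between (quasi-)Banach lattices is $(p,q)$-regular if there is $K>0$ with $\big\|(\sum_{i=1}^n|Sx_i|^p)^{1/p}\big\|\le K\big\|(\sum_{i=1}^n|x_i|^q)^{1/q}\big\|$ for every finite family $\{x_i\}_{i=1}^n\subset E$; when an exponent is $\infty$ the corresponding expression is replaced by the supremum $\bigvee_{i=1}^n|\cdot|$. $X$ is $r$-convex if there is $M$ with $\|(\sum|x_i|^r)^{1/r}\|\le M(\sum\|x_i\|^r)^{1/r}$ for all finite families in $X$; $Y$ is $r$-concave if there is $M$ with $(\sum\|y_i\|^r)^{1/r}\le M\|(\sum|y_i|^r)^{1/r}\|$ for all finite families in $Y$. The statement specifies no ranges for the exponents $p,q,r$.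
   Formalization: Banach function spaces are taken to be order ideals of measurable functions over σ-finite measure spaces (the claim fails without either), with real scalars, 1 ≤ r < ∞, p ∈ [1,∞] and q ∈ (0,∞]. *)

theory Defs
  imports "HOL-Analysis.Analysis"
begin

text \<open>
  Spaces of a.e. classes are represented by genuine functions: a \<open>fun_space\<close> carries a measure,
  a set of real functions closed under a.e. equality (see \<open>banach_function_space\<close>), and a norm
  that only depends on the a.e. class.  Order, linearity and equality are taken a.e.
\<close>

record 'a fun_space =
  msr :: "'a measure"
  elts :: "('a \<Rightarrow> real) set"
  nrm :: "('a \<Rightarrow> real) \<Rightarrow> real"

text \<open>
  A Banach lattice that is an order ideal of $L^0$ over a sigma-finite measure space.  It is
  not required to contain the indicators of sets of finite measure, nor to have full support.
\<close>

locale banach_function_space =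
  fixes X :: "'a fun_space"
  assumes sigma_finite: "sigma_finite_measure (msr X)"
    and measurable: "elts X \<subseteq> borel_measurable (msr X)"
    and zero_mem: "(\<lambda>_. 0) \<in> elts X"
    and add_mem: "\<lbrakk>x \<in> elts X; z \<in> elts X\<rbrakk> \<Longrightarrow> (\<lambda>w. x w + z w) \<in> elts X"
    and scale_mem: "x \<in> elts X \<Longrightarrow> (\<lambda>w. a * x w) \<in> elts X"
    and ideal_mem: "\<lbrakk>z \<in> elts X; x \<in> borel_measurable (msr X); AE w in msr X. \<bar>x w\<bar> \<le> \<bar>z w\<bar>\<rbrakk>
                      \<Longrightarrow> x \<in> elts X"
    and norm_mono: "\<lbrakk>x \<in> elts X; z \<in> elts X; AE w in msr X. \<bar>x w\<bar> \<le> \<bar>z w\<bar>\<rbrakk>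
                      \<Longrightarrow> nrm X x \<le> nrm X z"
    and norm_nonneg: "x \<in> elts X \<Longrightarrow> 0 \<le> nrm X x"
    and norm_zero_iff: "x \<in> elts X \<Longrightarrow> nrm X x = 0 \<longleftrightarrow> (AE w in msr X. x w = 0)"
    and norm_scale: "x \<in> elts X \<Longrightarrow> nrm X (\<lambda>w. a * x w) = \<bar>a\<bar> * nrm X x"
    and norm_triangle: "\<lbrakk>x \<in> elts X; z \<in> elts X\<rbrakk> \<Longrightarrow> nrm X (\<lambda>w. x w + z w) \<le> nrm X x + nrm X z"
    and complete: "\<lbrakk>\<And>n::nat. s n \<in> elts X;
                    \<And>e. e > 0 \<Longrightarrow> \<exists>N. \<forall>m\<ge>N. \<forall>n\<ge>N. nrm X (\<lambda>w. s m w - s n w) < e\<rbrakk>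
                    \<Longrightarrow> \<exists>x\<in>elts X. (\<lambda>n. nrm X (\<lambda>w. s n w - x w)) \<longlonglongrightarrow> 0"

text \<open>Every downward directed set with infimum \<open>0\<close> in the a.e. order of \<open>X\<close> has elements of
  arbitrarily small norm.\<close>

definition order_continuous :: "'a fun_space \<Rightarrow> bool" where
  "order_continuous X \<longleftrightarrow>
     (\<forall>D \<subseteq> elts X.
        D \<noteq> {} \<longrightarrow>
        (\<forall>a\<in>D. \<forall>b\<in>D. \<exists>c\<in>D. AE w in msr X. c w \<le> a w \<and> c w \<le> b w) \<longrightarrow>
        (\<forall>a\<in>D. AE w in msr X. 0 \<le> a w) \<longrightarrow>
        (\<forall>z\<in>elts X. (\<forall>a\<in>D. AE w in msr X. z w \<le> a w) \<longrightarrow> (AE w in msr X. z w \<le> 0)) \<longrightarrow>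
        (\<forall>e>0. \<exists>a\<in>D. nrm X a < e))"

definition r_convex :: "real \<Rightarrow> 'a fun_space \<Rightarrow> bool" where
  "r_convex r X \<longleftrightarrow>
     (\<exists>M. \<forall>n. \<forall>x :: nat \<Rightarrow> 'a \<Rightarrow> real. (\<forall>i<n. x i \<in> elts X) \<longrightarrow>
        nrm X (\<lambda>w. (\<Sum>i<n. \<bar>x i w\<bar> powr r) powr (1 / r)) \<le>
          M * (\<Sum>i<n. nrm X (x i) powr r) powr (1 / r))"

definition r_concave :: "real \<Rightarrow> 'a fun_space \<Rightarrow> bool" where
  "r_concave r Y \<longleftrightarrow>
     (\<exists>M. \<forall>n. \<forall>y :: nat \<Rightarrow> 'a \<Rightarrow> real. (\<forall>i<n. y i \<in> elts Y) \<longrightarrow>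
        (\<Sum>i<n. nrm Y (y i) powr r) powr (1 / r) \<le>
          M * nrm Y (\<lambda>w. (\<Sum>i<n. \<bar>y i w\<bar> powr r) powr (1 / r)))"

definition pairing :: "'a fun_space \<Rightarrow> ('a \<Rightarrow> real) \<Rightarrow> ('a \<Rightarrow> real) \<Rightarrow> real" where
  "pairing Y y y' = (\<integral>w. y w * y' w \<partial>msr Y)"

text \<open>
  The functions that represent, through the pairing, a bounded linear functional on \<open>Y\<close>, with the
  norm of that functional; if \<open>Y\<close> is order continuous, these are all the bounded functionals.
  The pairing sees \<open>y'\<close> only on the support of \<open>Y\<close>, and the last membership condition makes \<open>y'\<close>
  vanish elsewhere, so that each functional has exactly one representative up to a.e. equality.
\<close>

definition dual_space :: "'a fun_space \<Rightarrow> 'a fun_space" where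
  "dual_space Y =
     \<lparr>msr = msr Y,
      elts = {y' \<in> borel_measurable (msr Y).
                (\<forall>y\<in>elts Y. integrable (msr Y) (\<lambda>w. y w * y' w)) \<and>
                (\<exists>C. \<forall>y\<in>elts Y. \<bar>pairing Y y y'\<bar> \<le> C * nrm Y y) \<and>
                (\<forall>A\<in>sets (msr Y). (\<forall>y\<in>elts Y. AE w in msr Y. w \<in> A \<longrightarrow> y w = 0) \<longrightarrow>
                                    (AE w in msr Y. w \<in> A \<longrightarrow> y' w = 0))},
      nrm = (\<lambda>y'. Sup {\<bar>pairing Y y y'\<bar> | y. y \<in> elts Y \<and> nrm Y y \<le> 1})\<rparr>"

definition Lr_space :: "real \<Rightarrow> 'a measure \<Rightarrow> 'a fun_space" where
  "Lr_space r M =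
     \<lparr>msr = M,
      elts = {h \<in> borel_measurable M. integrable M (\<lambda>w. \<bar>h w\<bar> powr r)},
      nrm = (\<lambda>h. (\<integral>w. \<bar>h w\<bar> powr r \<partial>M) powr (1 / r))\<rparr>"

definition linear_map :: "'a fun_space \<Rightarrow> 'b fun_space \<Rightarrow> (('a \<Rightarrow> real) \<Rightarrow> ('b \<Rightarrow> real)) \<Rightarrow> bool" where
  "linear_map X Y T \<longleftrightarrow>
     (\<forall>x\<in>elts X. T x \<in> elts Y) \<and>
     (\<forall>x\<in>elts X. \<forall>z\<in>elts X. AE w in msr Y. T (\<lambda>u. x u + z u) w = T x w + T z w) \<and>
     (\<forall>x\<in>elts X. \<forall>a. AE w in msr Y. T (\<lambda>u. a * x u) w = a * T x w)"

text \<open>The bound, together with linearity, also makes \<open>T\<close> respect a.e. equality.\<close>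

definition bounded_operator ::
    "'a fun_space \<Rightarrow> 'b fun_space \<Rightarrow> (('a \<Rightarrow> real) \<Rightarrow> ('b \<Rightarrow> real)) \<Rightarrow> bool" where
  "bounded_operator X Y T \<longleftrightarrow>
     linear_map X Y T \<and> (\<exists>C. \<forall>x\<in>elts X. nrm Y (T x) \<le> C * nrm X x)"

definition mult_op :: "('a \<Rightarrow> real) \<Rightarrow> ('a \<Rightarrow> real) \<Rightarrow> ('a \<Rightarrow> real)" where
  "mult_op h x = (\<lambda>w. h w * x w)"

text \<open>
  $(\sum_{i<n} |a_i|^p)^{1/p}$ for \<open>0 < p < \<infinity>\<close> and $\max_{i<n} |a_i|$ for \<open>p = \<infinity>\<close>; the inserted \<open>0\<close>
  only matters for \<open>n = 0\<close>.
\<close>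

definition lp_sum :: "ennreal \<Rightarrow> nat \<Rightarrow> (nat \<Rightarrow> real) \<Rightarrow> real" where
  "lp_sum p n a =
     (if p = \<infinity> then Max (insert 0 ((\<lambda>i. \<bar>a i\<bar>) ` {..<n}))
      else (\<Sum>i<n. \<bar>a i\<bar> powr enn2real p) powr (1 / enn2real p))"

text \<open>
  $(\sum_{i<n} (\sum_{j<m} |x_{ij}|^q)^{s/q})^{1/s}$, written as the \<open>s\<close>-sum of the \<open>q\<close>-sums of the
  rows so that either exponent may be \<open>\<infinity>\<close>.
\<close>

definition mixed_sum ::
    "ennreal \<Rightarrow> ennreal \<Rightarrow> nat \<Rightarrow> nat \<Rightarrow> (nat \<Rightarrow> nat \<Rightarrow> 'a \<Rightarrow> real) \<Rightarrow> 'a \<Rightarrow> real" where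
  "mixed_sum s q n m x = (\<lambda>w. lp_sum s n (\<lambda>i. lp_sum q m (\<lambda>j. x i j w)))"

definition pq_regular ::
    "ennreal \<Rightarrow> ennreal \<Rightarrow> 'a fun_space \<Rightarrow> 'b fun_space \<Rightarrow> (('a \<Rightarrow> real) \<Rightarrow> ('b \<Rightarrow> real)) \<Rightarrow> bool" where
  "pq_regular p q E F S \<longleftrightarrow>
     linear_map E F S \<and>
     (\<exists>K>0. \<forall>n. \<forall>x :: nat \<Rightarrow> 'a \<Rightarrow> real. (\<forall>i<n. x i \<in> elts E) \<longrightarrow>
        nrm F (\<lambda>w. lp_sum p n (\<lambda>i. S (x i) w)) \<le> K * nrm E (\<lambda>w. lp_sum q n (\<lambda>i. x i w)))"

end

(*
  (i) and (ii) are dual to each other: Hoelder's inequality for the mixed sums gives (i) from (ii),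
  and conversely Y has a norming set of integral functionals because r-concavity makes Y order
  continuous.  (iii) implies (ii) by summing the r-th powers of the regularity estimate over the rows.

  For (iii) from (ii), write A = sum_i (sum_j |x_ij|^q)^(r/q) and B = sum_i (sum_j |T x_ij|^p)^(r/p).
  With the r-convexity of X and the r-concavity of Y, (ii) says that the set of all triples (u, v, c)
  with u <= sum_k |a_k|^r - A, v <= B - sum_l |b_l|^r + t e^r and
  c >= K1 sum_k ||a_k||^r - sum_l ||b_l||^r + K2 t is a convex cone that contains no (0, 0, c) with
  c < 0, where e is a weak unit of Y.  By Hahn-Banach there are positive functionals l and m with
  l(u) + m(v) <= c on the cone, that is, l(|a|^r) <= K1 ||a||^r, m(|b|^r) >= ||b||^r and
  m(B) <= l(A).  Order continuity of X makes l an integral with a density f^r.  The functional m is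
  replaced by its countably additive part, an integral with a density d: it is smaller, but the norm
  of Y is order continuous, so that it still dominates ||b||^r.  Hence g = d^(-1/r) multiplies L_r
  into Y, and the map from f x to d^(1/r) T x extends by approximation to a (p,q)-regular operator
  on L_r.
*)

theory Submission
  imports Defs
begin

section \<open>Hahn-Banach for spaces of functions\<close>

text \<open>The functional on the \<open>Y\<close> side must be large on all powers
  \<open>|b|^r\<close>, and concavity of \<open>Y\<close> gives no upper bound for it there. It is
  therefore built only on the ideal generated by the sums \<open>B\<close> and by
  \<open>e^r\<close>, where every function has a finite price in the cone. The summand
  \<open>t e^r\<close> is present so that this ideal has a weak unit, which lets the lower bound be
  tested on every \<open>y\<close> bounded by a multiple of \<open>e\<close>. Its price
  \<open>K2 t\<close> reflects that \<open>e\<close> has finite norm.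

  Finite families \<open>a_k\<close>, \<open>b_l\<close> and matrices of arbitrary size enter
  because they can be concatenated, so that the cone is convex without any renorming; convexity and
  concavity of the two norms then turn a family back into one function. The factor
  \<open>2^r\<close> in both constants comes from \<open>(a + b)^r \<le> 2^r (a^r + b^r)\<close>.

  No continuity of the second functional is known. Its singular part can be discarded because the
  two inequalities imposed on it are of opposite kind: the upper one survives any decrease, and the
  lower one concerns a norm that can be approximated by truncation to sets on which the singular
  part is negligible.\<close>

definition fun_subspace :: "('c \<Rightarrow> real) set \<Rightarrow> bool" where
  "fun_subspace V \<longleftrightarrow> (\<lambda>_. 0) \<in> V \<and> (\<forall>u\<in>V. \<forall>v\<in>V. (\<lambda>w. u w + v w) \<in> V) \<and>
     (\<forall>u\<in>V. \<forall>a. (\<lambda>w. a * u w) \<in> V)"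

definition linear_on_fun :: "('c \<Rightarrow> real) set \<Rightarrow> (('c \<Rightarrow> real) \<Rightarrow> real) \<Rightarrow> bool" where
  "linear_on_fun V m \<longleftrightarrow> (\<forall>u\<in>V. \<forall>v\<in>V. m (\<lambda>w. u w + v w) = m u + m v) \<and>
     (\<forall>u\<in>V. \<forall>a. m (\<lambda>w. a * u w) = a * m u)"

definition sublinear_on_fun :: "('c \<Rightarrow> real) set \<Rightarrow> (('c \<Rightarrow> real) \<Rightarrow> real) \<Rightarrow> bool" where
  "sublinear_on_fun V p \<longleftrightarrow> (\<forall>u\<in>V. \<forall>v\<in>V. p (\<lambda>w. u w + v w) \<le> p u + p v) \<and>
     (\<forall>u\<in>V. \<forall>a\<ge>0. p (\<lambda>w. a * u w) = a * p u)"

lemma sublinear_on_funD: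
  assumes "sublinear_on_fun V p"
  shows "\<And>u v. u \<in> V \<Longrightarrow> v \<in> V \<Longrightarrow> p (\<lambda>w. u w + v w) \<le> p u + p v"
    and "\<And>u a. u \<in> V \<Longrightarrow> 0 \<le> a \<Longrightarrow> p (\<lambda>w. a * u w) = a * p u"
  using assms unfolding sublinear_on_fun_def by auto

lemma fun_subspaceD:
  assumes "fun_subspace V"
  shows "(\<lambda>_. 0) \<in> V"
    and "\<And>u v. u \<in> V \<Longrightarrow> v \<in> V \<Longrightarrow> (\<lambda>w. u w + v w) \<in> V"
    and "\<And>u a. u \<in> V \<Longrightarrow> (\<lambda>w. a * u w) \<in> V"
  using assms unfolding fun_subspace_def by auto

lemma fun_subspace_neg:
  assumes "fun_subspace V" "u \<in> V"
  shows "(\<lambda>w. - u w) \<in> V"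
  using fun_subspaceD(3)[OF assms, of "-1"] by simp

lemma linear_on_funD:
  assumes "linear_on_fun V m"
  shows "\<And>u v. u \<in> V \<Longrightarrow> v \<in> V \<Longrightarrow> m (\<lambda>w. u w + v w) = m u + m v"
    and "\<And>u a. u \<in> V \<Longrightarrow> m (\<lambda>w. a * u w) = a * m u"
  using assms unfolding linear_on_fun_def by auto

lemma sublinear_on_fun_neg:
  assumes "fun_subspace V" "sublinear_on_fun V p" "u \<in> V"
  shows "- p (\<lambda>w. - u w) \<le> p u"
proof -
  have "p (\<lambda>w. 0 * u w) = 0 * p u" by (rule sublinear_on_funD(2)[OF assms(2,3)]) simp
  then show ?thesis
    using sublinear_on_funD(1)[OF assms(2,3) fun_subspace_neg[OF assms(1,3)]] by simp
qed

text \<open>A minimal sublinear functional is linear, so no extension from subspaces is needed.\<close>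

lemma hahn_banach_fun:
  assumes V: "fun_subspace V" and S: "sublinear_on_fun V S"
  obtains m where "linear_on_fun V m" "\<And>u. u \<in> V \<Longrightarrow> m u \<le> S u"
proof -
  have V0: "(\<lambda>_. 0) \<in> V" and Vadd: "\<And>u v. u \<in> V \<Longrightarrow> v \<in> V \<Longrightarrow> (\<lambda>w. u w + v w) \<in> V"
    and Vsc: "\<And>u a. u \<in> V \<Longrightarrow> (\<lambda>w. a * u w) \<in> V"
    using fun_subspaceD[OF V] by auto
  note Vneg = fun_subspace_neg[OF V]
  \<comment> \<open>Values off \<open>V\<close> are pinned to 0, so that comparing two candidates as
    total functions amounts to comparing them on \<open>V\<close>.\<close>
  define A where "A = {p. sublinear_on_fun V p \<and> (\<forall>u\<in>V. p u \<le> S u) \<and> (\<forall>u. u \<notin> V \<longrightarrow> p u = 0)}"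
  \<comment> \<open>The order is reversed: the maximal element supplied by Zorn's lemma is a minimal
    sublinear functional.\<close>
  let ?P = "\<lambda>p q :: ('a \<Rightarrow> real) \<Rightarrow> real. q \<le> p"
  have "\<exists>m\<in>A. \<forall>a\<in>A. ?P m a \<longrightarrow> a = m"
  proof (rule predicate_Zorn)
    show "partial_order_on A (relation_of ?P A)"
      by (intro partial_order_on_relation_ofI) auto
    fix C assume "C \<in> Chains (relation_of ?P A)"
    then have CA: "C \<subseteq> A" and ch: "\<And>p q. p \<in> C \<Longrightarrow> q \<in> C \<Longrightarrow> p \<le> q \<or> q \<le> p"
      unfolding Chains_def relation_of_def by auto
    define S0 where "S0 = (\<lambda>u. if u \<in> V then S u else 0)"
    have S0: "S0 \<in> A"
      using S Vadd Vsc unfolding A_def S0_def sublinear_on_fun_def by auto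
    show "\<exists>u\<in>A. \<forall>a\<in>C. u \<le> a"
    proof (cases "C = {}")
      case True
      then show ?thesis using S0 by auto
    next
      case ne: False
      define q where "q = (\<lambda>u. if u \<in> V then (INF p\<in>C. p u) else 0)"
      \<comment> \<open>Sublinearity at \<open>u\<close> and \<open>-u\<close> bounds every member
        of the chain from below by the same number, so the infimum is a real one.\<close>
      have bd: "bdd_below ((\<lambda>p. p u) ` C)" if "u \<in> V" for u
      proof (rule bdd_belowI2)
        fix p assume "p \<in> C"
        then have p: "sublinear_on_fun V p" "p (\<lambda>w. - u w) \<le> S (\<lambda>w. - u w)"
          using CA Vneg[OF that] unfolding A_def by auto
        show "- S (\<lambda>w. - u w) \<le> p u" using sublinear_on_fun_neg[OF V p(1) that] p(2) by linarith
      qed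
      have qle: "q u \<le> p u" if "u \<in> V" "p \<in> C" for u p
        using that bd unfolding q_def by (auto intro: cINF_lower)
      have qge: "c \<le> q u" if "u \<in> V" "\<And>p. p \<in> C \<Longrightarrow> c \<le> p u" for u c
        using that ne unfolding q_def by (auto intro: cINF_greatest)
      have "q (\<lambda>w. u w + v w) \<le> q u + q v" if u: "u \<in> V" and v: "v \<in> V" for u v
      proof -
        have "q (\<lambda>w. u w + v w) \<le> p1 u + p2 v" if p: "p1 \<in> C" "p2 \<in> C" for p1 p2
        proof -
          \<comment> \<open>The smaller of \<open>p1\<close> and \<open>p2\<close> serves both
            summands. This is the only place where \<open>C\<close> has to be a chain.\<close>
          obtain p where "p \<in> C" "p u \<le> p1 u" "p v \<le> p2 v"
            using ch[OF p] p by (auto simp: le_fun_def)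
          moreover from this have "p (\<lambda>w. u w + v w) \<le> p u + p v"
            using CA u v unfolding A_def sublinear_on_fun_def by auto
          ultimately show ?thesis using qle[OF Vadd[OF u v], of p] by linarith
        qed
        then have "q (\<lambda>w. u w + v w) - p2 v \<le> q u" if "p2 \<in> C" for p2
          using that by (intro qge u) (simp add: algebra_simps)
        then have "q (\<lambda>w. u w + v w) - q u \<le> q v" by (intro qge v) (simp add: algebra_simps)
        then show ?thesis by simp
      qed
      moreover have "q (\<lambda>w. a * u w) = a * q u" if u: "u \<in> V" and a: "a \<ge> 0" for u a
      proof -
        have hom: "p (\<lambda>w. a * u w) = a * p u" if "p \<in> C" "u \<in> V" "a \<ge> 0" for p u a
          using that CA unfolding A_def sublinear_on_fun_def by auto
        \<comment> \<open>One inequality is enough: applied to \<open>inverse a\<close> it yields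
          the other.\<close>
        have le: "a * q u \<le> q (\<lambda>w. a * u w)" if "u \<in> V" "a \<ge> 0" for u a
          by (intro qge Vsc that) (subst hom, use that qle in \<open>auto simp: mult_left_mono\<close>)
        have zero: "q (\<lambda>_. 0) = 0"
          using le[OF V0, of 0] hom[OF _ V0, of _ 0] qle[OF V0] ne by fastforce
        show ?thesis
        proof (cases "a = 0")
          case False
          have "q (\<lambda>w. a * u w) = a * (inverse a * q (\<lambda>w. a * u w))" using False by simp
          also have "\<dots> \<le> a * q (\<lambda>w. inverse a * (a * u w))"
            using le[OF Vsc[OF u], of "inverse a"] a by (intro mult_left_mono) auto
          also have "(\<lambda>w. inverse a * (a * u w)) = u" using False by auto
          finally show ?thesis using le[OF u a] by simp
        qed (simp add: zero)
      qed
      moreover have "q u \<le> S u" if "u \<in> V" for u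
      proof -
        obtain p where "p \<in> C" using ne by auto
        then show ?thesis using qle[OF that] CA that unfolding A_def by fastforce
      qed
      ultimately have "q \<in> A" unfolding A_def sublinear_on_fun_def by (auto simp: q_def)
      moreover have "q \<le> p" if "p \<in> C" for p
        using qle[OF _ that] CA that unfolding A_def le_fun_def by (auto simp: q_def)
      ultimately show ?thesis by auto
    qed
  qed
  then obtain p where pA: "p \<in> A" and min: "\<And>q. q \<in> A \<Longrightarrow> q \<le> p \<Longrightarrow> q = p" by auto
  have psub: "\<And>u v. u \<in> V \<Longrightarrow> v \<in> V \<Longrightarrow> p (\<lambda>w. u w + v w) \<le> p u + p v"
    and phom: "\<And>u a. u \<in> V \<Longrightarrow> a \<ge> 0 \<Longrightarrow> p (\<lambda>w. a * u w) = a * p u"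
    and pS: "\<And>u. u \<in> V \<Longrightarrow> p u \<le> S u" and pout: "\<And>u. u \<notin> V \<Longrightarrow> p u = 0"
    and psl: "sublinear_on_fun V p"
    using pA unfolding A_def sublinear_on_fun_def by auto
  have p0: "p (\<lambda>_. 0) = 0" using phom[OF V0, of 0] by simp
  have super: "p u + p v \<le> p (\<lambda>w. u w + v w)" if uV: "u \<in> V" and vV: "v \<in> V" for u v
  proof -
    \<comment> \<open>\<open>p\<close> is lowered along the ray spanned by \<open>v\<close>. The
      term \<open>t = 0\<close> gives \<open>q \<le> p\<close>, the term \<open>t = 1\<close> gives
      \<open>q u \<le> p (u + v) - p v\<close>. Since \<open>q\<close> is again sublinear and below
      \<open>S\<close>, minimality forces \<open>q = p\<close>, and the second bound becomes
      superadditivity of \<open>p\<close>.\<close>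
    define q where "q = (\<lambda>x. if x \<in> V then (INF t\<in>{0..}. p (\<lambda>w. x w + t * v w) - t * p v) else 0)"
    have bdl: "- p (\<lambda>w. - x w) \<le> p (\<lambda>w. x w + t * v w) - t * p v" if "x \<in> V" "t \<ge> 0" for x t
      using psub[OF Vadd[OF that(1) Vsc[OF vV, of t]] Vneg[OF that(1)]] phom[OF vV that(2)] by simp
    have bd: "bdd_below ((\<lambda>t. p (\<lambda>w. x w + t * v w) - t * p v) ` {0..})" if "x \<in> V" for x
      using bdl[OF that] by (intro bdd_belowI2) auto
    have qle: "q x \<le> p (\<lambda>w. x w + t * v w) - t * p v" if "x \<in> V" "t \<ge> 0" for x t
      using that bd unfolding q_def by (auto intro!: cINF_lower)
    have qge: "c \<le> q x" if "x \<in> V" "\<And>t. t \<ge> 0 \<Longrightarrow> c \<le> p (\<lambda>w. x w + t * v w) - t * p v" for x c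
      using that unfolding q_def by (auto intro!: cINF_greatest)
    have qp: "q x \<le> p x" if "x \<in> V" for x using qle[OF that, of 0] by simp
    have "q (\<lambda>w. x w + y w) \<le> q x + q y" if x: "x \<in> V" and y: "y \<in> V" for x y
    proof -
      have "q (\<lambda>w. x w + y w) \<le>
        (p (\<lambda>w. x w + s * v w) - s * p v) + (p (\<lambda>w. y w + t * v w) - t * p v)"
        if st: "s \<ge> 0" "t \<ge> 0" for s t
      proof -
        have "(\<lambda>w. x w + y w + (s + t) * v w) = (\<lambda>w. (x w + s * v w) + (y w + t * v w))"
          by (auto simp: algebra_simps)
        then show ?thesis
          using psub[OF Vadd[OF x Vsc[OF vV, of s]] Vadd[OF y Vsc[OF vV, of t]]]
            qle[OF Vadd[OF x y], of "s + t"] st by (simp add: algebra_simps)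
      qed
      note le = this
      have "q (\<lambda>w. x w + y w) - (p (\<lambda>w. y w + t * v w) - t * p v) \<le> q x" if t: "t \<ge> 0" for t
      proof (rule qge[OF x])
        fix s :: real assume "s \<ge> 0"
        from le[OF this t]
        show "q (\<lambda>w. x w + y w) - (p (\<lambda>w. y w + t * v w) - t * p v) \<le>
          p (\<lambda>w. x w + s * v w) - s * p v"
          by linarith
      qed
      note le2 = this
      have "q (\<lambda>w. x w + y w) - q x \<le> q y"
      proof (rule qge[OF y])
        fix t :: real assume "t \<ge> 0"
        from le2[OF this] show "q (\<lambda>w. x w + y w) - q x \<le> p (\<lambda>w. y w + t * v w) - t * p v"
          by linarith
      qed
      then show ?thesis by simp
    qed
    moreover have "q (\<lambda>w. a * x w) = a * q x" if x: "x \<in> V" and a: "a \<ge> 0" for x a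
    proof -
      have q0: "q (\<lambda>_. 0) = 0"
      proof (rule antisym)
        show "0 \<le> q (\<lambda>_. 0)" using phom[OF vV] by (intro qge V0) simp
      qed (use qp[OF V0] p0 in simp)
      have le: "q (\<lambda>w. a * x w) \<le> a * q x" if x: "x \<in> V" and a: "a > 0" for x a
      proof -
        have "inverse a * q (\<lambda>w. a * x w) \<le> q x"
        proof (rule qge[OF x])
          fix t :: real assume t: "t \<ge> 0"
          have "(\<lambda>w. a * x w + (a * t) * v w) = (\<lambda>w. a * (x w + t * v w))"
            by (auto simp: algebra_simps)
          then have "q (\<lambda>w. a * x w) \<le> a * (p (\<lambda>w. x w + t * v w) - t * p v)"
            using qle[OF Vsc[OF x], of "a * t" a] phom[OF Vadd[OF x Vsc[OF vV, of t]], of a] a t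
            by (simp add: algebra_simps)
          then show "inverse a * q (\<lambda>w. a * x w) \<le> p (\<lambda>w. x w + t * v w) - t * p v"
            using a by (simp add: field_simps)
        qed
        then show ?thesis using a by (simp add: field_simps)
      qed
      show ?thesis
      proof (cases "a = 0")
        case False
        then have a': "a > 0" using a by simp
        have "(\<lambda>w. inverse a * (a * x w)) = x" using False by auto
        then have "q x \<le> inverse a * q (\<lambda>w. a * x w)"
          using le[OF Vsc[OF x, of a], of "inverse a"] a' by simp
        then show ?thesis using le[OF x a'] a' by (simp add: field_simps)
      qed (simp add: q0)
    qed
    moreover have "q x \<le> S x" if "x \<in> V" for x using qp[OF that] pS[OF that] by simp
    ultimately have "q \<in> A" unfolding A_def sublinear_on_fun_def by (auto simp: q_def)
    moreover have "q \<le> p" using qp pout unfolding le_fun_def by (metis q_def order_refl)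
    ultimately have "q = p" by (rule min)
    then show ?thesis using qle[OF uV, of 1] by simp
  qed
  have add: "p (\<lambda>w. u w + v w) = p u + p v" if "u \<in> V" "v \<in> V" for u v
    using super[OF that] psub[OF that] by simp
  have neg: "p (\<lambda>w. - u w) = - p u" if "u \<in> V" for u
    using add[OF that Vneg[OF that]] p0 by simp
  have "p (\<lambda>w. a * u w) = a * p u" if "u \<in> V" for u a
  proof (cases "a \<ge> 0")
    case False
    then show ?thesis using phom[OF that, of "-a"] neg[OF Vsc[OF that, of a]] by simp
  qed (use phom[OF that] in auto)
  then have "linear_on_fun V p" using add unfolding linear_on_fun_def by auto
  then show ?thesis using pS that by blast
qed

text \<open>\<open>S v\<close>, the least price at which \<open>v\<close> occurs in
  \<open>C\<close>, is sublinear because \<open>C\<close> is a convex cone. It is finite because a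
  price of \<open>v\<close> and a price of \<open>-v\<close> add up to a price of 0, which
  \<open>pos\<close> makes nonnegative. A linear minorant of \<open>S\<close> does the job.\<close>

lemma cone_functional:
  assumes V: "fun_subspace V"
    and total: "\<And>v. v \<in> V \<Longrightarrow> \<exists>c. (v, c) \<in> C"
    and zero: "(\<lambda>_. 0, 0) \<in> C"
    and add: "\<And>u v a b. (u, a) \<in> C \<Longrightarrow> (v, b) \<in> C \<Longrightarrow> (\<lambda>w. u w + v w, a + b) \<in> C"
    and scale: "\<And>u a t. (u, a) \<in> C \<Longrightarrow> t > 0 \<Longrightarrow> (\<lambda>w. t * u w, t * a) \<in> C"
    and pos: "\<And>c. (\<lambda>_. 0, c) \<in> C \<Longrightarrow> 0 \<le> c"
  obtains m where "linear_on_fun V m" "\<And>v c. v \<in> V \<Longrightarrow> (v, c) \<in> C \<Longrightarrow> m v \<le> c"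
proof -
  note Vneg = fun_subspace_neg[OF V]
  define S where "S v = Inf {c. (v, c) \<in> C}" for v
  have bd: "bdd_below {c. (v, c) \<in> C}" if v: "v \<in> V" for v
  proof -
    obtain c' where c': "(\<lambda>w. - v w, c') \<in> C" using total[OF Vneg[OF v]] by auto
    have "- c' \<le> c" if "(v, c) \<in> C" for c
      using pos[of "c + c'"] add[OF that c'] by simp
    then show ?thesis by (intro bdd_belowI[of _ "-c'"]) auto
  qed
  have le: "S v \<le> c" if "v \<in> V" "(v, c) \<in> C" for v c
    unfolding S_def using bd that by (intro cInf_lower) auto
  have ge: "c \<le> S v" if "v \<in> V" "\<And>d. (v, d) \<in> C \<Longrightarrow> c \<le> d" for v c
    unfolding S_def using total that by (intro cInf_greatest) auto
  have V0: "(\<lambda>_. 0) \<in> V" and Vadd: "\<And>u v. u \<in> V \<Longrightarrow> v \<in> V \<Longrightarrow> (\<lambda>w. u w + v w) \<in> V"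
    and Vsc: "\<And>u a. u \<in> V \<Longrightarrow> (\<lambda>w. a * u w) \<in> V"
    using V unfolding fun_subspace_def by auto
  have S0: "S (\<lambda>_. 0) = 0" using le[OF V0 zero] ge[OF V0 pos] by fastforce
  have "S (\<lambda>w. u w + v w) \<le> S u + S v" if u: "u \<in> V" and v: "v \<in> V" for u v
  proof -
    have "S (\<lambda>w. u w + v w) - b \<le> S u" if "(v, b) \<in> C" for b
      by (intro ge[OF u]) (use le[OF Vadd[OF u v] add[OF _ that]] in \<open>simp add: algebra_simps\<close>)
    then have "S (\<lambda>w. u w + v w) - S u \<le> S v" by (intro ge[OF v]) (simp add: algebra_simps)
    then show ?thesis by simp
  qed
  moreover have "S (\<lambda>w. a * u w) = a * S u" if u: "u \<in> V" and "a \<ge> 0" for u a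
  proof (cases "a = 0")
    case False
    then have a: "a > 0" using that by simp
    have half: "S (\<lambda>w. a * u w) \<le> a * S u" if u: "u \<in> V" and a: "a > 0" for u a
    proof -
      have "inverse a * S (\<lambda>w. a * u w) \<le> S u"
      proof (rule ge[OF u])
        fix d assume "(u, d) \<in> C"
        then have "S (\<lambda>w. a * u w) \<le> a * d" by (intro le[OF Vsc[OF u] scale] a)
        then show "inverse a * S (\<lambda>w. a * u w) \<le> d" using a by (simp add: field_simps)
      qed
      then show ?thesis using a by (simp add: field_simps)
    qed
    have "(\<lambda>w. inverse a * (a * u w)) = u" using False by auto
    then have "S u \<le> inverse a * S (\<lambda>w. a * u w)"
      using half[OF Vsc[OF u, of a], of "inverse a"] a by simp
    then show ?thesis using half[OF u a] a by (simp add: field_simps)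
  qed (simp add: S0)
  ultimately have "sublinear_on_fun V S" unfolding sublinear_on_fun_def by auto
  then obtain m where "linear_on_fun V m" "\<And>u. u \<in> V \<Longrightarrow> m u \<le> S u"
    using hahn_banach_fun[OF V] by blast
  then show ?thesis using that le order_trans by blast
qed

section \<open>The normal part of a positive functional\<close>

definition fun_ideal :: "'a measure \<Rightarrow> ('a \<Rightarrow> real) set \<Rightarrow> bool" where
  "fun_ideal M F \<longleftrightarrow> fun_subspace F \<and> F \<subseteq> borel_measurable M \<and>
     (\<forall>v\<in>F. \<forall>u\<in>borel_measurable M. (AE w in M. \<bar>u w\<bar> \<le> \<bar>v w\<bar>) \<longrightarrow> u \<in> F)"

text \<open>The support is maximal within \<open>F\<close>, not in the whole measure space: where
  \<open>e\<close> vanishes, every element of \<open>F\<close> vanishes, and this is all that can be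
  asked of a space without full support.\<close>

definition weak_unit :: "'a measure \<Rightarrow> ('a \<Rightarrow> real) set \<Rightarrow> ('a \<Rightarrow> real) \<Rightarrow> bool" where
  "weak_unit M F e \<longleftrightarrow> e \<in> F \<and> (\<forall>w. 0 \<le> e w) \<and> (\<forall>v\<in>F. AE w in M. e w = 0 \<longrightarrow> v w = 0)"

locale positive_functional = sigma_finite_measure M for M :: "'a measure" +
  fixes F :: "('a \<Rightarrow> real) set" and e :: "'a \<Rightarrow> real" and m :: "('a \<Rightarrow> real) \<Rightarrow> real"
  assumes ideal: "fun_ideal M F"
    and unit: "weak_unit M F e"
    and linear: "linear_on_fun F m"
    and pos: "\<And>v. v \<in> F \<Longrightarrow> AE w in M. 0 \<le> v w \<Longrightarrow> 0 \<le> m v"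
begin

lemma F_subspace: "fun_subspace F" using ideal unfolding fun_ideal_def by simp
lemmas F_zero = fun_subspaceD(1)[OF F_subspace]
lemmas F_add = fun_subspaceD(2)[OF F_subspace]
lemmas F_scale = fun_subspaceD(3)[OF F_subspace]
lemmas m_add = linear_on_funD(1)[OF linear]
lemmas m_scale = linear_on_funD(2)[OF linear]

lemma F_meas: "v \<in> F \<Longrightarrow> v \<in> borel_measurable M" using ideal unfolding fun_ideal_def by auto

lemma F_ideal: "v \<in> F \<Longrightarrow> u \<in> borel_measurable M \<Longrightarrow> AE w in M. \<bar>u w\<bar> \<le> \<bar>v w\<bar> \<Longrightarrow> u \<in> F"
  using ideal unfolding fun_ideal_def by auto

lemma F_indicator: "v \<in> F \<Longrightarrow> A \<in> sets M \<Longrightarrow> (\<lambda>w. indicator A w * v w) \<in> F"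
proof (rule F_ideal[of v])
  assume v: "v \<in> F" and A [measurable]: "A \<in> sets M"
  have [measurable]: "v \<in> borel_measurable M" by (rule F_meas[OF v])
  show "(\<lambda>w. indicator A w * v w) \<in> borel_measurable M" by measurable
qed (auto split: split_indicator)

lemma e_F: "e \<in> F" and e_nonneg: "0 \<le> e w" and e_unit: "v \<in> F \<Longrightarrow> AE w in M. e w = 0 \<longrightarrow> v w = 0"
  using unit unfolding weak_unit_def by auto

lemma e_meas [measurable]: "e \<in> borel_measurable M" by (rule F_meas[OF e_F])

lemma m_mono:
  assumes u: "u \<in> F" and v: "v \<in> F" and le: "AE w in M. u w \<le> v w"
  shows "m u \<le> m v"
proof -
  have d: "(\<lambda>w. v w + (-1) * u w) \<in> F" by (intro F_add F_scale u v)
  have "0 \<le> m (\<lambda>w. v w + (-1) * u w)" by (rule pos[OF d]) (use le in auto)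
  also have "\<dots> = m v - m u" using m_add[OF v F_scale[OF u, of "-1"]] m_scale[OF u, of "-1"] by simp
  finally show ?thesis by simp
qed

lemma F_sum: "finite I \<Longrightarrow> (\<And>i. i \<in> I \<Longrightarrow> h i \<in> F) \<Longrightarrow> (\<lambda>w. \<Sum>i\<in>I. c i * h i w) \<in> F"
  by (induction I rule: finite_induct) (auto intro!: F_zero F_add F_scale)

lemma m_zero: "m (\<lambda>_. 0) = 0" using m_scale[OF F_zero, of 0] by simp

lemma m_sum:
  "finite I \<Longrightarrow> (\<And>i. i \<in> I \<Longrightarrow> h i \<in> F) \<Longrightarrow> m (\<lambda>w. \<Sum>i\<in>I. c i * h i w) = (\<Sum>i\<in>I. c i * m (h i))"
  by (induction I rule: finite_induct) (simp_all add: m_zero m_add F_sum F_scale m_scale)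

text \<open>The weight \<open>e\<close> gives every measurable set a finite value, although
  indicators themselves need not lie in \<open>F\<close>.\<close>

definition content :: "'a set \<Rightarrow> ennreal" where
  "content A = ennreal (m (\<lambda>w. indicator A w * e w))"

lemma content_nonneg: "A \<in> sets M \<Longrightarrow> 0 \<le> m (\<lambda>w. indicator A w * e w)"
  by (intro pos F_indicator e_F) (auto simp: e_nonneg)

lemma content_positive: "positive (sets M) content"
  by (simp add: positive_def content_def m_zero)

lemma content_increasing: "increasing (sets M) content"
  unfolding increasing_def content_def
  by (auto intro!: ennreal_leI m_mono F_indicator e_F AE_I2 simp: e_nonneg split: split_indicator)

lemma content_additive: "additive (sets M) content"
proof -
  have "m (\<lambda>w. indicator (A \<union> B) w * e w) =
    m (\<lambda>w. indicator A w * e w) + m (\<lambda>w. indicator B w * e w)"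
    if "A \<in> sets M" "B \<in> sets M" "A \<inter> B = {}" for A B
  proof -
    have "(\<lambda>w. indicator (A \<union> B) w * e w) = (\<lambda>w. indicator A w * e w + indicator B w * e w)"
      using that(3) by (auto simp: indicator_def fun_eq_iff)
    then show ?thesis using m_add F_indicator[OF e_F] that by simp
  qed
  then show ?thesis
    unfolding additive_def content_def by (auto simp: content_nonneg ennreal_plus)
qed

text \<open>\<open>content\<close> is only finitely additive, but every measurable set splits every cover additively, so
  the outer measure that it generates is countably additive on \<open>sets M\<close>.\<close>

definition normal_measure :: "'a measure" where
  "normal_measure = measure_of (space M) (sets M) (outer_measure (sets M) content)"

lemma emeasure_normal:
  assumes "A \<in> sets M"
  shows "emeasure normal_measure A = outer_measure (sets M) content A"
proof -
  have "measure_space (space M) (sets M) (outer_measure (sets M) content)"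
    by (rule measure_down[OF sigma_algebra.caratheodory_lemma[OF sigma_algebra_Pow
            sets.outer_measure_space_outer_measure[OF content_positive content_increasing]]
          sets.sigma_algebra_axioms
          sets.algebra_subset_lambda_system[OF content_positive content_increasing
            content_additive]])
  then show ?thesis
    using assms unfolding normal_measure_def measure_space_def
    by (intro emeasure_measure_of_sigma) (auto simp: sets.sigma_algebra_axioms)
qed

lemma sets_normal [simp]: "sets normal_measure = sets M"
  and space_normal [simp]: "space normal_measure = space M"
  unfolding normal_measure_def by (auto simp: sets.sigma_sets_eq sets.space_closed space_measure_of)

lemma normal_le_content:
  assumes "A \<in> sets M"
  shows "emeasure normal_measure A \<le> content A"
proof -
  have "outer_measure (sets M) content A \<le> (\<Sum>i. content (if i = (0::nat) then A else {}))"
    using assms by (intro sets.outer_measure_le[OF content_positive content_increasing]) (auto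
      split: if_splits)
  also have "\<dots> = content A" 
    using positiveD1[OF content_positive] by (subst suminf_finite[of "{0}"]) auto
  finally show ?thesis using emeasure_normal[OF assms] by simp
qed

text \<open>Monotonicity of \<open>m\<close> refers to the a.e. order, so \<open>content\<close>,
  and with it the smaller measure, vanishes on null sets and Radon-Nikodym applies. The density is
  finite a.e. because its integral is at most the finite number
  \<open>content (space M)\<close>.\<close>

lemma ex_density:
  obtains D where "D \<in> borel_measurable M"
    "\<And>A. A \<in> sets M \<Longrightarrow> (\<integral>\<^sup>+w. D w * indicator A w \<partial>M) = emeasure normal_measure A"
    "AE w in M. D w < \<infinity>"
proof -
  have "absolutely_continuous M normal_measure"
  proof (unfold absolutely_continuous_def, rule subsetI)
    fix A assume A: "A \<in> null_sets M"
    then have AM: "A \<in> sets M" by auto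
    have "AE w in M. indicator A w * e w \<le> (0 :: real)"
      using AE_not_in[OF A] by eventually_elim auto
    then have "content A = 0"
      using m_mono[OF F_indicator[OF e_F AM] F_zero] m_zero unfolding content_def
      by (simp add: ennreal_eq_0_iff)
    then show "A \<in> null_sets normal_measure"
      using normal_le_content[OF AM] AM by (auto simp: null_sets_def)
  qed
  from Radon_Nikodym[OF this] obtain D
    where D: "D \<in> borel_measurable M" "density M D = normal_measure"
    by auto
  then have eq: "(\<integral>\<^sup>+w. D w * indicator A w \<partial>M) = emeasure normal_measure A" if "A \<in> sets M" for A
    using emeasure_density[OF D(1) that] by simp
  have "(\<integral>\<^sup>+w. D w \<partial>M) = (\<integral>\<^sup>+w. D w * indicator (space M) w \<partial>M)"
    by (intro nn_integral_cong) simp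
  also have "\<dots> \<le> content (space M)" using eq[of "space M"] normal_le_content[of "space M"] by simp
  also have "\<dots> < \<infinity>" by (simp add: content_def)
  finally have "AE w in M. D w \<noteq> \<infinity>" using D(1) by (intro nn_integral_PInf_AE) auto
  then have "AE w in M. D w < \<infinity>" by eventually_elim (simp add: less_top)
  with eq D(1) that show ?thesis by blast
qed


text \<open>The level sets of \<open>v / e\<close> compare both sides with sums of \<open>normal_measure\<close>: on a level set
  of height \<open>j * \<delta>\<close> one has \<open>j * \<delta> * e \<le> v \<le> (j + 1) * \<delta> * e\<close>.\<close>

lemma level_sets:
  assumes v: "v \<in> F" "AE w in M. 0 \<le> v w" and \<delta>: "\<delta> > 0"
  obtains A :: "nat \<Rightarrow> 'a set" where "range A \<subseteq> sets M" "disjoint_family A"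
    "\<And>j w. w \<in> A j \<Longrightarrow> real j * \<delta> * e w \<le> v w \<and> v w \<le> (real j + 1) * \<delta> * e w \<and> 0 < e w"
    "AE w in M. w \<notin> (\<Union>j. A j) \<longrightarrow> v w = 0 \<and> e w = 0"
proof -
  have [measurable]: "v \<in> borel_measurable M" using F_meas v by simp
  define A where "A j = {w \<in> space M. 0 < e w \<and> real j * \<delta> * e w \<le> v w \<and>
    v w < (real j + 1) * \<delta> * e w}" for j :: nat
  have "disjoint_family A"
  proof -
    have "False" if w: "w \<in> A i" "w \<in> A j" "i < j" for w i j
    proof -
      have "(real i + 1) * \<delta> * e w \<le> real j * \<delta> * e w"
        using that \<delta> by (intro mult_right_mono) (auto simp: A_def)
      then show False using w by (auto simp: A_def)
    qed
    then show ?thesis unfolding disjoint_family_on_def by (metis disjoint_iff linorder_neqE_nat)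
  qed
  moreover have "AE w in M. w \<notin> (\<Union>j. A j) \<longrightarrow> v w = 0 \<and> e w = 0"
    using v(2) e_unit[OF v(1)] AE_space
  proof eventually_elim
    case (elim w)
    have "w \<in> (\<Union>j. A j)" if "e w \<noteq> 0"
    proof -
      have e: "0 < e w" using that e_nonneg[of w] by simp
      define j where "j = nat \<lfloor>v w / (\<delta> * e w)\<rfloor>"
      have "real j \<le> v w / (\<delta> * e w)" "v w / (\<delta> * e w) < real j + 1"
        unfolding j_def using elim(1) e \<delta> by (auto simp: of_nat_nat)
      then have "w \<in> A j" using e \<delta> elim(3) by (simp add: A_def field_simps)
      then show ?thesis by auto
    qed
    then show ?case using elim by auto
  qed
  ultimately show ?thesis by (intro that[of A]) (auto simp: A_def)
qed

text \<open>The integral part in the Yosida-Hewitt decomposition of \<open>m\<close>. The last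
  property stands in for singularity of the remainder: the outer measure is an infimum over
  countable covers, so the level sets of \<open>v\<close> have covers whose total content is close
  to their measure, and the first \<open>k\<close> covering sets control \<open>m\<close> on
  \<open>G k\<close>.\<close>

theorem normal_part:
  obtains d where "d \<in> borel_measurable M" "\<And>w. 0 \<le> d w" "\<And>w. e w = 0 \<Longrightarrow> d w = 0"
    "\<And>v. v \<in> F \<Longrightarrow> AE w in M. 0 \<le> v w \<Longrightarrow> (\<integral>\<^sup>+w. ennreal (v w * d w) \<partial>M) \<le> ennreal (m v)"
    "\<And>v \<epsilon>. v \<in> F \<Longrightarrow> AE w in M. 0 \<le> v w \<Longrightarrow> \<epsilon> > 0 \<Longrightarrow>
       \<exists>G. range G \<subseteq> sets M \<and> incseq G \<and> (\<Union>k. G k) = space M \<and>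
         (\<forall>k::nat. ennreal (m (\<lambda>w. indicator (G k) w * v w)) \<le> (\<integral>\<^sup>+w. ennreal (v w * d w) \<partial>M) +
           ennreal \<epsilon>)"
proof -
  let ?N = "emeasure normal_measure"
  obtain D where D [measurable]: "D \<in> borel_measurable M"
    and DN: "\<And>A. A \<in> sets M \<Longrightarrow> (\<integral>\<^sup>+w. D w * indicator A w \<partial>M) = ?N A"
    and Dfin: "AE w in M. D w < \<infinity>" using ex_density by blast
  define d where "d w = (if e w = 0 then 0 else enn2real (D w) / e w)" for w
  have d_meas [measurable]: "d \<in> borel_measurable M" unfolding d_def by measurable
  have me: "content (space M) = ennreal (m e)"
  proof -
    have "m (\<lambda>w. indicator (space M) w * e w) = m e"
      by (intro antisym m_mono F_indicator e_F) auto
    then show ?thesis by (simp add: content_def)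
  qed
  have me0: "0 \<le> m e" by (rule pos[OF e_F]) (simp add: e_nonneg)
  \<comment> \<open>\<open>\<delta>\<close> is the mesh of the level sets. On each of them
    \<open>v\<close> is squeezed between two multiples of \<open>e\<close> that differ by
    \<open>\<delta> e\<close>, which accounts for the error \<open>\<delta> * m e\<close>.\<close>
  have core: "(\<integral>\<^sup>+w. ennreal (v w * d w) \<partial>M) \<le> ennreal (m v) + ennreal (\<delta> * m e)"
    "\<epsilon> > 0 \<Longrightarrow> \<exists>G. range G \<subseteq> sets M \<and> incseq G \<and> (\<Union>k. G k) = space M \<and>
         (\<forall>k::nat. ennreal (m (\<lambda>w. indicator (G k) w * v w)) \<le>
            (\<integral>\<^sup>+w. ennreal (v w * d w) \<partial>M) + ennreal (\<delta> * m e) + ennreal \<epsilon>)"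
    if v: "v \<in> F" "AE w in M. 0 \<le> v w" and \<delta>: "\<delta> > 0" for v \<delta> \<epsilon>
  proof -
    have [measurable]: "v \<in> borel_measurable M" using F_meas v by simp
    obtain A :: "nat \<Rightarrow> 'a set" where AM: "range A \<subseteq> sets M" and dis: "disjoint_family A"
      and A: "\<And>j w. w \<in> A j \<Longrightarrow> real j * \<delta> * e w \<le> v w \<and> v w \<le> (real j + 1) * \<delta> * e w \<and> 0 < e w"
      and Aout: "AE w in M. w \<notin> (\<Union>j. A j) \<longrightarrow> v w = 0 \<and> e w = 0"
      using level_sets[OF v \<delta>] by blast
    have AM' [measurable]: "A j \<in> sets M" for j using AM by auto
    have vd: "(\<integral>\<^sup>+w. ennreal (v w * d w) \<partial>M) =
      (\<Sum>j. \<integral>\<^sup>+w. ennreal (v w * d w) * indicator (A j) w \<partial>M)"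
    proof -
      have "(\<integral>\<^sup>+w. ennreal (v w * d w) \<partial>M) = (\<integral>\<^sup>+w. ennreal (v w * d w) * indicator (\<Union>j. A j) w \<partial>M)"
        using Aout by (intro nn_integral_cong_AE) (auto split: split_indicator elim:
          eventually_mono)
      also have "\<dots> = (\<integral>\<^sup>+w. (\<Sum>j. ennreal (v w * d w) * indicator (A j) w) \<partial>M)"
        by (intro nn_integral_cong) (simp add: suminf_indicator[OF dis, symmetric] flip:
          ennreal_suminf_cmult)
      also have "\<dots> = (\<Sum>j. \<integral>\<^sup>+w. ennreal (v w * d w) * indicator (A j) w \<partial>M)"
        by (intro nn_integral_suminf) measurable
      finally show ?thesis .
    qed
    have DA: "(\<integral>\<^sup>+w. ennreal c * (D w * indicator (A j) w) \<partial>M) = ennreal c * ?N (A j)" for c j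
      by (subst nn_integral_cmult) (auto simp: DN)
    have up: "(\<integral>\<^sup>+w. ennreal (v w * d w) * indicator (A j) w \<partial>M) \<le>
      ennreal ((real j + 1) * \<delta>) * ?N (A j)" for j
      unfolding DA[symmetric] using Dfin
    proof (intro nn_integral_mono_AE, eventually_elim)
      case (elim w)
      show ?case
      proof (cases "w \<in> A j")
        case True
        then have "v w * d w \<le> ((real j + 1) * \<delta>) * enn2real (D w)"
          using A[OF True] mult_right_mono[of "v w" "(real j + 1) * \<delta> * e w" "enn2real (D w) / e w"]
          by (simp add: d_def)
        then have "ennreal (v w * d w) \<le> ennreal ((real j + 1) * \<delta>) * ennreal (enn2real (D w))"
          using \<delta> by (simp add: ennreal_mult[symmetric] ennreal_leI)
        then show ?thesis using True elim by simp
      qed simp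
    qed
    have low: "ennreal (real j * \<delta>) * ?N (A j) \<le>
      (\<integral>\<^sup>+w. ennreal (v w * d w) * indicator (A j) w \<partial>M)" for j
      unfolding DA[symmetric] using Dfin
    proof (intro nn_integral_mono_AE, eventually_elim)
      case (elim w)
      show ?case
      proof (cases "w \<in> A j")
        case True
        then have "(real j * \<delta>) * enn2real (D w) \<le> v w * d w"
          using A[OF True] mult_right_mono[of "real j * \<delta> * e w" "v w" "enn2real (D w) / e w"]
          by (simp add: d_def)
        then have "ennreal (real j * \<delta>) * ennreal (enn2real (D w)) \<le> ennreal (v w * d w)"
          using \<delta> by (simp add: ennreal_mult[symmetric] ennreal_leI)
        then show ?thesis using True elim by simp
      qed simp
    qed
    have Nsum: "(\<Sum>j. ennreal \<delta> * ?N (A j)) \<le> ennreal (\<delta> * m e)"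
    proof -
      have "(\<Sum>j. ennreal \<delta> * ?N (A j)) = ennreal \<delta> * ?N (\<Union>j. A j)"
        using dis AM by (simp add: suminf_emeasure)
      also have "\<dots> \<le> ennreal \<delta> * content (space M)"
        using normal_le_content[of "space M"] emeasure_space[of normal_measure "\<Union>j. A j"]
        by (intro mult_left_mono) (auto intro: order_trans)
      also have "\<dots> = ennreal (\<delta> * m e)" using me me0 \<delta> by (simp add: ennreal_mult)
      finally show ?thesis .
    qed
    have split: "(\<Sum>j. ennreal ((real j + 1) * \<delta>) * ?N (A j)) =
        (\<Sum>j. ennreal (real j * \<delta>) * ?N (A j)) + (\<Sum>j. ennreal \<delta> * ?N (A j))"
    proof -
      have "ennreal ((real j + 1) * \<delta>) = ennreal (real j * \<delta>) + ennreal \<delta>" for j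
        using \<delta> by (simp add: ennreal_plus[symmetric] algebra_simps del: ennreal_plus)
      then show ?thesis by (simp only: distrib_right suminf_add[OF summableI summableI])
    qed
    have mlow: "(\<Sum>j. ennreal (real j * \<delta>) * ?N (A j)) \<le> ennreal (m v)"
    proof (rule suminf_le_const)
      fix n
      have "(\<Sum>j<n. ennreal (real j * \<delta>) * ?N (A j)) \<le> (\<Sum>j<n. ennreal (real j * \<delta>) * content (A j))"
        by (intro sum_mono mult_left_mono normal_le_content) auto
      also have "\<dots> = ennreal (\<Sum>j<n. real j * \<delta> * m (\<lambda>w. indicator (A j) w * e w))"
        using \<delta> content_nonneg[OF AM']
          by (simp add: content_def sum_ennreal[symmetric] ennreal_mult)
      also have "(\<Sum>j<n. real j * \<delta> * m (\<lambda>w. indicator (A j) w * e w)) =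
          m (\<lambda>w. \<Sum>j<n. real j * \<delta> * (indicator (A j) w * e w))"
        by (intro m_sum[symmetric] F_indicator e_F) auto
      also have "\<dots> \<le> m v"
      proof (intro m_mono F_sum F_indicator e_F v(1))
        show "AE w in M. (\<Sum>j<n. real j * \<delta> * (indicator (A j) w * e w)) \<le> v w"
          using v(2)
        proof eventually_elim
          case (elim w)
          show ?case
          proof (cases "\<exists>i<n. w \<in> A i")
            case True
            then obtain i where i: "i < n" "w \<in> A i" by auto
            have "indicator (A j) w = (if j = i then 1 else 0 :: real)" for j
              using i dis unfolding disjoint_family_on_def by (auto split: split_indicator)
            then have "(\<Sum>j<n. real j * \<delta> * (indicator (A j) w * e w)) = real i * \<delta> * e w"
              using i by (simp add: if_distrib[of "\<lambda>x. _ * x"] if_distrib[of "\<lambda>x. x * _"] cong: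
                if_cong)
            then show ?thesis using A[OF i(2)] by simp
          next
            case False
            then have "(\<Sum>j<n. real j * \<delta> * (indicator (A j) w * e w)) = 0"
              by (intro sum.neutral) auto
            then show ?thesis using elim by simp
          qed
        qed
      qed auto
      finally show "(\<Sum>j<n. ennreal (real j * \<delta>) * ?N (A j)) \<le> ennreal (m v)"
        by (simp add: ennreal_leI)
    qed simp
    have "(\<integral>\<^sup>+w. ennreal (v w * d w) \<partial>M) \<le> (\<Sum>j. ennreal ((real j + 1) * \<delta>) * ?N (A j))"
      unfolding vd by (intro suminf_le up) auto
    also have "\<dots> \<le> ennreal (m v) + ennreal (\<delta> * m e)"
      unfolding split by (intro add_mono mlow Nsum)
    finally show "(\<integral>\<^sup>+w. ennreal (v w * d w) \<partial>M) \<le> ennreal (m v) + ennreal (\<delta> * m e)" .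
    assume \<epsilon>: "\<epsilon> > 0"
    \<comment> \<open>Chosen so that the excess \<open>\<eta> j\<close> of the cover of level
      \<open>j\<close>, multiplied by the height \<open>(j + 1) * \<delta>\<close>, is
      \<open>\<epsilon> / 2^(j+1)\<close>; over all levels this adds up to at most
      \<open>\<epsilon>\<close>.\<close>
    define \<eta> where "\<eta> j = \<epsilon> * (1/2) ^ Suc j / ((real j + 1) * \<delta>)" for j
    have \<eta>: "\<eta> j > 0" for j using \<epsilon> \<delta> by (simp add: \<eta>_def)
    have "\<exists>B. range B \<subseteq> sets M \<and> A j \<subseteq> (\<Union>i. B i) \<and> (\<Sum>i. content (B i)) < ?N (A j) + ennreal (\<eta> j)"
      for j
    proof -
      have "?N (A j) < \<infinity>"
        using normal_le_content[OF AM', of j] by (simp add: content_def order_le_less_trans)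
      then have "?N (A j) < ?N (A j) + ennreal (\<eta> j)"
        using \<eta>[of j] by (cases "?N (A j)") (auto simp: ennreal_plus[symmetric] ennreal_less_iff
          simp del: ennreal_plus)
      then show ?thesis using sets.outer_measure_close[of M content "A j"] emeasure_normal[OF AM',
        of j]
        by metis
    qed
    then obtain B where B: "\<And>j. range (B j) \<subseteq> sets M" "\<And>j. A j \<subseteq> (\<Union>i. B j i)"
      "\<And>j. (\<Sum>i::nat. content (B j i)) < ?N (A j) + ennreal (\<eta> j)" by metis
    have BM [measurable]: "B j i \<in> sets M" for j i using B(1) by blast
    \<comment> \<open>Almost everywhere on \<open>Z\<close> both \<open>v\<close> and
      \<open>e\<close> vanish. Adding \<open>Z\<close> to every \<open>G k\<close> makes the union
      all of \<open>space M\<close>, not just almost all of it.\<close>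
    define Z where "Z = space M - (\<Union>j. A j)"
    define G where "G k = Z \<union> (\<Union>j<k. \<Union>i<k. A j \<inter> B j i)" for k
    have [measurable]: "Z \<in> sets M" unfolding Z_def by measurable
    have GM [measurable]: "G k \<in> sets M" for k unfolding G_def by measurable
    have "incseq G" unfolding G_def incseq_def by auto
    moreover have "(\<Union>k. G k) = space M"
    proof
      show "(\<Union>k. G k) \<subseteq> space M" using GM sets.sets_into_space by blast
      show "space M \<subseteq> (\<Union>k. G k)"
      proof
        fix w assume w: "w \<in> space M"
        show "w \<in> (\<Union>k. G k)"
        proof (cases "w \<in> Z")
          case False
          then obtain j i where "w \<in> A j" "w \<in> B j i" using w B(2) unfolding Z_def by blast
          then have "w \<in> G (Suc (max i j))" unfolding G_def by (auto simp: less_Suc_eq_le)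
          then show ?thesis by blast
        qed (auto simp: G_def)
      qed
    qed
    moreover have "ennreal (m (\<lambda>w. indicator (G k) w * v w)) \<le>
            (\<integral>\<^sup>+w. ennreal (v w * d w) \<partial>M) + ennreal (\<delta> * m e) + ennreal \<epsilon>" for k
    proof -
      let ?I = "{..<k} \<times> {..<k}"
      let ?h = "\<lambda>z w. indicator (B (fst z) (snd z)) w * e w"
      let ?c = "\<lambda>z. (real (fst z) + 1) * \<delta>"
      \<comment> \<open>Only finitely many covering sets meet \<open>G k\<close> outside
        \<open>Z\<close>, in the construction of \<open>G k\<close>, so monotonicity and finite
        additivity of \<open>m\<close> suffice here.\<close>
      have "m (\<lambda>w. indicator (G k) w * v w) \<le> m (\<lambda>w. \<Sum>z\<in>?I. ?c z * ?h z w)"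
      proof (intro m_mono F_sum F_indicator e_F v(1) GM BM)
        show "AE w in M. indicator (G k) w * v w \<le> (\<Sum>z\<in>?I. ?c z * ?h z w)"
          using Aout AE_space
        proof eventually_elim
          case (elim w)
          have nn: "0 \<le> ?c z * ?h z w" for z using \<delta> e_nonneg[of w] by simp
          show ?case
          proof (cases "\<exists>j<k. \<exists>i<k. w \<in> A j \<inter> B j i")
            case True
            then obtain j i where ji: "j < k" "i < k" "w \<in> A j" "w \<in> B j i" by auto
            have "w \<in> G k" using ji by (auto simp: G_def)
            then have "indicator (G k) w * v w \<le> ?c (j, i) * ?h (j, i) w" using A[OF ji(3)] ji(4)
              by simp
            also have "\<dots> \<le> (\<Sum>z\<in>?I. ?c z * ?h z w)"
              using ji nn by (intro member_le_sum) auto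
            finally show ?thesis .
          next
            case False
            then have "indicator (G k) w * v w = 0"
              using elim by (auto simp: G_def Z_def split: split_indicator)
            moreover have "0 \<le> (\<Sum>z\<in>?I. ?c z * ?h z w)" by (intro sum_nonneg nn)
            ultimately show ?thesis by linarith
          qed
        qed
      qed auto
      also have "\<dots> = (\<Sum>z\<in>?I. ?c z * m (?h z))"
        by (intro m_sum F_indicator e_F) auto
      also have "\<dots> = (\<Sum>j<k. \<Sum>i<k. (real j + 1) * \<delta> * m (\<lambda>w. indicator (B j i) w * e w))"
        by (simp add: sum.cartesian_product case_prod_unfold)
      finally have "ennreal (m (\<lambda>w. indicator (G k) w * v w)) \<le>
          ennreal (\<Sum>j<k. \<Sum>i<k. (real j + 1) * \<delta> * m (\<lambda>w. indicator (B j i) w * e w))"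
        by (rule ennreal_leI)
      also have "\<dots> = (\<Sum>j<k. ennreal ((real j + 1) * \<delta>) * (\<Sum>i<k. content (B j i)))"
      proof -
        have "ennreal (\<Sum>i<k. (real j + 1) * \<delta> * m (\<lambda>w. indicator (B j i) w * e w)) =
            ennreal ((real j + 1) * \<delta>) * (\<Sum>i<k. content (B j i))" for j
          unfolding content_def sum_distrib_left[symmetric] using \<delta> content_nonneg[OF BM]
          by (subst sum_ennreal) (auto intro!: ennreal_mult sum_nonneg)
        moreover have "0 \<le> (\<Sum>i<k. (real j + 1) * \<delta> * m (\<lambda>w. indicator (B j i) w * e w))" for j
          using \<delta> content_nonneg[OF BM] by (intro sum_nonneg mult_nonneg_nonneg) auto
        ultimately show ?thesis by (subst sum_ennreal[symmetric]) auto
      qed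
      also have "\<dots> \<le> (\<Sum>j<k. ennreal ((real j + 1) * \<delta>) * (?N (A j) + ennreal (\<eta> j)))"
      proof (intro sum_mono mult_left_mono)
        fix j
        have "(\<Sum>i<k. content (B j i)) \<le> (\<Sum>i. content (B j i))" by (intro sum_le_suminf) auto
        then show "(\<Sum>i<k. content (B j i)) \<le> ?N (A j) + ennreal (\<eta> j)"
          using B(3)[of j] by simp
      qed simp
      also have "\<dots> = (\<Sum>j<k. ennreal ((real j + 1) * \<delta>) * ?N (A j)) +
        (\<Sum>j<k. ennreal (\<epsilon> * (1/2) ^ Suc j))"
      proof -
        have "ennreal ((real j + 1) * \<delta>) * ennreal (\<eta> j) = ennreal (\<epsilon> * (1/2) ^ Suc j)" for j
        proof -
          have "(real j + 1) * \<delta> > 0" using \<delta> by (simp add: add_nonneg_pos)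
          then have "((real j + 1) * \<delta>) * \<eta> j = \<epsilon> * (1/2) ^ Suc j"
            unfolding \<eta>_def by (metis less_irrefl nonzero_mult_div_cancel_left
              times_divide_eq_right)
          moreover have "ennreal ((real j + 1) * \<delta>) * ennreal (\<eta> j) =
            ennreal (((real j + 1) * \<delta>) * \<eta> j)"
            using \<delta> \<eta>[of j] by (intro ennreal_mult[symmetric]) auto
          ultimately show ?thesis by (simp only:)
        qed
        then show ?thesis by (simp add: distrib_left sum.distrib)
      qed
      also have "\<dots> \<le> ((\<integral>\<^sup>+w. ennreal (v w * d w) \<partial>M) + ennreal (\<delta> * m e)) + ennreal \<epsilon>"
      proof (rule add_mono)
        have "(\<Sum>j<k. ennreal ((real j + 1) * \<delta>) * ?N (A j)) \<le>
          (\<Sum>j. ennreal ((real j + 1) * \<delta>) * ?N (A j))"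
          by (intro sum_le_suminf) auto
        also have "\<dots> \<le> (\<integral>\<^sup>+w. ennreal (v w * d w) \<partial>M) + ennreal (\<delta> * m e)"
          unfolding split vd by (intro add_mono suminf_le low Nsum) auto
        finally show "(\<Sum>j<k. ennreal ((real j + 1) * \<delta>) * ?N (A j)) \<le>
           (\<integral>\<^sup>+w. ennreal (v w * d w) \<partial>M) + ennreal (\<delta> * m e)" .
        have "(\<Sum>j<k. \<epsilon> * (1/2) ^ Suc j) = \<epsilon> * (1 - (1/2) ^ k)"
          by (induction k) (auto simp: algebra_simps)
        also have "\<dots> \<le> \<epsilon>" using \<epsilon> by simp
        finally show "(\<Sum>j<k. ennreal (\<epsilon> * (1/2) ^ Suc j)) \<le> ennreal \<epsilon>"
          using \<epsilon> by (subst sum_ennreal) (auto intro: ennreal_leI)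
      qed
      finally show ?thesis .
    qed
    ultimately show "\<exists>G. range G \<subseteq> sets M \<and> incseq G \<and> (\<Union>k. G k) = space M \<and>
         (\<forall>k::nat. ennreal (m (\<lambda>w. indicator (G k) w * v w)) \<le>
            (\<integral>\<^sup>+w. ennreal (v w * d w) \<partial>M) + ennreal (\<delta> * m e) + ennreal \<epsilon>)"
      by (intro exI[of _ G]) auto
  qed
  show ?thesis
  proof (rule that[of d])
    show "0 \<le> d w" for w by (simp add: d_def e_nonneg)
    show "d w = 0" if "e w = 0" for w using that by (simp add: d_def)
    \<comment> \<open>The summand 1 in the denominator avoids a division by zero when
      \<open>m e = 0\<close>.\<close>
    have small: "\<exists>\<delta>>0. \<delta> * m e \<le> \<epsilon>" if "\<epsilon> > 0" for \<epsilon> :: real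
      using that me0 by (intro exI[of _ "\<epsilon> / (m e + 1)"]) (auto simp: field_simps)
    fix v assume v: "v \<in> F" "AE w in M. 0 \<le> v w"
    show "(\<integral>\<^sup>+w. ennreal (v w * d w) \<partial>M) \<le> ennreal (m v)"
    proof (rule ennreal_le_epsilon)
      fix \<epsilon> :: real assume "\<epsilon> > 0"
      with small obtain \<delta> where "\<delta> > 0" "\<delta> * m e \<le> \<epsilon>" by blast
      then show "(\<integral>\<^sup>+w. ennreal (v w * d w) \<partial>M) \<le> ennreal (m v) + ennreal \<epsilon>"
        using core(1)[OF v] by (meson add_left_mono ennreal_leI order_trans)
    qed
    fix \<epsilon> :: real assume \<epsilon>: "\<epsilon> > 0"
    with small[of "\<epsilon>/2"] obtain \<delta> where \<delta>: "\<delta> > 0" "\<delta> * m e \<le> \<epsilon>/2" by auto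
    have "ennreal (\<delta> * m e) + ennreal (\<epsilon>/2) \<le> ennreal \<epsilon>"
      using \<delta> me0 \<epsilon>
        by (auto simp del: ennreal_plus simp: ennreal_plus[symmetric] intro!: ennreal_leI)
    then have step: "x + ennreal (\<delta> * m e) + ennreal (\<epsilon>/2) \<le> x + ennreal \<epsilon>" for x
      unfolding add.assoc by (rule add_left_mono)
    show "\<exists>G. range G \<subseteq> sets M \<and> incseq G \<and> (\<Union>k. G k) = space M \<and>
         (\<forall>k::nat. ennreal (m (\<lambda>w. indicator (G k) w * v w)) \<le> (\<integral>\<^sup>+w. ennreal (v w * d w) \<partial>M) +
           ennreal \<epsilon>)"
    proof -
      obtain G where G: "range G \<subseteq> sets M" "incseq G" "(\<Union>k. G k) = space M"
        and le: "\<And>k::nat. ennreal (m (\<lambda>w. indicator (G k) w * v w)) \<le>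
           (\<integral>\<^sup>+w. ennreal (v w * d w) \<partial>M) + ennreal (\<delta> * m e) + ennreal (\<epsilon>/2)"
        using core(2)[OF v \<delta>(1), of "\<epsilon>/2"] \<epsilon> by auto
      have "ennreal (m (\<lambda>w. indicator (G k) w * v w)) \<le>
        (\<integral>\<^sup>+w. ennreal (v w * d w) \<partial>M) + ennreal \<epsilon>" for k
        by (rule order_trans[OF le step])
      then show ?thesis using G by blast
    qed
  qed (rule d_meas)
qed

end

text \<open>Continuity along exhausting sequences kills the singular part: some \<open>G k\<close>
  from \<open>normal_part\<close> carries \<open>m v\<close> up to half of
  \<open>\<epsilon>\<close>, and on \<open>G k\<close> the integral dominates \<open>m\<close> up to
  the other half.\<close>

lemma (in positive_functional) representation:
  assumes cont: "\<And>v G \<epsilon>. v \<in> F \<Longrightarrow> AE w in M. 0 \<le> v w \<Longrightarrow> range G \<subseteq> sets M \<Longrightarrow> incseq G \<Longrightarrow>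
      (\<Union>k::nat. G k) = space M \<Longrightarrow> \<epsilon> > 0 \<Longrightarrow> \<exists>k. m v \<le> m (\<lambda>w. indicator (G k) w * v w) + \<epsilon>"
  obtains d where "d \<in> borel_measurable M" "\<And>w. 0 \<le> d w" "\<And>w. e w = 0 \<Longrightarrow> d w = 0"
    "\<And>v. v \<in> F \<Longrightarrow> AE w in M. 0 \<le> v w \<Longrightarrow> has_bochner_integral M (\<lambda>w. v w * d w) (m v)"
proof -
  obtain d where d: "d \<in> borel_measurable M" "\<And>w. 0 \<le> d w" "\<And>w. e w = 0 \<Longrightarrow> d w = 0"
    and le: "\<And>v. v \<in> F \<Longrightarrow> AE w in M. 0 \<le> v w \<Longrightarrow> (\<integral>\<^sup>+w. ennreal (v w * d w) \<partial>M) \<le> ennreal (m v)"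
    and ge: "\<And>v \<epsilon>. v \<in> F \<Longrightarrow> AE w in M. 0 \<le> v w \<Longrightarrow> \<epsilon> > 0 \<Longrightarrow>
       \<exists>G. range G \<subseteq> sets M \<and> incseq G \<and> (\<Union>k. G k) = space M \<and>
         (\<forall>k::nat. ennreal (m (\<lambda>w. indicator (G k) w * v w)) \<le> (\<integral>\<^sup>+w. ennreal (v w * d w) \<partial>M) +
           ennreal \<epsilon>)"
    using normal_part by blast
  have "ennreal (m v) \<le> (\<integral>\<^sup>+w. ennreal (v w * d w) \<partial>M)" if v: "v \<in> F" "AE w in M. 0 \<le> v w" for v
  proof (rule ennreal_le_epsilon)
    fix \<epsilon> :: real assume \<epsilon>: "\<epsilon> > 0"
    obtain G where G: "range G \<subseteq> sets M" "incseq G" "(\<Union>k::nat. G k) = space M"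
      "\<And>k. ennreal (m (\<lambda>w. indicator (G k) w * v w)) \<le>
        (\<integral>\<^sup>+w. ennreal (v w * d w) \<partial>M) + ennreal (\<epsilon> / 2)"
      using ge[OF v, of "\<epsilon> / 2"] \<epsilon> by auto
    obtain k where k: "m v \<le> m (\<lambda>w. indicator (G k) w * v w) + \<epsilon> / 2"
      using cont[OF v G(1-3), of "\<epsilon> / 2"] \<epsilon> by auto
    have "G k \<in> sets M" using G(1) by auto
    then have nn: "0 \<le> m (\<lambda>w. indicator (G k) w * v w)"
      using v by (intro pos F_indicator) (auto elim!: eventually_mono split: split_indicator)
    have "ennreal (m v) \<le> ennreal (m (\<lambda>w. indicator (G k) w * v w)) + ennreal (\<epsilon> / 2)"
      using k nn \<epsilon>
        by (auto simp del: ennreal_plus simp: ennreal_plus[symmetric] intro!: ennreal_leI)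
    also have "\<dots> \<le> ((\<integral>\<^sup>+w. ennreal (v w * d w) \<partial>M) + ennreal (\<epsilon> / 2)) + ennreal (\<epsilon> / 2)"
      by (rule add_right_mono[OF G(4)])
    also have "\<dots> = (\<integral>\<^sup>+w. ennreal (v w * d w) \<partial>M) + ennreal \<epsilon>"
    proof -
      have "ennreal (\<epsilon> / 2) + ennreal (\<epsilon> / 2) = ennreal (\<epsilon> / 2 + \<epsilon> / 2)"
        using \<epsilon> by (intro ennreal_plus[symmetric]) auto
      then show ?thesis by (simp add: add.assoc)
    qed
    finally show "ennreal (m v) \<le> (\<integral>\<^sup>+w. ennreal (v w * d w) \<partial>M) + ennreal \<epsilon>" .
  qed
  then have eq: "(\<integral>\<^sup>+w. ennreal (v w * d w) \<partial>M) = ennreal (m v)" if "v \<in> F" "AE w in M. 0 \<le> v w"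
    for v
    using le that by (meson antisym)
  have "has_bochner_integral M (\<lambda>w. v w * d w) (m v)" if v: "v \<in> F" "AE w in M. 0 \<le> v w" for v
  proof (rule has_bochner_integral_nn_integral)
    show "(\<lambda>w. v w * d w) \<in> borel_measurable M" using F_meas[OF v(1)] d(1) by simp
    show "AE w in M. 0 \<le> v w * d w" using v(2) by eventually_elim (simp add: d(2))
  qed (use pos[OF v] eq[OF v] in auto)
  then show ?thesis using that[of d] d by blast
qed

section \<open>Lattice sums of finite families\<close>

lemma lp_sum_ennreal:
  assumes "0 < s"
  shows "lp_sum (ennreal s) n a = (\<Sum>i<n. \<bar>a i\<bar> powr s) powr (1 / s)"
  using assms by (simp add: lp_sum_def)

lemma lp_sum_top_0 [simp]: "lp_sum top 0 a = 0"
  by (simp add: lp_sum_def)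

lemma lp_sum_top_Suc: "lp_sum top (Suc n) a = max (lp_sum top n a) \<bar>a n\<bar>"
proof -
  have "insert 0 ((\<lambda>i. \<bar>a i\<bar>) ` {..<Suc n}) = insert \<bar>a n\<bar> (insert 0 ((\<lambda>i. \<bar>a i\<bar>) ` {..<n}))"
    by (auto simp: lessThan_Suc)
  then show ?thesis by (simp add: lp_sum_def max.commute)
qed

lemma exponent_cases [consumes 1, case_names infinity finite]:
  assumes "0 < p"
  obtains "p = top" | s where "0 < s" "p = ennreal s"
  using assms by (cases p) (auto simp: ennreal_zero_less_top)

lemma lp_sum_nonneg: "0 \<le> lp_sum p n a"
proof (cases "p = \<infinity>")
  case True
  then show ?thesis by (induction n) (auto simp: lp_sum_top_Suc)
qed (simp add: lp_sum_def)

lemma lp_sum_cong: "(\<And>i. i < n \<Longrightarrow> \<bar>a i\<bar> = \<bar>b i\<bar>) \<Longrightarrow> lp_sum p n a = lp_sum p n b"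
  by (auto simp: lp_sum_def intro!: arg_cong[of _ _ Max] image_cong)

lemma lp_sum_mono:
  assumes "\<And>i. i < n \<Longrightarrow> \<bar>a i\<bar> \<le> \<bar>b i\<bar>"
  shows "lp_sum p n a \<le> lp_sum p n b"
proof (cases "p = \<infinity>")
  case True
  have "lp_sum top n a \<le> lp_sum top n b" using assms
  proof (induction n)
    case (Suc n)
    have "lp_sum top n a \<le> lp_sum top n b" by (rule Suc.IH) (use Suc.prems in auto)
    then show ?case using Suc.prems[of n] by (auto simp: lp_sum_top_Suc max_def)
  qed simp
  then show ?thesis using True by simp
next
  case False
  then show ?thesis using assms
    by (auto simp: lp_sum_def intro!: powr_mono2 sum_mono sum_nonneg)
qed

lemma lp_sum_scale:
  assumes "0 < p"
  shows "lp_sum p n (\<lambda>i. c * a i) = \<bar>c\<bar> * lp_sum p n a"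
  using assms
proof (cases rule: exponent_cases)
  case infinity
  then show ?thesis
    by (induction n) (auto simp: lp_sum_top_Suc abs_mult max_mult_distrib_left)
next
  case (finite s)
  have "(\<Sum>i<n. \<bar>c * a i\<bar> powr s) = \<bar>c\<bar> powr s * (\<Sum>i<n. \<bar>a i\<bar> powr s)"
    by (simp add: abs_mult powr_mult sum_distrib_left)
  then show ?thesis
    using finite by (simp add: lp_sum_ennreal powr_mult sum_nonneg powr_powr)
qed

lemma lp_sum_measurable:
  assumes "\<And>i. i < n \<Longrightarrow> (\<lambda>w. x i w) \<in> borel_measurable M"
  shows "(\<lambda>w. lp_sum p n (\<lambda>i. x i w)) \<in> borel_measurable M"
proof (cases "p = \<infinity>")
  case True
  have "(\<lambda>w. lp_sum top n (\<lambda>i. x i w)) \<in> borel_measurable M" using assms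
    by (induction n) (auto simp: lp_sum_top_Suc intro!: borel_measurable_max borel_measurable_abs)
  then show ?thesis using True by simp
next
  case False
  have [measurable]: "(\<lambda>w. \<Sum>i<n. \<bar>x i w\<bar> powr enn2real p) \<in> borel_measurable M"
    using assms by (intro borel_measurable_sum powr_real_measurable borel_measurable_abs) auto
  show ?thesis using False by (simp add: lp_sum_def)
qed

text \<open>A crude constant depending on \<open>n\<close> is enough, since the bound only serves to
  place lattice sums in an ideal. It is available for exponents below 1 as well, where no triangle
  inequality holds.\<close>

lemma lp_sum_le_sum:
  assumes "0 < p"
  obtains C where "0 \<le> C" "\<And>a. lp_sum p n a \<le> C * (\<Sum>i<n. \<bar>a i\<bar>)"
  using assms
proof (cases rule: exponent_cases)
  case infinity
  have "lp_sum top n a \<le> 1 * (\<Sum>i<n. \<bar>a i\<bar>)" for a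
    by (induction n) (auto simp: lp_sum_top_Suc intro: sum_nonneg)
  then show ?thesis using that[of 1] infinity by auto
next
  case (finite s)
  have "lp_sum p n a \<le> real n powr (1 / s) * (\<Sum>i<n. \<bar>a i\<bar>)" for a
  proof -
    have "(\<Sum>i<n. \<bar>a i\<bar> powr s) \<le> (\<Sum>i<n. (\<Sum>i<n. \<bar>a i\<bar>) powr s)"
      using finite by (intro sum_mono powr_mono2 member_le_sum) auto
    then have "lp_sum p n a \<le> (real n * (\<Sum>i<n. \<bar>a i\<bar>) powr s) powr (1 / s)"
      using finite by (auto simp: lp_sum_ennreal intro!: powr_mono2 sum_nonneg)
    then show ?thesis using finite by (simp add: powr_mult powr_powr sum_nonneg)
  qed
  then show ?thesis by (intro that[of "real n powr (1 / s)"]) auto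
qed

lemma lp_sum_tendsto:
  assumes "0 < p" and lim: "\<And>i. i < n \<Longrightarrow> ((\<lambda>k. a k i) \<longlongrightarrow> b i) G"
  shows "((\<lambda>k. lp_sum p n (a k)) \<longlongrightarrow> lp_sum p n b) G"
  using assms(1)
proof (cases rule: exponent_cases)
  case infinity
  have "((\<lambda>k. lp_sum top n (a k)) \<longlongrightarrow> lp_sum top n b) G" using lim
    by (induction n) (auto simp: lp_sum_top_Suc intro!: tendsto_max tendsto_rabs)
  then show ?thesis using infinity by simp
next
  case (finite s)
  have "((\<lambda>k. \<Sum>i<n. \<bar>a k i\<bar> powr s) \<longlongrightarrow> (\<Sum>i<n. \<bar>b i\<bar> powr s)) G"
    using finite lim by (intro tendsto_sum tendsto_powr2 tendsto_rabs tendsto_const) auto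
  then have "((\<lambda>k. (\<Sum>i<n. \<bar>a k i\<bar> powr s) powr (1 / s)) \<longlongrightarrow> (\<Sum>i<n. \<bar>b i\<bar> powr s) powr (1 / s)) G"
    using finite by (intro tendsto_powr2 tendsto_const) (auto intro!: sum_nonneg always_eventually)
  then show ?thesis using finite by (simp add: lp_sum_ennreal)
qed

lemma lp_sum_append_zero:
  assumes "0 < p" "n \<le> k" "\<And>i. n \<le> i \<Longrightarrow> i < k \<Longrightarrow> a i = 0"
  shows "lp_sum p k a = lp_sum p n a"
  using assms(1)
proof (cases rule: exponent_cases)
  case infinity
  have "lp_sum top k a = lp_sum top n a" using assms(2,3)
    by (induction k rule: dec_induct) (auto simp: lp_sum_top_Suc lp_sum_nonneg max_absorb1)
  then show ?thesis using infinity by simp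
next
  case (finite s)
  have "(\<Sum>i<k. \<bar>a i\<bar> powr s) = (\<Sum>i<n. \<bar>a i\<bar> powr s)"
    using assms by (intro sum.mono_neutral_right) auto
  then show ?thesis using finite by (simp add: lp_sum_ennreal)
qed

lemma lp_sum_powr:
  assumes "0 < s"
  shows "lp_sum (ennreal s) n a powr s = (\<Sum>i<n. \<bar>a i\<bar> powr s)"
  using assms by (simp add: lp_sum_ennreal powr_powr sum_nonneg)

lemma lp_sum_1: "lp_sum 1 n a = (\<Sum>i<n. \<bar>a i\<bar>)"
  using lp_sum_ennreal[of 1 n a] by (simp add: sum_nonneg)

lemma le_lp_sum:
  assumes "0 < p" "i < n"
  shows "\<bar>a i\<bar> \<le> lp_sum p n a"
  using assms(1)
proof (cases rule: exponent_cases)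
  case infinity
  have "\<bar>a i\<bar> \<le> lp_sum top n a" using assms(2)
    by (induction n) (auto simp: lp_sum_top_Suc less_Suc_eq)
  then show ?thesis using infinity by simp
next
  case (finite s)
  have "\<bar>a i\<bar> powr s \<le> (\<Sum>i<n. \<bar>a i\<bar> powr s)"
    using assms by (intro member_le_sum) auto
  then have "(\<bar>a i\<bar> powr s) powr (1 / s) \<le> (\<Sum>i<n. \<bar>a i\<bar> powr s) powr (1 / s)"
    using finite by (intro powr_mono2) auto
  then show ?thesis using finite by (simp add: lp_sum_ennreal powr_powr)
qed

text \<open>In \<open>ennreal\<close> one has \<open>1 / top = 0\<close> and
  \<open>1 / 0 = top\<close>. The relation therefore rules out exponents below 1 and includes the
  two endpoint pairs.\<close>

lemma conjugate_exponent_cases [consumes 1, case_names infinity one finite]: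
  fixes p p' :: ennreal
  assumes "1 / p + 1 / p' = 1"
  obtains "p = top" "p' = 1" | "p = 1" "p' = top"
    | s s' where "1 < s" "1 < s'" "1 / s + 1 / s' = 1" "p = ennreal s" "p' = ennreal s'"
proof -
  have inv1: "x = 1" if "1 / x = (1 :: ennreal)" for x
  proof (cases x)
    case (real r)
    then have "r > 0" using that by (cases "r = 0") auto
    then have "1 / x = ennreal (1 / r)"
      using real divide_ennreal[of 1 r] by simp
    then have "ennreal (1 / r) = ennreal 1" using that by simp
    then have "1 / r = 1" using \<open>r > 0\<close> by (subst (asm) ennreal_inj) auto
    then show ?thesis using real by simp
  qed (use that in auto)
  have nz: "p \<noteq> 0" "p' \<noteq> 0" using assms by auto
  show ?thesis
  proof (cases "p = \<infinity> \<or> p' = \<infinity>")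
    case True
    then show ?thesis using assms that(1,2) inv1 by auto
  next
    case False
    with nz have "0 < p" "p \<noteq> top" "0 < p'" "p' \<noteq> top" by (auto simp: zero_less_iff_neq_zero)
    then obtain s s' where s: "0 < s" "0 < s'" "p = ennreal s" "p' = ennreal s'"
      by (elim exponent_cases) auto
    then have "ennreal (1 / s + 1 / s') = ennreal 1"
      using assms divide_ennreal[of 1 s] divide_ennreal[of 1 s'] by simp
    then have eq: "1 / s + 1 / s' = 1" using s by (subst (asm) ennreal_inj) auto
    moreover have "0 < 1 / s" "0 < 1 / s'" using s by simp_all
    then have "1 / s < 1" "1 / s' < 1" using eq by linarith+
    then have "1 < s" "1 < s'" using s by simp_all
    ultimately show ?thesis using that(3) s by blast
  qed
qed

lemma conjugate_exponent_pos:
  fixes p p' :: ennreal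
  assumes "1 / p + 1 / p' = 1"
  shows "0 < p" "0 < p'"
  using assms by (cases rule: conjugate_exponent_cases; simp)+

lemma lp_sum_eq_0:
  assumes "0 < p" "lp_sum p n a = 0" "i < n"
  shows "a i = 0"
  using le_lp_sum[OF assms(1,3), of a] assms(2) by simp

lemma lp_sum_holder:
  assumes "1 / p + 1 / p' = 1"
  shows "(\<Sum>i<n. \<bar>a i\<bar> * \<bar>b i\<bar>) \<le> lp_sum p n a * lp_sum p' n b"
  using assms
proof (cases rule: conjugate_exponent_cases)
  case infinity
  have "(\<Sum>i<n. \<bar>a i\<bar> * \<bar>b i\<bar>) \<le> (\<Sum>i<n. lp_sum p n a * \<bar>b i\<bar>)"
    using infinity by (intro sum_mono mult_right_mono le_lp_sum) auto
  then show ?thesis using infinity by (simp add: lp_sum_1 sum_distrib_left)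
next
  case one
  have "(\<Sum>i<n. \<bar>a i\<bar> * \<bar>b i\<bar>) \<le> (\<Sum>i<n. \<bar>a i\<bar> * lp_sum p' n b)"
    using one by (intro sum_mono mult_left_mono le_lp_sum) auto
  then show ?thesis using one by (simp add: lp_sum_1 sum_distrib_right)
next
  case (finite s s')
  note pos = conjugate_exponent_pos[OF assms]
  let ?A = "lp_sum p n a" and ?B = "lp_sum p' n b"
  show ?thesis
  proof (cases "?A = 0 \<or> ?B = 0")
    case True
    then have "\<bar>a i\<bar> * \<bar>b i\<bar> = 0" if "i < n" for i
      using lp_sum_eq_0 pos that by (metis abs_0 mult_zero_left mult_zero_right)
    then have "(\<Sum>i<n. \<bar>a i\<bar> * \<bar>b i\<bar>) = 0" by (intro sum.neutral) auto
    then show ?thesis using lp_sum_nonneg[of p n a] lp_sum_nonneg[of p' n b] by simp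
  next
    case False
    then have AB: "?A > 0" "?B > 0" using lp_sum_nonneg[of p n a] lp_sum_nonneg[of p' n b]
      by linarith+
    have "(\<Sum>i<n. (\<bar>a i\<bar> / ?A) * (\<bar>b i\<bar> / ?B)) \<le>
      (\<Sum>i<n. (\<bar>a i\<bar> / ?A) powr s / s + (\<bar>b i\<bar> / ?B) powr s' / s')"
      using AB finite by (intro sum_mono Youngs_inequality) auto
    also have "\<dots> = (\<Sum>i<n. \<bar>a i\<bar> powr s) / ?A powr s / s + (\<Sum>i<n. \<bar>b i\<bar> powr s') / ?B powr s' / s'"
      using AB by (simp add: sum.distrib powr_divide sum_divide_distrib)
    also have "\<dots> = 1"
    proof -
      have "(\<Sum>i<n. \<bar>a i\<bar> powr s) = ?A powr s" "(\<Sum>i<n. \<bar>b i\<bar> powr s') = ?B powr s'"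
        using finite lp_sum_powr[of s n a] lp_sum_powr[of s' n b] by auto
      moreover have "?A powr s > 0" "?B powr s' > 0" using AB by auto
      ultimately show ?thesis using finite(3) by simp
    qed
    finally have "(\<Sum>i<n. \<bar>a i\<bar> * \<bar>b i\<bar>) / (?A * ?B) \<le> 1" by (simp add: sum_divide_distrib)
    then show ?thesis using AB by (simp add: field_simps)
  qed
qed

text \<open>For \<open>p = \<infinity>\<close> only the first entry of maximal modulus is charged.  For \<open>p = 1\<close> the value
  \<open>0 powr 0 = 0\<close> at vanishing entries does no harm.\<close>

definition lp_dual :: "ennreal \<Rightarrow> nat \<Rightarrow> (nat \<Rightarrow> real) \<Rightarrow> nat \<Rightarrow> real" where
  "lp_dual p n a i =
     (if p = \<infinity> then (if \<bar>a i\<bar> = lp_sum p n a \<and> (\<forall>k<i. \<bar>a k\<bar> \<noteq> lp_sum p n a) then 1 else 0)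
      else \<bar>a i\<bar> powr (enn2real p - 1) / lp_sum p n a powr (enn2real p - 1))"

lemma lp_dual_nonneg: "0 \<le> lp_dual p n a i"
  by (simp add: lp_dual_def)

text \<open>Charging the first maximal entry is a measurable choice, because it is decided by
  finitely many comparisons of measurable functions.\<close>

lemma lp_dual_measurable:
  assumes "\<And>i. i < n \<Longrightarrow> (\<lambda>w. x i w) \<in> borel_measurable M" "i < n"
  shows "(\<lambda>w. lp_dual p n (\<lambda>i. x i w) i) \<in> borel_measurable M"
proof -
  define L where "L = (\<lambda>w. lp_sum p n (\<lambda>i. x i w))"
  define y where "y = (\<lambda>w. x i w)"
  define P where "P = (\<lambda>w. \<forall>k\<in>{..<i}. \<bar>x k w\<bar> \<noteq> L w)"
  have [measurable]: "L \<in> borel_measurable M" unfolding L_def using assms(1)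
    by (rule lp_sum_measurable)
  have [measurable]: "y \<in> borel_measurable M" using assms by (simp add: y_def)
  have [measurable]: "Measurable.pred M P"
    unfolding P_def
  proof (rule pred_intros_finite)
    fix k assume "k \<in> {..<i}"
    define z where "z = (\<lambda>w. x k w)"
    have [measurable]: "z \<in> borel_measurable M" using assms \<open>k \<in> {..<i}\<close> by (simp add: z_def)
    have "Measurable.pred M (\<lambda>w. \<bar>z w\<bar> \<noteq> L w)" by measurable
    then show "Measurable.pred M (\<lambda>w. \<bar>x k w\<bar> \<noteq> L w)" by (simp add: z_def)
  qed simp
  have "(\<lambda>w. lp_dual p n (\<lambda>i. x i w) i) = (\<lambda>w. if p = \<infinity> then (if \<bar>y w\<bar> = L w \<and> P w then 1 else 0)
      else \<bar>y w\<bar> powr (enn2real p - 1) / L w powr (enn2real p - 1))"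
    unfolding lp_dual_def L_def y_def P_def by (simp only: Ball_def lessThan_iff)
  also have "\<dots> \<in> borel_measurable M" by (cases "p = \<infinity>") simp_all
  finally show ?thesis .
qed

lemma lp_sum_top_attained:
  assumes "0 < n"
  shows "\<exists>k<n. \<bar>a k\<bar> = lp_sum top n a"
  using assms
proof (induction n)
  case (Suc n)
  then show ?case
    by (cases "n = 0") (auto simp: lp_sum_top_Suc max_def intro: less_SucI)
qed simp

lemma lp_dual:
  assumes "1 / p + 1 / p' = 1"
  shows "(\<Sum>i<n. \<bar>a i\<bar> * lp_dual p n a i) = lp_sum p n a"
    and "lp_sum p' n (lp_dual p n a) \<le> 1"
proof -
  have "(\<Sum>i<n. \<bar>a i\<bar> * lp_dual p n a i) = lp_sum p n a \<and> lp_sum p' n (lp_dual p n a) \<le> 1"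
    using assms
  proof (cases rule: conjugate_exponent_cases)
    case infinity
    show ?thesis
    proof (cases "n = 0")
      case False
      define k where "k = (LEAST k. \<bar>a k\<bar> = lp_sum top n a)"
      obtain k0 where k0: "k0 < n" "\<bar>a k0\<bar> = lp_sum top n a"
        using lp_sum_top_attained False by blast
      have k: "\<bar>a k\<bar> = lp_sum top n a" unfolding k_def using k0(2) by (rule LeastI)
      have kl: "\<bar>a j\<bar> \<noteq> lp_sum top n a" if "j < k" for j
        using not_less_Least that unfolding k_def by blast
      have kn: "k < n" using k0 unfolding k_def by (meson Least_le le_less_trans)
      have d: "lp_dual p n a i = (if i = k then 1 else 0)" for i
        using k kl infinity linorder_neqE_nat[of i k] unfolding lp_dual_def by auto
      have "(\<Sum>i<n. \<bar>a i\<bar> * (if i = k then 1 else 0)) = \<bar>a k\<bar>"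
        using kn by (simp add: if_distrib cong: if_cong)
      moreover have "(\<Sum>i<n. \<bar>if i = k then 1 else 0 :: real\<bar>) = 1"
        using kn by (simp add: if_distrib cong: if_cong)
      ultimately show ?thesis
        unfolding infinity(2) lp_sum_1 d using infinity(1) k by simp
    qed (use infinity in \<open>simp add: lp_sum_1\<close>)
  next
    case one
    have "(\<Sum>i<n. \<bar>a i\<bar> * lp_dual p n a i) = (\<Sum>i<n. \<bar>a i\<bar>)"
    proof (intro sum.cong refl)
      fix i assume i: "i \<in> {..<n}"
      show "\<bar>a i\<bar> * lp_dual p n a i = \<bar>a i\<bar>"
        using le_lp_sum[of p i n a] i one by (cases "a i = 0") (auto simp: lp_dual_def)
    qed
    moreover have "lp_sum top n (lp_dual p n a) \<le> 1"
    proof -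
      have "\<bar>lp_dual p n a i\<bar> \<le> 1" for i using one by (simp add: lp_dual_def powr_def)
      then have "lp_sum top k (lp_dual p n a) \<le> 1" for k
        by (induction k) (auto simp: lp_sum_top_Suc)
      then show ?thesis .
    qed
    ultimately show ?thesis using one by (simp add: lp_sum_1)
  next
    case (finite s s')
    let ?A = "lp_sum p n a"
    have d: "lp_dual p n a i = \<bar>a i\<bar> powr (s - 1) / ?A powr (s - 1)" for i
      using finite by (simp add: lp_dual_def)
    show ?thesis
    proof (cases "?A = 0")
      case True
      then have "a i = 0" if "i < n" for i
        using lp_sum_eq_0 conjugate_exponent_pos[OF assms] that by blast
      moreover have "lp_sum p' n (lp_dual p n a) = 0"
        using True d finite by (simp add: lp_sum_ennreal)
      ultimately show ?thesis using True by simp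
    next
      case False
      then have A: "?A > 0" using lp_sum_nonneg[of p n a] by linarith
      have sum: "(\<Sum>i<n. \<bar>a i\<bar> powr s) = ?A powr s"
        using finite lp_sum_powr[of s n a] by simp
      have "\<bar>a i\<bar> * \<bar>a i\<bar> powr (s - 1) = \<bar>a i\<bar> powr s" for i
        using finite powr_mult_base[of "\<bar>a i\<bar>" "s - 1"] by simp
      then have "(\<Sum>i<n. \<bar>a i\<bar> * lp_dual p n a i) = ?A powr s / ?A powr (s - 1)"
        unfolding d sum[symmetric] by (simp add: sum_divide_distrib)
      also have "\<dots> = ?A" using A by (simp flip: powr_diff)
      finally have 1: "(\<Sum>i<n. \<bar>a i\<bar> * lp_dual p n a i) = ?A" .
      \<comment> \<open>This identity of conjugate exponents turns the \<open>s'\<close>-sum of the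
        weights into the \<open>s\<close>-sum of \<open>a\<close>, normalised to 1.\<close>
      have e: "(s - 1) * s' = s" using finite by (simp add: field_simps)
      have "\<bar>lp_dual p n a i\<bar> powr s' = \<bar>a i\<bar> powr s / ?A powr s" for i
        unfolding d using A by (simp add: powr_divide powr_powr e)
      then have "lp_sum p' n (lp_dual p n a) = ((\<Sum>i<n. \<bar>a i\<bar> powr s) / ?A powr s) powr (1 / s')"
        using finite by (simp add: lp_sum_ennreal sum_divide_distrib)
      then show ?thesis using 1 sum A by simp
    qed
  qed
  then show "(\<Sum>i<n. \<bar>a i\<bar> * lp_dual p n a i) = lp_sum p n a" "lp_sum p' n (lp_dual p n a) \<le> 1"
    by auto
qed

section \<open>Membership of lattice sums in ideals\<close>

lemma fun_ideal_sum:
  assumes F: "fun_ideal M F" and "finite I" "\<And>i. i \<in> I \<Longrightarrow> v i \<in> F"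
  shows "(\<lambda>w. \<Sum>i\<in>I. v i w) \<in> F"
  using assms(2,3)
proof (induction I rule: finite_induct)
  case empty
  then show ?case using F by (simp add: fun_ideal_def fun_subspace_def)
next
  case (insert i I)
  then show ?case using F by (simp add: fun_ideal_def fun_subspaceD(2))
qed

lemma fun_idealD:
  assumes "fun_ideal M F"
  shows "fun_subspace F" "\<And>v. v \<in> F \<Longrightarrow> v \<in> borel_measurable M"
    "\<And>u v. v \<in> F \<Longrightarrow> u \<in> borel_measurable M \<Longrightarrow> AE w in M. \<bar>u w\<bar> \<le> \<bar>v w\<bar> \<Longrightarrow> u \<in> F"
  using assms unfolding fun_ideal_def by auto

lemma fun_ideal_abs:
  assumes F: "fun_ideal M F" and v: "v \<in> F"
  shows "(\<lambda>w. \<bar>v w\<bar>) \<in> F"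
  using fun_idealD(2)[OF F v] by (intro fun_idealD(3)[OF F v]) auto

lemma fun_ideal_lp_sum:
  assumes F: "fun_ideal M F" and p: "0 < p" and x: "\<And>i. i < n \<Longrightarrow> x i \<in> F"
  shows "(\<lambda>w. lp_sum p n (\<lambda>i. x i w)) \<in> F"
proof -
  obtain C where C: "0 \<le> C" "\<And>a. lp_sum p n a \<le> C * (\<Sum>i<n. \<bar>a i\<bar>)"
    using lp_sum_le_sum[OF p] by blast
  have "(\<lambda>w. \<Sum>i<n. \<bar>x i w\<bar>) \<in> F"
    by (rule fun_ideal_sum[OF F]) (auto intro: fun_ideal_abs[OF F] x)
  then have "(\<lambda>w. C * (\<Sum>i<n. \<bar>x i w\<bar>)) \<in> F"
    using fun_subspaceD(3)[OF fun_idealD(1)[OF F]] by blast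
  then show ?thesis
  proof (rule fun_idealD(3)[OF F])
    show "(\<lambda>w. lp_sum p n (\<lambda>i. x i w)) \<in> borel_measurable M"
      using x fun_idealD(2)[OF F] by (intro lp_sum_measurable) auto
    have "\<bar>lp_sum p n (\<lambda>i. x i w)\<bar> \<le> \<bar>C * (\<Sum>i<n. \<bar>x i w\<bar>)\<bar>" for w
      using C(2)[of "\<lambda>i. x i w"] lp_sum_nonneg[of p n "\<lambda>i. x i w"] by linarith
    then show "AE w in M. \<bar>lp_sum p n (\<lambda>i. x i w)\<bar> \<le> \<bar>C * (\<Sum>i<n. \<bar>x i w\<bar>)\<bar>" by simp
  qed
qed

lemma fun_ideal_mixed_sum:
  assumes F: "fun_ideal M F" and "0 < s" "0 < q" and x: "\<And>i j. i < n \<Longrightarrow> j < k \<Longrightarrow> x i j \<in> F"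
  shows "mixed_sum s q n k x \<in> F"
  unfolding mixed_sum_def using assms by (intro fun_ideal_lp_sum[OF F]) auto

text \<open>With \<open>S\<close> the sum of the moduli, each \<open>|a_i|^r\<close> is at most
  \<open>|a_i| S^(r-1)\<close>. The bound lets \<open>r\<close>-sums of increments be estimated by
  telescoping, and it yields subadditivity of the \<open>r\<close>-th root.\<close>

lemma lp_sum_le_l1:
  assumes "1 \<le> r"
  shows "lp_sum (ennreal r) n a \<le> (\<Sum>i<n. \<bar>a i\<bar>)"
proof -
  let ?S = "\<Sum>i<n. \<bar>a i\<bar>"
  have S: "0 \<le> ?S" by (intro sum_nonneg) auto
  have b: "\<bar>a i\<bar> powr r = \<bar>a i\<bar> * \<bar>a i\<bar> powr (r - 1)" for i
    using powr_mult_base[of "\<bar>a i\<bar>" "r - 1"] by simp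
  have "(\<Sum>i<n. \<bar>a i\<bar> powr r) \<le> (\<Sum>i<n. \<bar>a i\<bar> * ?S powr (r - 1))"
    unfolding b using assms by (intro sum_mono mult_left_mono powr_mono2 member_le_sum) auto
  also have "\<dots> = ?S powr r"
    using S powr_mult_base[of ?S "r - 1"] by (simp add: sum_distrib_right)
  finally have "(\<Sum>i<n. \<bar>a i\<bar> powr r) powr (1 / r) \<le> (?S powr r) powr (1 / r)"
    using assms by (intro powr_mono2 sum_nonneg) auto
  then show ?thesis using assms S by (simp add: lp_sum_ennreal powr_powr)
qed

section \<open>Banach function spaces\<close>

definition exhausts :: "'a measure \<Rightarrow> (nat \<Rightarrow> 'a set) \<Rightarrow> bool" where
  "exhausts M G \<longleftrightarrow> range G \<subseteq> sets M \<and> incseq G \<and> (\<Union>k. G k) = space M"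

text \<open>The sequential form of order continuity in which functionals are shown to be integrals
  and truncations to be approximations. Order continuity of the norm implies it, and so does
  \<open>r\<close>-concavity.\<close>

definition section_continuous :: "'a fun_space \<Rightarrow> bool" where
  "section_continuous X \<longleftrightarrow> (\<forall>x\<in>elts X. \<forall>G. exhausts (msr X) G \<longrightarrow>
     (\<forall>\<epsilon>>0. \<exists>k. nrm X (\<lambda>w. x w - indicator (G k) w * x w) < \<epsilon>))"

context banach_function_space
begin

lemma subspace: "fun_subspace (elts X)"
  unfolding fun_subspace_def using zero_mem add_mem scale_mem by auto

lemma ideal: "fun_ideal (msr X) (elts X)"
  unfolding fun_ideal_def using subspace measurable ideal_mem by blast

lemma elts_meas: "x \<in> elts X \<Longrightarrow> x \<in> borel_measurable (msr X)"
  using measurable by auto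

lemma diff_mem: "x \<in> elts X \<Longrightarrow> z \<in> elts X \<Longrightarrow> (\<lambda>w. x w - z w) \<in> elts X"
  using add_mem[of x "\<lambda>w. (-1) * z w"] scale_mem[of z "-1"] by simp

lemmas abs_mem = fun_ideal_abs[OF ideal]
lemmas sum_mem = fun_ideal_sum[OF ideal]
lemmas lp_sum_mem = fun_ideal_lp_sum[OF ideal]
lemmas mixed_sum_mem = fun_ideal_mixed_sum[OF ideal]

lemma norm_cong:
  assumes "x \<in> elts X" "z \<in> elts X" "AE w in msr X. \<bar>x w\<bar> = \<bar>z w\<bar>"
  shows "nrm X x = nrm X z"
  using assms by (intro antisym norm_mono) (auto elim: eventually_mono)

lemma norm_abs: "x \<in> elts X \<Longrightarrow> nrm X (\<lambda>w. \<bar>x w\<bar>) = nrm X x"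
  by (intro norm_cong abs_mem) auto

lemma norm_zero: "nrm X (\<lambda>_. 0) = 0"
  using norm_zero_iff[OF zero_mem] by simp

lemma norm_diff_commute:
  assumes "x \<in> elts X" "z \<in> elts X"
  shows "nrm X (\<lambda>w. x w - z w) = nrm X (\<lambda>w. z w - x w)"
  using assms by (intro norm_cong diff_mem) auto

lemma norm_triangle_diff:
  assumes "x \<in> elts X" "y \<in> elts X" "z \<in> elts X"
  shows "nrm X (\<lambda>w. x w - z w) \<le> nrm X (\<lambda>w. x w - y w) + nrm X (\<lambda>w. y w - z w)"
  using norm_triangle[OF diff_mem[OF assms(1,2)] diff_mem[OF assms(2,3)]] by simp

lemma indicator_mem: "x \<in> elts X \<Longrightarrow> A \<in> sets (msr X) \<Longrightarrow> (\<lambda>w. indicator A w * x w) \<in> elts X"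
proof (rule ideal_mem[of x])
  assume x: "x \<in> elts X" and A [measurable]: "A \<in> sets (msr X)"
  have [measurable]: "x \<in> borel_measurable (msr X)" by (rule elts_meas[OF x])
  show "(\<lambda>w. indicator A w * x w) \<in> borel_measurable (msr X)" by measurable
qed (auto split: split_indicator)

text \<open>For every \<open>n \<ge> k\<close> the positive part of \<open>s k - z\<close> lies
  below \<open>|s n - z|\<close>, so its norm is 0. No a.e. convergence of the sequence has to be
  known.\<close>

lemma le_norm_limit:
  assumes s: "\<And>n. s n \<in> elts X" and incr: "\<And>n. AE w in msr X. s n w \<le> s (Suc n) w"
    and z: "z \<in> elts X" and lim: "(\<lambda>n. nrm X (\<lambda>w. s n w - z w)) \<longlonglongrightarrow> 0"
  shows "AE w in msr X. s k w \<le> z w"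
proof -
  let ?u = "\<lambda>w. max 0 (s k w - z w)"
  have [measurable]: "s k \<in> borel_measurable (msr X)" "z \<in> borel_measurable (msr X)"
    using s z elts_meas by auto
  have u: "?u \<in> elts X" by (rule ideal_mem[OF diff_mem[OF s[of k] z]]) auto
  have mono: "AE w in msr X. s k w \<le> s n w" if "k \<le> n" for n
    using that
  proof (induction n rule: dec_induct)
    case (step n)
    from step.IH incr[of n] show ?case by eventually_elim simp
  qed simp
  have "nrm X ?u \<le> nrm X (\<lambda>w. s n w - z w)" if "k \<le> n" for n
  proof (rule norm_mono[OF u diff_mem[OF s z]])
    show "AE w in msr X. \<bar>?u w\<bar> \<le> \<bar>s n w - z w\<bar>"
      using mono[OF that] by eventually_elim auto
  qed
  then have "nrm X ?u \<le> 0"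
    by (intro LIMSEQ_le_const[OF lim]) auto
  then have "nrm X ?u = 0" using norm_nonneg[OF u] by simp
  then have "AE w in msr X. ?u w = 0" using norm_zero_iff[OF u] by simp
  then show ?thesis by eventually_elim (auto simp: max_def split: if_splits)
qed

lemma geometric_limit:
  assumes s: "\<And>n. s n \<in> elts X" and step: "\<And>n. nrm X (\<lambda>w. s (Suc n) w - s n w) \<le> (1/2) ^ n"
  obtains z where "z \<in> elts X" "(\<lambda>n. nrm X (\<lambda>w. s n w - z w)) \<longlonglongrightarrow> 0"
proof -
  \<comment> \<open>The factor \<open>2 - 2 * (1/2) ^ k\<close> is the sum of the first
    \<open>k\<close> powers of \<open>1/2\<close>, which keeps the induction exact.\<close>
  have le: "nrm X (\<lambda>w. s (n + k) w - s n w) \<le> (1/2) ^ n * (2 - 2 * (1/2) ^ k)" for n k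
  proof (induction k)
    case (Suc k)
    then show ?case
      using norm_triangle_diff[OF s[of "Suc (n + k)"] s[of "n + k"] s[of n]] step[of "n + k"]
      by (simp add: power_add algebra_simps)
  qed (simp add: norm_zero)
  have le': "nrm X (\<lambda>w. s a w - s b w) \<le> 2 * (1/2) ^ N" if ab: "a \<ge> N" "b \<ge> N" for a b N
  proof -
    have *: "nrm X (\<lambda>w. s a w - s b w) \<le> 2 * (1/2) ^ N" if "b \<le> a" "b \<ge> N" for a b
    proof -
      have "nrm X (\<lambda>w. s a w - s b w) \<le> (1/2) ^ b * (2 - 2 * (1/2) ^ (a - b))"
        using le[of b "a - b"] that by simp
      also have "\<dots> \<le> (1/2) ^ b * 2" by (intro mult_left_mono) auto
      also have "\<dots> \<le> (1/2) ^ N * 2" using that by (intro mult_right_mono power_decreasing) auto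
      finally show ?thesis by simp
    qed
    show ?thesis using *[of a b] *[of b a] ab norm_diff_commute[OF s s, of a b]
      by (cases "b \<le> a") auto
  qed
  have "\<exists>N. \<forall>a\<ge>N. \<forall>b\<ge>N. nrm X (\<lambda>w. s a w - s b w) < e" if e: "e > 0" for e
  proof -
    have "0 < e / 2" using e by simp
    then obtain N where "(1/2 :: real) ^ N < e / 2" using real_arch_pow_inv[of "e/2" "1/2"] by auto
    then have "2 * (1/2 :: real) ^ N < e" by simp
    then have "nrm X (\<lambda>w. s a w - s b w) < e" if "a \<ge> N" "b \<ge> N" for a b
      using le'[OF that] by linarith
    then show ?thesis by blast
  qed
  then have "\<exists>x\<in>elts X. (\<lambda>n. nrm X (\<lambda>w. s n w - x w)) \<longlonglongrightarrow> 0" by (rule complete[OF s])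
  then show ?thesis using that by auto
qed

text \<open>Exhaustion of supports. The finite measure with density \<open>h\<close> has the same
  null sets, and \<open>a x\<close> is its value on the support of \<open>x\<close>. A weighted
  series of elements whose values \<open>a\<close> approach the supremum attains it, and nothing in
  the space can live outside its support.\<close>

lemma ex_weak_unit:
  obtains e where "weak_unit (msr X) (elts X) e"
proof -
  interpret sigma_finite_measure "msr X" by (rule sigma_finite)
  obtain h where h [measurable]: "h \<in> borel_measurable (msr X)"
    and hfin: "integral\<^sup>N (msr X) h \<noteq> \<infinity>" and hpos: "\<And>w. w \<in> space (msr X) \<Longrightarrow> 0 < h w"
    using Ex_finite_integrable_function by blast
  define a where "a x = (\<integral>\<^sup>+w. h w * indicator {w. x w \<noteq> 0} w \<partial>msr X)" for x :: "'a \<Rightarrow> real"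
  obtain f where f: "range f \<subseteq> a ` elts X" "Sup (a ` elts X) = (SUP i::nat. f i)"
    using ennreal_Sup_countable_SUP[of "a ` elts X"] zero_mem by auto
  then have "\<forall>n. \<exists>x\<in>elts X. f n = a x" by blast
  then obtain x where x: "\<And>n. x n \<in> elts X" "\<And>n. f n = a (x n)" by metis
  \<comment> \<open>Each term of the series has norm at most \<open>(1/2) ^ n\<close>, whatever the
    size of \<open>x n\<close>, and the positive weights leave the supports unchanged.\<close>
  define c where "c n = (1/2) ^ n / (1 + nrm X (x n))" for n
  have c: "0 < c n" for n using norm_nonneg[OF x(1), of n] by (simp add: c_def)
  define s where "s n = (\<lambda>w. \<Sum>i<n. c i * \<bar>x i w\<bar>)" for n
  have sm: "s n \<in> elts X" for n
    unfolding s_def by (intro sum_mem scale_mem abs_mem x) auto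
  have "nrm X (\<lambda>w. s (Suc n) w - s n w) \<le> (1/2) ^ n" for n
  proof -
    have "nrm X (\<lambda>w. s (Suc n) w - s n w) = c n * nrm X (x n)"
      using norm_scale[OF abs_mem[OF x(1)], of "c n"] norm_abs[OF x(1)] c[of n]
      by (simp add: s_def)
    also have "\<dots> = (1/2) ^ n * (nrm X (x n) / (1 + nrm X (x n)))" by (simp add: c_def)
    also have "\<dots> \<le> (1/2) ^ n * 1"
      using norm_nonneg[OF x(1), of n] by (intro mult_left_mono) auto
    finally show ?thesis by simp
  qed
  from geometric_limit[OF sm this] obtain z where z: "z \<in> elts X"
    and lim: "(\<lambda>n. nrm X (\<lambda>w. s n w - z w)) \<longlonglongrightarrow> 0" by blast
  have "AE w in msr X. s n w \<le> z w" for n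
    by (rule le_norm_limit[OF sm _ z lim]) (use c in \<open>auto simp: s_def less_imp_le\<close>)
  then have sz: "AE w in msr X. \<forall>n. s n w \<le> z w" by (simp add: AE_all_countable)
  define e where "e = (\<lambda>w. \<bar>z w\<bar>)"
  have e: "e \<in> elts X" unfolding e_def by (rule abs_mem[OF z])
  have [measurable]: "e \<in> borel_measurable (msr X)" by (rule elts_meas[OF e])
  have supp: "AE w in msr X. \<forall>n. x n w \<noteq> 0 \<longrightarrow> e w \<noteq> 0"
    using sz
  proof eventually_elim
    case (elim w)
    show ?case
    proof (intro allI impI)
      fix n assume "x n w \<noteq> 0"
      then have "0 < c n * \<bar>x n w\<bar>" using c by simp
      also have "\<dots> \<le> s (Suc n) w"
        unfolding s_def using c
          by (intro member_le_sum[of n "{..<Suc n}" "\<lambda>i. c i * \<bar>x i w\<bar>"]) (auto simp: less_imp_le)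
      also have "\<dots> \<le> z w" using elim by simp
      finally show "e w \<noteq> 0" by (simp add: e_def)
    qed
  qed
  have "a (x n) \<le> a e" for n
    unfolding a_def using supp
      by (intro nn_integral_mono_AE) (auto elim!: eventually_mono split: split_indicator)
  then have sup: "a v \<le> a e" if "v \<in> elts X" for v
    using f(2) x(2) that by (metis (mono_tags, lifting) SUP_least SUP_upper order_trans)
  have "AE w in msr X. e w = 0 \<longrightarrow> v w = 0" if v: "v \<in> elts X" for v
  proof -
    have [measurable]: "v \<in> borel_measurable (msr X)" by (rule elts_meas[OF v])
    \<comment> \<open>Enlarging \<open>e\<close> by \<open>|v|\<close> cannot raise the supremum
      \<open>a e\<close>. As \<open>a e\<close> is finite it may be cancelled, and the set where
      \<open>v\<close> lives outside the support of \<open>e\<close> is null.\<close>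
    have "a (\<lambda>w. e w + \<bar>v w\<bar>) = a e + (\<integral>\<^sup>+w. h w * indicator {w. e w = 0 \<and> v w \<noteq> 0} w \<partial>msr X)"
      unfolding a_def
    proof (subst nn_integral_add[symmetric])
      have "e w + \<bar>v w\<bar> = 0 \<longleftrightarrow> e w = 0 \<and> v w = 0" for w by (auto simp: e_def)
      then show "(\<integral>\<^sup>+w. h w * indicator {w. e w + \<bar>v w\<bar> \<noteq> 0} w \<partial>msr X) =
          (\<integral>\<^sup>+w. h w * indicator {w. e w \<noteq> 0} w + h w * indicator {w. e w = 0 \<and> v w \<noteq> 0} w \<partial>msr X)"
        by (intro nn_integral_cong) (auto split: split_indicator)
    qed measurable
    moreover have "a e \<noteq> \<infinity>"
    proof -
      have "a e \<le> integral\<^sup>N (msr X) h"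
        unfolding a_def by (intro nn_integral_mono) (auto split: split_indicator)
      then show ?thesis using hfin by (auto simp: top_unique)
    qed
    moreover have "a (\<lambda>w. e w + \<bar>v w\<bar>) \<le> a e" by (rule sup[OF add_mem[OF e abs_mem[OF v]]])
    ultimately have "(\<integral>\<^sup>+w. h w * indicator {w. e w = 0 \<and> v w \<noteq> 0} w \<partial>msr X) = 0"
      using ennreal_add_left_cancel_le[of "a e"
        "\<integral>\<^sup>+w. h w * indicator {w. e w = 0 \<and> v w \<noteq> 0} w \<partial>msr X" 0] by simp
    then have "AE w in msr X. h w * indicator {w. e w = 0 \<and> v w \<noteq> 0} w = 0"
      by (subst nn_integral_0_iff_AE[symmetric]) auto
    then show ?thesis using AE_space
    proof eventually_elim
      case (elim w)
      then show ?case using hpos[of w] by (auto split: split_indicator_asm)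
    qed
  qed
  then show ?thesis using that[of e] e unfolding weak_unit_def by (simp add: e_def)
qed

text \<open>Norm-bounded increasing sequences converge under \<open>r\<close>-concavity. Otherwise
  there are arbitrarily many successive increments of norm at least \<open>e / 2\<close>; concavity
  bounds the sum of the \<open>r\<close>-th powers of their norms through their lattice
  \<open>r\<close>-sum, which lies below one telescoped difference.\<close>

lemma monotone_limit:
  assumes r: "1 \<le> r" and conc: "r_concave r X"
    and s: "\<And>n. s n \<in> elts X" and s0: "\<And>n. AE w in msr X. 0 \<le> s n w"
    and incr: "\<And>n. AE w in msr X. s n w \<le> s (Suc n) w"
    and bound: "\<And>n. nrm X (s n) \<le> B"
  obtains z where "z \<in> elts X" "(\<lambda>n. nrm X (\<lambda>w. s n w - z w)) \<longlonglongrightarrow> 0" "nrm X z \<le> B"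
    "AE w in msr X. (\<lambda>n. s n w) \<longlonglongrightarrow> z w"
proof -
  obtain M where M: "\<And>n y. (\<forall>i<n. y i \<in> elts X) \<Longrightarrow>
        (\<Sum>i<n. nrm X (y i) powr r) powr (1 / r) \<le>
          M * nrm X (\<lambda>w. lp_sum (ennreal r) n (\<lambda>i. y i w))"
    using conc r unfolding r_concave_def by (auto simp: lp_sum_ennreal)
  have B0: "0 \<le> B" using bound[of 0] norm_nonneg[OF s, of 0] by simp
  have incr': "AE w in msr X. \<forall>n. s n w \<le> s (Suc n) w" using incr by (simp add: AE_all_countable)
  have "\<exists>N. \<forall>a\<ge>N. \<forall>b\<ge>N. nrm X (\<lambda>w. s a w - s b w) < e" if e: "e > 0" for e
  proof (rule ccontr)
    assume "\<not> ?thesis"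
    then have bad: "\<exists>a\<ge>N. \<exists>b\<ge>N. e \<le> nrm X (\<lambda>w. s a w - s b w)" for N by (meson not_le)
    have "\<exists>a>N. e / 2 \<le> nrm X (\<lambda>w. s a w - s N w)" for N
    proof -
      obtain a b where ab: "a \<ge> N" "b \<ge> N" "e \<le> nrm X (\<lambda>w. s a w - s b w)" using bad by blast
      have "e \<le> nrm X (\<lambda>w. s a w - s N w) + nrm X (\<lambda>w. s b w - s N w)"
        using norm_triangle_diff[OF s[of a] s[of N] s[of b]] ab(3) norm_diff_commute[OF s s, of N
          b] by simp
      then consider "e / 2 \<le> nrm X (\<lambda>w. s a w - s N w)" | "e / 2 \<le> nrm X (\<lambda>w. s b w - s N w)"
        by linarith
      \<comment> \<open>This excludes the index \<open>N\<close> itself, so that the chosen index is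
        strictly larger and the increments follow each other.\<close>
      moreover have "nrm X (\<lambda>w. s N w - s N w) = 0" by (simp add: norm_zero)
      ultimately show ?thesis using ab(1,2) e by (metis half_gt_zero le_neq_implies_less not_le)
    qed
    then obtain nx where nx: "\<And>N. nx N > N" "\<And>N. e / 2 \<le> nrm X (\<lambda>w. s (nx N) w - s N w)"
      by metis
    define t where "t k = (nx ^^ k) 0" for k
    have tS: "t (Suc k) = nx (t k)" for k by (simp add: t_def)
    \<comment> \<open>Consecutive increments along the subsequence: nonnegative a.e., each of norm
      at least \<open>e / 2\<close>, with sum \<open>s (t K) - s (t 0)\<close> of norm at most
      \<open>2 * B\<close>.\<close>
    define y where "y k = (\<lambda>w. s (t (Suc k)) w - s (t k) w)" for k
    have y: "y k \<in> elts X" for k unfolding y_def by (intro diff_mem s)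
    have y0: "AE w in msr X. \<forall>k. 0 \<le> y k w"
      using incr'
    proof eventually_elim
      case (elim w)
      then have "incseq (\<lambda>n. s n w)" by (intro incseq_SucI) auto
      then show ?case unfolding y_def tS using nx(1) by (auto simp: incseq_def less_imp_le)
    qed
    have K: "real K * (e / 2) powr r \<le> (\<bar>M\<bar> * (2 * B)) powr r" for K
    proof -
      have "(\<Sum>i<K. nrm X (y i) powr r) powr (1 / r) \<le>
        M * nrm X (\<lambda>w. lp_sum (ennreal r) K (\<lambda>i. y i w))"
        using y by (intro M) auto
      also have "\<dots> \<le> \<bar>M\<bar> * nrm X (\<lambda>w. lp_sum (ennreal r) K (\<lambda>i. y i w))"
        using y r by (intro mult_right_mono norm_nonneg lp_sum_mem) auto
      also have "\<dots> \<le> \<bar>M\<bar> * nrm X (\<lambda>w. s (t K) w - s (t 0) w)"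
      proof (intro mult_left_mono norm_mono lp_sum_mem diff_mem s y)
        show "AE w in msr X. \<bar>lp_sum (ennreal r) K (\<lambda>i. y i w)\<bar> \<le> \<bar>s (t K) w - s (t 0) w\<bar>"
          using y0
        proof eventually_elim
          case (elim w)
          have "(\<Sum>i<K. \<bar>y i w\<bar>) = (\<Sum>i<K. s (t (Suc i)) w - s (t i) w)"
            using elim by (intro sum.cong) (auto simp: y_def)
          also have "\<dots> = s (t K) w - s (t 0) w" by (rule sum_lessThan_telescope)
          finally show ?case
            using lp_sum_le_l1[OF r, of K "\<lambda>i. y i w"] lp_sum_nonneg[of "ennreal r" K "\<lambda>i. y i w"]
              by simp
        qed
      qed (use r in auto)
      also have "\<dots> \<le> \<bar>M\<bar> * (2 * B)"
      proof (intro mult_left_mono)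
        have "nrm X (\<lambda>w. s (t K) w - s (t 0) w) \<le>
            nrm X (\<lambda>w. s (t K) w - 0) + nrm X (\<lambda>w. 0 - s (t 0) w)"
          by (rule norm_triangle_diff[OF s zero_mem s])
        also have "\<dots> = nrm X (s (t K)) + nrm X (s (t 0))"
          using norm_diff_commute[OF zero_mem s] by simp
        finally show "nrm X (\<lambda>w. s (t K) w - s (t 0) w) \<le> 2 * B"
          using bound[of "t K"] bound[of "t 0"] by linarith
      qed auto
      finally have "((\<Sum>i<K. nrm X (y i) powr r) powr (1 / r)) powr r \<le> (\<bar>M\<bar> * (2 * B)) powr r"
        using r by (intro powr_mono2) auto
      then have "(\<Sum>i<K. nrm X (y i) powr r) \<le> (\<bar>M\<bar> * (2 * B)) powr r"
        using r by (simp add: powr_powr sum_nonneg)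
      moreover have "(\<Sum>i<K. (e / 2) powr r) \<le> (\<Sum>i<K. nrm X (y i) powr r)"
        using r e nx(2) unfolding y_def tS by (intro sum_mono powr_mono2) auto
      ultimately show ?thesis by simp
    qed
    obtain K where "real K * (e / 2) powr r > (\<bar>M\<bar> * (2 * B)) powr r"
      using reals_Archimedean3[of "(e / 2) powr r"] e by auto
    then show False using K[of K] by simp
  qed
  then have "\<exists>x\<in>elts X. (\<lambda>n. nrm X (\<lambda>w. s n w - x w)) \<longlonglongrightarrow> 0" by (rule complete[OF s])
  then obtain z where z: "z \<in> elts X" and lim: "(\<lambda>n. nrm X (\<lambda>w. s n w - z w)) \<longlonglongrightarrow> 0"
    by auto
  have sz: "AE w in msr X. s n w \<le> z w" for n by (rule le_norm_limit[OF s incr z lim])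
  have sz': "AE w in msr X. \<forall>n. s n w \<le> z w" using sz by (simp add: AE_all_countable)
  \<comment> \<open>The norm limit \<open>z\<close> still has to be identified with the pointwise
    limit \<open>u\<close>. As \<open>u\<close> lies between every \<open>s n\<close> and
    \<open>z\<close>, the function \<open>z - u\<close> is dominated by \<open>|s n - z|\<close> and
    has norm 0.\<close>
  define u where "u w = lim (\<lambda>n. s n w)" for w
  have [measurable]: "s n \<in> borel_measurable (msr X)" "z \<in> borel_measurable (msr X)" for n
    using s z elts_meas by auto
  have [measurable]: "u \<in> borel_measurable (msr X)"
    unfolding u_def by (rule borel_measurable_lim_metric) simp
  have lu: "AE w in msr X. (\<lambda>n. s n w) \<longlonglongrightarrow> u w \<and> (\<forall>n. s n w \<le> u w) \<and> u w \<le> z w"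
    using incr' sz'
  proof eventually_elim
    case (elim w)
    have inc: "incseq (\<lambda>n. s n w)" using elim by (intro incseq_SucI) auto
    obtain L where L: "(\<lambda>n. s n w) \<longlonglongrightarrow> L" "\<forall>n. s n w \<le> L"
      using incseq_convergent[OF inc, of "z w"] elim by blast
    then have "u w = L" unfolding u_def by (simp add: limI)
    then show ?case using L elim LIMSEQ_le_const2[OF L(1)] by auto
  qed
  have d: "(\<lambda>w. z w - u w) \<in> elts X"
  proof (rule ideal_mem[OF diff_mem[OF z s[of 0]]])
    show "AE w in msr X. \<bar>z w - u w\<bar> \<le> \<bar>z w - s 0 w\<bar>"
      using lu
    proof eventually_elim
      case (elim w)
      then have "s 0 w \<le> u w" "u w \<le> z w" by auto
      then show ?case by linarith
    qed
  qed measurable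
  have "nrm X (\<lambda>w. z w - u w) \<le> nrm X (\<lambda>w. s n w - z w)" for n
  proof (rule norm_mono[OF d diff_mem[OF s z]])
    show "AE w in msr X. \<bar>z w - u w\<bar> \<le> \<bar>s n w - z w\<bar>"
      using lu
    proof eventually_elim
      case (elim w)
      then have "s n w \<le> u w" "u w \<le> z w" by auto
      then show ?case by linarith
    qed
  qed
  then have "nrm X (\<lambda>w. z w - u w) \<le> 0" by (intro LIMSEQ_le_const[OF lim]) auto
  then have "nrm X (\<lambda>w. z w - u w) = 0" using norm_nonneg[OF d] by simp
  then have "AE w in msr X. z w - u w = 0" using norm_zero_iff[OF d] by simp
  with lu have "AE w in msr X. (\<lambda>n. s n w) \<longlonglongrightarrow> z w" by eventually_elim auto
  moreover have "nrm X z \<le> B"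
  proof -
    have "nrm X z \<le> B + nrm X (\<lambda>w. s n w - z w)" for n
      using norm_triangle[OF s diff_mem[OF z s], of n n] norm_diff_commute[OF z s, of n] bound[of
        n] by simp
    moreover have "(\<lambda>n. B + nrm X (\<lambda>w. s n w - z w)) \<longlonglongrightarrow> B + 0"
      by (intro tendsto_add tendsto_const lim)
    ultimately show ?thesis by (intro LIMSEQ_le_const[of _ B]) auto
  qed
  ultimately show ?thesis using that z lim by blast
qed

text \<open>The truncations of \<open>|x|\<close> to the sets \<open>G k\<close> increase and are
  bounded in norm by \<open>x\<close>, so they converge in norm; the pointwise limit shows that the
  limit is \<open>|x|\<close>.\<close>

lemma r_concave_section_continuous:
  assumes r: "1 \<le> r" and conc: "r_concave r X"
  shows "section_continuous X"
  unfolding section_continuous_def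
proof (intro ballI allI impI)
  fix x G and \<epsilon> :: real assume x: "x \<in> elts X" and G: "exhausts (msr X) G" and \<epsilon>: "\<epsilon> > 0"
  have GM: "G k \<in> sets (msr X)" for k using G unfolding exhausts_def by auto
  have Gmono: "G k \<subseteq> G (Suc k)" for k using G unfolding exhausts_def incseq_def by auto
  define s where "s k = (\<lambda>w. indicator (G k) w * \<bar>x w\<bar>)" for k
  have s: "s k \<in> elts X" for k unfolding s_def by (intro indicator_mem abs_mem x GM)
  obtain z where z: "z \<in> elts X" "(\<lambda>n. nrm X (\<lambda>w. s n w - z w)) \<longlonglongrightarrow> 0"
    and zlim: "AE w in msr X. (\<lambda>n. s n w) \<longlonglongrightarrow> z w"
  proof (rule monotone_limit[OF r conc s])
    show "AE w in msr X. s n w \<le> s (Suc n) w" for n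
      using Gmono[of n] by (auto simp: s_def split: split_indicator)
    show "nrm X (s n) \<le> nrm X x" for n
      by (intro norm_mono s x) (auto simp: s_def split: split_indicator)
  qed (auto simp: s_def)
  have "AE w in msr X. z w = \<bar>x w\<bar>"
    using zlim AE_space
  proof eventually_elim
    case (elim w)
    then obtain k where k: "w \<in> G k" using G unfolding exhausts_def by blast
    have "s n w = \<bar>x w\<bar>" if "n \<ge> k" for n
      using k G that unfolding exhausts_def incseq_def s_def by (auto split: split_indicator)
    then have "(\<lambda>n. s n w) \<longlonglongrightarrow> \<bar>x w\<bar>"
      by (intro tendsto_eventually) (auto simp: eventually_sequentially)
    then show ?case using elim(1) LIMSEQ_unique by blast
  qed
  then have "nrm X (\<lambda>w. x w - indicator (G k) w * x w) = nrm X (\<lambda>w. s k w - z w)" for k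
    by (intro norm_cong diff_mem indicator_mem x s z GM)
      (auto elim!: eventually_mono simp: s_def split: split_indicator)
  moreover have "\<exists>k. nrm X (\<lambda>w. s k w - z w) < \<epsilon>"
    using z(2) \<epsilon> order_tendstoD(2) by (metis (lifting) eventually_happens' sequentially_bot)
  ultimately show "\<exists>k. nrm X (\<lambda>w. x w - indicator (G k) w * x w) < \<epsilon>" by auto
qed

text \<open>The tails of \<open>|x|\<close> outside the sets \<open>G k\<close> form a downward
  directed set. Its infimum is 0 because every point lies in some \<open>G k\<close>; as there are
  only countably many \<open>k\<close>, the exceptional null sets can be united.\<close>

lemma order_continuous_section_continuous:
  assumes "order_continuous X"
  shows "section_continuous X"
  unfolding section_continuous_def
proof (intro ballI allI impI)
  fix x G and \<epsilon> :: real assume x: "x \<in> elts X" and G: "exhausts (msr X) G" and \<epsilon>: "\<epsilon> > 0"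
  have GM: "G k \<in> sets (msr X)" for k using G unfolding exhausts_def by auto
  have Gmono: "G k \<subseteq> G l" if "k \<le> l" for k l using G that unfolding exhausts_def incseq_def by auto
  define s where "s k = (\<lambda>w. \<bar>x w\<bar> - indicator (G k) w * \<bar>x w\<bar>)" for k
  have s: "s k \<in> elts X" for k unfolding s_def by (intro diff_mem indicator_mem abs_mem x GM)
  have "\<exists>c\<in>range s. AE w in msr X. c w \<le> a w \<and> c w \<le> b w" if ab: "a \<in> range s" "b \<in> range s" for a b
  proof -
    obtain k l where kl: "a = s k" "b = s l" using ab by auto
    have "s (max k l) w \<le> a w \<and> s (max k l) w \<le> b w" for w
      using Gmono[of k "max k l"] Gmono[of l "max k l"] kl
      by (auto simp: s_def split: split_indicator)
    then show ?thesis by (intro bexI[of _ "s (max k l)"]) auto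
  qed
  moreover have "AE w in msr X. 0 \<le> a w" if "a \<in> range s" for a
    using that by (auto simp: s_def split: split_indicator)
  moreover have "AE w in msr X. z w \<le> 0" if "\<forall>a\<in>range s. AE w in msr X. z w \<le> a w" for z
  proof -
    have "AE w in msr X. \<forall>k. z w \<le> s k w" using that by (simp add: AE_all_countable)
    then show ?thesis using AE_space
    proof eventually_elim
      case (elim w)
      then obtain k where "w \<in> G k" using G unfolding exhausts_def by blast
      then show ?case using elim(1)[rule_format, of k] by (simp add: s_def)
    qed
  qed
  moreover have "range s \<subseteq> elts X" "range s \<noteq> {}" using s by auto
  ultimately have "\<exists>a\<in>range s. nrm X a < \<epsilon>"
    using assms[unfolded order_continuous_def, THEN spec, of "range s"] \<epsilon> by simp
  then obtain k where "nrm X (s k) < \<epsilon>" by auto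
  moreover have "nrm X (s k) = nrm X (\<lambda>w. x w - indicator (G k) w * x w)"
    by (intro norm_cong s diff_mem indicator_mem x GM) (auto simp: s_def split: split_indicator)
  ultimately show "\<exists>k. nrm X (\<lambda>w. x w - indicator (G k) w * x w) < \<epsilon>" by auto
qed

end

section \<open>Duality\<close>

lemma integral_double_sum:
  fixes f :: "nat \<Rightarrow> nat \<Rightarrow> 'a \<Rightarrow> real"
  assumes "\<And>i j. i < n \<Longrightarrow> j < k \<Longrightarrow> integrable M (f i j)"
  shows "(\<integral>w. (\<Sum>i<n. \<Sum>j<k. f i j w) \<partial>M) = (\<Sum>i<n. \<Sum>j<k. (\<integral>w. f i j w \<partial>M))"
proof -
  have "(\<integral>w. (\<Sum>i<n. \<Sum>j<k. f i j w) \<partial>M) = (\<Sum>i<n. (\<integral>w. (\<Sum>j<k. f i j w) \<partial>M))"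
    using assms by (intro Bochner_Integration.integral_sum Bochner_Integration.integrable_sum) auto
  also have "\<dots> = (\<Sum>i<n. \<Sum>j<k. (\<integral>w. f i j w \<partial>M))"
    using assms by (intro sum.cong Bochner_Integration.integral_sum) auto
  finally show ?thesis .
qed

section \<open>The dual as an ideal of functions, and norming functionals\<close>

context banach_function_space
begin

text \<open>The witness is \<open>|v| sgn y'\<close>. It converts a bound on the pairing into a
  bound on the integral of the modulus.\<close>

lemma pairing_abs:
  assumes v: "v \<in> elts X" and y: "y' \<in> borel_measurable (msr X)"
  obtains z where "z \<in> elts X" "nrm X z \<le> nrm X v" "\<And>w. z w * y' w = \<bar>v w * y' w\<bar>"
proof -
  define z where "z = (\<lambda>w. \<bar>v w\<bar> * sgn (y' w))"
  have [measurable]: "v \<in> borel_measurable (msr X)" "y' \<in> borel_measurable (msr X)"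
    using elts_meas[OF v] y by auto
  have "\<bar>z w\<bar> \<le> \<bar>v w\<bar>" for w by (auto simp: z_def abs_mult sgn_if)
  then have le: "AE w in msr X. \<bar>z w\<bar> \<le> \<bar>v w\<bar>" by simp
  have "z \<in> borel_measurable (msr X)" unfolding z_def by measurable
  then have zm: "z \<in> elts X" by (rule ideal_mem[OF v _ le])
  have "sgn (y' w) * y' w = \<bar>y' w\<bar>" for w by (simp add: sgn_if)
  then have "z w * y' w = \<bar>v w * y' w\<bar>" for w by (simp add: z_def mult.assoc abs_mult)
  then show ?thesis using that[OF zm norm_mono[OF zm v le]] by blast
qed

text \<open>With the modulus under the integral the conditions pass to smaller functions, which
  makes the ideal property provable. The vanishing condition over all sets reduces to one set, the
  zero set of the weak unit.\<close>

lemma mem_dual_iff: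
  assumes e: "weak_unit (msr X) (elts X) e"
  shows "y' \<in> elts (dual_space X) \<longleftrightarrow> y' \<in> borel_measurable (msr X) \<and>
     (\<forall>v\<in>elts X. integrable (msr X) (\<lambda>w. v w * y' w)) \<and>
     (\<exists>C\<ge>0. \<forall>v\<in>elts X. (\<integral>w. \<bar>v w * y' w\<bar> \<partial>msr X) \<le> C * nrm X v) \<and>
     (AE w in msr X. e w = 0 \<longrightarrow> y' w = 0)" (is "?L \<longleftrightarrow> ?R")
proof
  assume L: ?L
  then have y': "y' \<in> borel_measurable (msr X)" "\<forall>v\<in>elts X. integrable (msr X) (\<lambda>w. v w * y' w)"
    "\<exists>C. \<forall>v\<in>elts X. \<bar>pairing X v y'\<bar> \<le> C * nrm X v"
    and van: "\<And>A. A \<in> sets (msr X) \<Longrightarrow> \<forall>v\<in>elts X. AE w in msr X. w \<in> A \<longrightarrow> v w = 0 \<Longrightarrow>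
        AE w in msr X. w \<in> A \<longrightarrow> y' w = 0"
    by (auto simp: dual_space_def)
  then obtain C where C: "\<And>v. v \<in> elts X \<Longrightarrow> \<bar>pairing X v y'\<bar> \<le> C * nrm X v" by blast
  have "(\<integral>w. \<bar>v w * y' w\<bar> \<partial>msr X) \<le> \<bar>C\<bar> * nrm X v" if v: "v \<in> elts X" for v
  proof -
    obtain z where z: "z \<in> elts X" "nrm X z \<le> nrm X v" "\<And>w. z w * y' w = \<bar>v w * y' w\<bar>"
      using pairing_abs[OF v y'(1)] by blast
    have "(\<integral>w. \<bar>v w * y' w\<bar> \<partial>msr X) = pairing X z y'" by (simp add: pairing_def z(3))
    also have "\<dots> \<le> C * nrm X z" using C[OF z(1)] by simp
    also have "\<dots> \<le> \<bar>C\<bar> * nrm X v"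
      using z norm_nonneg[OF z(1)] by (intro mult_mono) auto
    finally show ?thesis .
  qed
  then have "\<exists>C\<ge>0. \<forall>v\<in>elts X. (\<integral>w. \<bar>v w * y' w\<bar> \<partial>msr X) \<le> C * nrm X v"
    by (intro exI[of _ "\<bar>C\<bar>"]) auto
  moreover have "AE w in msr X. e w = 0 \<longrightarrow> y' w = 0"
  proof -
    have [measurable]: "e \<in> borel_measurable (msr X)"
      using e elts_meas unfolding weak_unit_def by auto
    have "AE w in msr X. w \<in> {w \<in> space (msr X). e w = 0} \<longrightarrow> y' w = 0"
    proof (rule van)
      show "\<forall>v\<in>elts X. AE w in msr X. w \<in> {w \<in> space (msr X). e w = 0} \<longrightarrow> v w = 0"
        using e unfolding weak_unit_def by (auto elim: eventually_mono)
    qed measurable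
    then show ?thesis using AE_space by eventually_elim auto
  qed
  ultimately show ?R using y' by blast
next
  assume R: ?R
  then obtain C where C: "\<And>v. v \<in> elts X \<Longrightarrow> (\<integral>w. \<bar>v w * y' w\<bar> \<partial>msr X) \<le> C * nrm X v" by blast
  have "\<bar>pairing X v y'\<bar> \<le> C * nrm X v" if "v \<in> elts X" for v
    using C[OF that] integral_abs_bound[of "msr X" "\<lambda>w. v w * y' w"] unfolding pairing_def
      by linarith
  moreover have "AE w in msr X. w \<in> A \<longrightarrow> y' w = 0"
    if "\<forall>v\<in>elts X. AE w in msr X. w \<in> A \<longrightarrow> v w = 0" for A
  proof -
    have "AE w in msr X. w \<in> A \<longrightarrow> e w = 0" using that e unfolding weak_unit_def by blast
    moreover have "AE w in msr X. e w = 0 \<longrightarrow> y' w = 0" using R by blast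
    ultimately show ?thesis by eventually_elim auto
  qed
  ultimately show ?L using R by (auto simp: dual_space_def)
qed

lemma dual_meas: "y' \<in> elts (dual_space X) \<Longrightarrow> y' \<in> borel_measurable (msr X)"
  and dual_integrable: "y' \<in> elts (dual_space X) \<Longrightarrow> v \<in> elts X \<Longrightarrow> integrable (msr X) (\<lambda>w. v w * y' w)"
  by (auto simp: dual_space_def)

lemma dual_ideal: "fun_ideal (msr X) (elts (dual_space X))"
proof -
  obtain e where e: "weak_unit (msr X) (elts X) e" using ex_weak_unit by blast
  note iff = mem_dual_iff[OF e]
  have "(\<lambda>_. 0) \<in> elts (dual_space X)" 
    unfolding iff using norm_nonneg by (auto intro!: exI[of _ 0])
  moreover have "(\<lambda>w. u w + v w) \<in> elts (dual_space X)"
    if u: "u \<in> elts (dual_space X)" and v: "v \<in> elts (dual_space X)" for u v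
  proof -
    obtain C D where C: "0 \<le> C" "\<And>x. x \<in> elts X \<Longrightarrow> (\<integral>w. \<bar>x w * u w\<bar> \<partial>msr X) \<le> C * nrm X x"
      and D: "0 \<le> D" "\<And>x. x \<in> elts X \<Longrightarrow> (\<integral>w. \<bar>x w * v w\<bar> \<partial>msr X) \<le> D * nrm X x"
      using u v unfolding iff by blast
    have i: "integrable (msr X) (\<lambda>w. x w * u w)" "integrable (msr X) (\<lambda>w. x w * v w)"
      if "x \<in> elts X" for x
      using dual_integrable u v that by auto
    have "(\<integral>w. \<bar>x w * (u w + v w)\<bar> \<partial>msr X) \<le> (C + D) * nrm X x" if x: "x \<in> elts X" for x
    proof -
      have "(\<integral>w. \<bar>x w * (u w + v w)\<bar> \<partial>msr X) \<le> (\<integral>w. \<bar>x w * u w\<bar> + \<bar>x w * v w\<bar> \<partial>msr X)"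
        using i[OF x] by (intro integral_mono integrable_abs Bochner_Integration.integrable_add)
          (auto simp: distrib_left abs_triangle_ineq)
      also have "\<dots> = (\<integral>w. \<bar>x w * u w\<bar> \<partial>msr X) + (\<integral>w. \<bar>x w * v w\<bar> \<partial>msr X)"
        using i[OF x] by (intro Bochner_Integration.integral_add integrable_abs)
      finally show ?thesis using C(2)[OF x] D(2)[OF x] by (simp add: distrib_right)
    qed
    moreover have "AE w in msr X. e w = 0 \<longrightarrow> u w = 0" "AE w in msr X. e w = 0 \<longrightarrow> v w = 0"
      using u v unfolding iff by auto
    then have "AE w in msr X. e w = 0 \<longrightarrow> u w + v w = 0" by eventually_elim auto
    moreover have "0 \<le> C + D" using C D by simp
    ultimately show ?thesis
      unfolding iff using dual_meas[OF u] dual_meas[OF v] i by (auto simp: distrib_left)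
  qed
  moreover have "(\<lambda>w. a * u w) \<in> elts (dual_space X)" if u: "u \<in> elts (dual_space X)" for u a
  proof -
    obtain C where C: "0 \<le> C" "\<And>x. x \<in> elts X \<Longrightarrow> (\<integral>w. \<bar>x w * u w\<bar> \<partial>msr X) \<le> C * nrm X x"
      using u unfolding iff by blast
    have "(\<integral>w. \<bar>x w * (a * u w)\<bar> \<partial>msr X) \<le> (\<bar>a\<bar> * C) * nrm X x" if x: "x \<in> elts X" for x
    proof -
      have "(\<integral>w. \<bar>x w * (a * u w)\<bar> \<partial>msr X) = \<bar>a\<bar> * (\<integral>w. \<bar>x w * u w\<bar> \<partial>msr X)"
        by (subst integral_mult_right_zero[symmetric]) (simp add: abs_mult mult_ac)
      then show ?thesis using mult_left_mono[OF C(2)[OF x], of "\<bar>a\<bar>"] by (simp add: mult_ac)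
    qed
    moreover have "integrable (msr X) (\<lambda>w. x w * (a * u w))" if "x \<in> elts X" for x
      using integrable_mult_right[OF dual_integrable[OF u that], of a] by (simp add: mult_ac)
    moreover have "AE w in msr X. e w = 0 \<longrightarrow> a * u w = 0"
    proof -
      have "AE w in msr X. e w = 0 \<longrightarrow> u w = 0" using u unfolding iff by auto
      then show ?thesis by eventually_elim auto
    qed
    moreover have "0 \<le> \<bar>a\<bar> * C" using C by simp
    moreover have "(\<lambda>w. a * u w) \<in> borel_measurable (msr X)" using dual_meas[OF u] by simp
    ultimately show ?thesis
      unfolding iff by (intro conjI ballI exI[of _ "\<bar>a\<bar> * C"])
  qed
  moreover have "u \<in> elts (dual_space X)"
    if v: "v \<in> elts (dual_space X)" and u: "u \<in> borel_measurable (msr X)"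
      and le: "AE w in msr X. \<bar>u w\<bar> \<le> \<bar>v w\<bar>" for u v
  proof -
    obtain C where C: "0 \<le> C" "\<And>x. x \<in> elts X \<Longrightarrow> (\<integral>w. \<bar>x w * v w\<bar> \<partial>msr X) \<le> C * nrm X x"
      using v unfolding iff by blast
    have i: "integrable (msr X) (\<lambda>w. x w * u w)" if x: "x \<in> elts X" for x
    proof (rule Bochner_Integration.integrable_bound[OF dual_integrable[OF v x]])
      show "(\<lambda>w. x w * u w) \<in> borel_measurable (msr X)" using elts_meas[OF x] u by simp
      show "AE w in msr X. norm (x w * u w) \<le> norm (x w * v w)"
        using le by eventually_elim (simp add: abs_mult mult_left_mono)
    qed
    have "(\<integral>w. \<bar>x w * u w\<bar> \<partial>msr X) \<le> C * nrm X x" if x: "x \<in> elts X" for x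
    proof -
      have "(\<integral>w. \<bar>x w * u w\<bar> \<partial>msr X) \<le> (\<integral>w. \<bar>x w * v w\<bar> \<partial>msr X)"
        using i[OF x] dual_integrable[OF v x] le
        by (intro integral_mono_AE integrable_abs) (auto elim!: eventually_mono simp: abs_mult
          mult_left_mono)
      then show ?thesis using C(2)[OF x] by linarith
    qed
    moreover have "AE w in msr X. e w = 0 \<longrightarrow> u w = 0"
    proof -
      have "AE w in msr X. e w = 0 \<longrightarrow> v w = 0" using v unfolding iff by auto
      with le show ?thesis by eventually_elim auto
    qed
    ultimately show ?thesis unfolding iff using u i C(1) by blast
  qed
  ultimately show ?thesis
    unfolding fun_ideal_def fun_subspace_def using dual_meas by blast
qed

lemma dual_norm_le:
  assumes "\<And>v. v \<in> elts X \<Longrightarrow> (\<integral>w. \<bar>v w * y' w\<bar> \<partial>msr X) \<le> B * nrm X v" "0 \<le> B"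
  shows "nrm (dual_space X) y' \<le> B"
proof -
  have "\<bar>pairing X v y'\<bar> \<le> B" if v: "v \<in> elts X" "nrm X v \<le> 1" for v
  proof -
    have "\<bar>pairing X v y'\<bar> \<le> B * nrm X v"
      using assms(1)[OF v(1)] integral_abs_bound[of "msr X" "\<lambda>w. v w * y' w"]
      unfolding pairing_def by linarith
    also have "\<dots> \<le> B * 1" using v assms(2) by (intro mult_left_mono)
    finally show ?thesis by simp
  qed
  then show ?thesis
    unfolding dual_space_def using zero_mem norm_zero
    by (auto intro!: cSup_least exI[of _ "\<lambda>_. 0"])
qed

lemma dual_norm_upper:
  assumes y': "y' \<in> elts (dual_space X)" and u: "u \<in> elts X" "nrm X u \<le> 1"
  shows "\<bar>pairing X u y'\<bar> \<le> nrm (dual_space X) y'"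
proof -
  obtain C where C: "\<And>v. v \<in> elts X \<Longrightarrow> \<bar>pairing X v y'\<bar> \<le> C * nrm X v"
    using y' unfolding dual_space_def by auto
  have "\<bar>pairing X v y'\<bar> \<le> \<bar>C\<bar>" if v: "v \<in> elts X" "nrm X v \<le> 1" for v
  proof -
    have "\<bar>pairing X v y'\<bar> \<le> C * nrm X v" by (rule C[OF v(1)])
    also have "\<dots> \<le> \<bar>C\<bar> * 1" using v norm_nonneg by (intro mult_mono) auto
    finally show ?thesis by simp
  qed
  then have "bdd_above {\<bar>pairing X y y'\<bar> | y. y \<in> elts X \<and> nrm X y \<le> 1}"
    by (intro bdd_aboveI[of _ "\<bar>C\<bar>"]) auto
  then show ?thesis unfolding dual_space_def using u by (auto intro!: cSup_upper)
qed

lemma dual_norm_nonneg: "y' \<in> elts (dual_space X) \<Longrightarrow> 0 \<le> nrm (dual_space X) y'"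
  using dual_norm_upper[OF _ zero_mem] norm_zero by (simp add: pairing_def)

lemma dual_holder:
  assumes v: "v \<in> elts X" and y': "y' \<in> elts (dual_space X)"
  shows "(\<integral>w. \<bar>v w * y' w\<bar> \<partial>msr X) \<le> nrm X v * nrm (dual_space X) y'"
proof -
  obtain z where z: "z \<in> elts X" "nrm X z \<le> nrm X v" "\<And>w. z w * y' w = \<bar>v w * y' w\<bar>"
    using pairing_abs[OF v dual_meas[OF y']] by blast
  have eq: "(\<integral>w. \<bar>v w * y' w\<bar> \<partial>msr X) = pairing X z y'" by (simp add: pairing_def z(3))
  have nn: "0 \<le> nrm (dual_space X) y'" by (rule dual_norm_nonneg[OF y'])
  show ?thesis
  \<comment> \<open>A null \<open>z\<close> cannot be normalised, but then it vanishes a.e. and the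
    integral is 0.\<close>
  proof (cases "nrm X z = 0")
    case True
    then have "AE w in msr X. z w = 0" using norm_zero_iff[OF z(1)] by simp
    then have "pairing X z y' = (\<integral>w. 0 \<partial>msr X)"
      unfolding pairing_def using elts_meas[OF z(1)] dual_meas[OF y']
      by (intro integral_cong_AE) (auto elim: eventually_mono)
    then have "(\<integral>w. \<bar>v w * y' w\<bar> \<partial>msr X) \<le> 0" unfolding eq by simp
    also have "\<dots> \<le> nrm X v * nrm (dual_space X) y'" using nn norm_nonneg[OF v] by simp
    finally show ?thesis .
  next
    case False
    then have pos: "nrm X z > 0" using norm_nonneg[OF z(1)] by simp
    have "nrm X (\<lambda>w. inverse (nrm X z) * z w) \<le> 1"
      using norm_scale[OF z(1), of "inverse (nrm X z)"] pos by simp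
    then have "\<bar>pairing X (\<lambda>w. inverse (nrm X z) * z w) y'\<bar> \<le> nrm (dual_space X) y'"
      by (intro dual_norm_upper y' scale_mem z)
    moreover have "pairing X (\<lambda>w. inverse (nrm X z) * z w) y' = inverse (nrm X z) * pairing X z y'"
      unfolding pairing_def by (simp add: mult.assoc)
    ultimately have "pairing X z y' \<le> nrm X z * nrm (dual_space X) y'"
      using pos mult_left_mono[of "inverse (nrm X z) * pairing X z y'" "nrm (dual_space X) y'"
        "nrm X z"]
      by (simp add: mult.assoc[symmetric])
    also have "\<dots> \<le> nrm X v * nrm (dual_space X) y'" using z(2) nn by (rule mult_right_mono)
    finally show ?thesis using eq by simp
  qed
qed

text \<open>Positivity is built into the cone, so Hahn-Banach gives a positive functional at once.
  Section continuity, together with the bound by the norm, makes it an integral, and its density is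
  the norming element.\<close>

lemma norming_functional:
  assumes sc: "section_continuous X" and y: "y \<in> elts X" and y0: "AE w in msr X. 0 \<le> y w"
  obtains y' where "y' \<in> elts (dual_space X)" "nrm (dual_space X) y' \<le> 1" "\<And>w. 0 \<le> y' w"
    "nrm X y \<le> pairing X y y'"
proof -
  obtain e where e: "weak_unit (msr X) (elts X) e" using ex_weak_unit by blast
  \<comment> \<open>Three elements of the cone give all properties of \<open>m\<close>:
    \<open>v\<close> itself with \<open>t = 0\<close> gives \<open>m v \<le> nrm X v\<close>, the
    choice \<open>z = 0, t = 0\<close> gives positivity, and \<open>z = 0, t = 1\<close> gives
    \<open>m y \<ge> nrm X y\<close>.\<close>
  define C where "C = {(v, c). \<exists>z\<in>elts X. \<exists>t\<ge>0. (AE w in msr X. v w \<le> z w - t * y w) \<and>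
    nrm X z - t * nrm X y \<le> c}"
  have CI: "(v, c) \<in> C"
    if "z \<in> elts X" "t \<ge> 0" "AE w in msr X. v w \<le> z w - t * y w" "nrm X z - t * nrm X y \<le> c"
      for v z t c
    using that unfolding C_def by auto
  obtain m where lin: "linear_on_fun (elts X) m" and mle: "\<And>v c. v \<in> elts X \<Longrightarrow> (v, c) \<in> C \<Longrightarrow> m v \<le> c"
  proof (rule cone_functional[OF subspace, of C])
    show "\<exists>c. (v, c) \<in> C" if "v \<in> elts X" for v using CI[OF that, of 0 v] by auto
    show "(\<lambda>_. 0, 0) \<in> C" using CI[OF zero_mem, of 0 "\<lambda>_. 0"] norm_zero by simp
    show "0 \<le> c" if C: "(\<lambda>_. 0, c) \<in> C" for c
    proof -
      obtain z t where z: "z \<in> elts X" "t \<ge> 0" "AE w in msr X. 0 \<le> z w - t * y w"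
        "nrm X z - t * nrm X y \<le> c"
        using C unfolding C_def by auto
      \<comment> \<open>Since \<open>y\<close> is nonnegative, \<open>t y \<le> z\<close> is a
        comparison of moduli, and monotonicity of the norm shows that 0 has no negative
        price.\<close>
      have "t * nrm X y = nrm X (\<lambda>w. t * y w)" using norm_scale[OF y] z(2) by simp
      also have "\<dots> \<le> nrm X z"
      proof (rule norm_mono[OF scale_mem[OF y] z(1)])
        show "AE w in msr X. \<bar>t * y w\<bar> \<le> \<bar>z w\<bar>"
          using y0 z(3)
        proof eventually_elim
          case (elim w)
          have "0 \<le> t * y w" using elim z(2) by simp
          then show ?case using elim by simp
        qed
      qed
      finally show ?thesis using z(4) by simp
    qed
    show "(\<lambda>w. s * u w, s * a) \<in> C" if C: "(u, a) \<in> C" and s: "s > 0" for u a s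
    proof -
      obtain z t where z: "z \<in> elts X" "t \<ge> 0" "AE w in msr X. u w \<le> z w - t * y w"
        "nrm X z - t * nrm X y \<le> a"
        using C unfolding C_def by auto
      have "AE w in msr X. s * u w \<le> s * z w - (s * t) * y w"
        using z(3)
      proof eventually_elim
        case (elim w)
        then show ?case using mult_left_mono[OF elim, of s] s by (simp add: algebra_simps)
      qed
      moreover have "nrm X (\<lambda>w. s * z w) - (s * t) * nrm X y \<le> s * a"
        using norm_scale[OF z(1), of s] s mult_left_mono[OF z(4), of s] by (simp add: algebra_simps)
      ultimately show ?thesis using s z by (intro CI[OF scale_mem[OF z(1)]]) auto
    qed
    show "(\<lambda>w. u w + v w, a + b) \<in> C" if C: "(u, a) \<in> C" "(v, b) \<in> C" for u v a b
    proof -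
      obtain z t where z: "z \<in> elts X" "t \<ge> 0" "AE w in msr X. u w \<le> z w - t * y w"
        "nrm X z - t * nrm X y \<le> a"
        using C unfolding C_def by auto
      obtain z' t' where z': "z' \<in> elts X" "t' \<ge> 0" "AE w in msr X. v w \<le> z' w - t' * y w"
        "nrm X z' - t' * nrm X y \<le> b"
        using C unfolding C_def by auto
      have "AE w in msr X. u w + v w \<le> (z w + z' w) - (t + t') * y w"
        using z(3) z'(3) by eventually_elim (simp add: distrib_right)
      moreover have "nrm X (\<lambda>w. z w + z' w) - (t + t') * nrm X y \<le> a + b"
        using norm_triangle[OF z(1) z'(1)] z(4) z'(4) by (simp add: distrib_right)
      ultimately show ?thesis using z(2) z'(2) by (intro CI[OF add_mem[OF z(1) z'(1)]]) auto
    qed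
  qed blast
  note lin_scale = linear_on_funD(2)[OF lin]
  have mnorm: "m v \<le> nrm X v" if "v \<in> elts X" for v
    using CI[OF that, of 0 v] by (intro mle that) auto
  have mpos: "0 \<le> m v" if v: "v \<in> elts X" "AE w in msr X. 0 \<le> v w" for v
  proof -
    have "m (\<lambda>w. (-1) * v w) \<le> 0"
      using v(2) norm_zero
      by (intro mle scale_mem v CI[OF zero_mem, of 0]) (auto elim: eventually_mono)
    then show ?thesis using lin_scale[OF v(1), of "-1"] by simp
  qed
  have my: "nrm X y \<le> m y"
  proof -
    have "m (\<lambda>w. (-1) * y w) \<le> - nrm X y"
      using norm_zero by (intro mle scale_mem y CI[OF zero_mem, of 1]) auto
    then show ?thesis using lin_scale[OF y, of "-1"] by simp
  qed
  interpret sigma_finite_measure "msr X" by (rule sigma_finite)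
  interpret pf: positive_functional "msr X" "elts X" e m
    by unfold_locales (use ideal e lin mpos in auto)
  obtain d where d: "d \<in> borel_measurable (msr X)" "\<And>w. 0 \<le> d w" "\<And>w. e w = 0 \<Longrightarrow> d w = 0"
    and dm: "\<And>v. v \<in> elts X \<Longrightarrow> AE w in msr X. 0 \<le> v w \<Longrightarrow>
      has_bochner_integral (msr X) (\<lambda>w. v w * d w) (m v)"
  proof (rule pf.representation)
    fix v G and \<epsilon> :: real
    assume v: "v \<in> elts X"
      and G: "range G \<subseteq> sets (msr X)" "incseq G" "(\<Union>k::nat. G k) = space (msr X)"
      and \<epsilon>: "\<epsilon> > 0"
    obtain k where k: "nrm X (\<lambda>w. v w - indicator (G k) w * v w) < \<epsilon>"
      using sc v G \<epsilon> unfolding section_continuous_def exhausts_def by blast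
    have Gk: "(\<lambda>w. indicator (G k) w * v w) \<in> elts X" using G(1) by (intro indicator_mem v) auto
    have "m v = m (\<lambda>w. v w - indicator (G k) w * v w) + m (\<lambda>w. indicator (G k) w * v w)"
      using pf.m_add[OF diff_mem[OF v Gk] Gk] by simp
    then have "m v \<le> m (\<lambda>w. indicator (G k) w * v w) + \<epsilon>"
      using mnorm[OF diff_mem[OF v Gk]] k by linarith
    then show "\<exists>k. m v \<le> m (\<lambda>w. indicator (G k) w * v w) + \<epsilon>" by blast
  qed blast
  have abs: "has_bochner_integral (msr X) (\<lambda>w. \<bar>v w\<bar> * d w) (m (\<lambda>w. \<bar>v w\<bar>))" if "v \<in> elts X" for v
    by (intro dm abs_mem that) simp
  have int: "integrable (msr X) (\<lambda>w. v w * d w)" if v: "v \<in> elts X" for v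
    by (rule Bochner_Integration.integrable_bound[OF has_bochner_integral_iff[THEN iffD1, OF
      abs[OF v], THEN conjunct1]])
      (use elts_meas[OF v] d in \<open>auto simp: abs_mult\<close>)
  have bound: "(\<integral>w. \<bar>v w * d w\<bar> \<partial>msr X) \<le> 1 * nrm X v" if v: "v \<in> elts X" for v
  proof -
    have "(\<integral>w. \<bar>v w * d w\<bar> \<partial>msr X) = (\<integral>w. \<bar>v w\<bar> * d w \<partial>msr X)" using d(2) by (simp add: abs_mult)
    also have "\<dots> = m (\<lambda>w. \<bar>v w\<bar>)" using abs[OF v] by (rule has_bochner_integral_integral_eq)
    also have "\<dots> \<le> nrm X v" using mnorm[OF abs_mem[OF v]] norm_abs[OF v] by simp
    finally show ?thesis by simp
  qed
  have "d \<in> elts (dual_space X)"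
    unfolding mem_dual_iff[OF e] using d int bound by (auto intro!: exI[of _ 1])
  moreover have "pairing X y d = m y"
    unfolding pairing_def using dm[OF y y0] by (rule has_bochner_integral_integral_eq)
  ultimately show ?thesis
    using that[of d] dual_norm_le[OF bound] d(2) my by simp
qed

lemma mixed_holder:
  assumes s: "1 / s + 1 / s' = 1" and p: "1 / p + 1 / p' = 1"
    and u: "\<And>i j. i < n \<Longrightarrow> j < k \<Longrightarrow> u i j \<in> elts X"
    and y: "\<And>i j. i < n \<Longrightarrow> j < k \<Longrightarrow> y i j \<in> elts (dual_space X)"
  shows "(\<Sum>i<n. \<Sum>j<k. \<bar>pairing X (u i j) (y i j)\<bar>)
     \<le> nrm X (mixed_sum s p n k u) * nrm (dual_space X) (mixed_sum s' p' n k y)"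
proof -
  note pos = conjugate_exponent_pos[OF s] conjugate_exponent_pos[OF p]
  have mu: "mixed_sum s p n k u \<in> elts X" by (intro mixed_sum_mem pos u)
  have my: "mixed_sum s' p' n k y \<in> elts (dual_space X)"
    by (intro fun_ideal_mixed_sum[OF dual_ideal] pos y)
  have int: "integrable (msr X) (\<lambda>w. \<bar>u i j w * y i j w\<bar>)" if "i < n" "j < k" for i j
    using that by (intro integrable_abs dual_integrable u y)
  have "(\<Sum>i<n. \<Sum>j<k. \<bar>pairing X (u i j) (y i j)\<bar>) \<le> (\<Sum>i<n. \<Sum>j<k. (\<integral>w. \<bar>u i j w * y i j w\<bar> \<partial>msr X))"
    unfolding pairing_def by (intro sum_mono integral_abs_bound)
  also have "\<dots> = (\<integral>w. (\<Sum>i<n. \<Sum>j<k. \<bar>u i j w * y i j w\<bar>) \<partial>msr X)"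
    using int by (intro integral_double_sum[symmetric])
  also have "\<dots> \<le> (\<integral>w. \<bar>mixed_sum s p n k u w * mixed_sum s' p' n k y w\<bar> \<partial>msr X)"
  proof (rule integral_mono)
    show "integrable (msr X) (\<lambda>w. \<Sum>i<n. \<Sum>j<k. \<bar>u i j w * y i j w\<bar>)"
      using int by (intro Bochner_Integration.integrable_sum) auto
    show "integrable (msr X) (\<lambda>w. \<bar>mixed_sum s p n k u w * mixed_sum s' p' n k y w\<bar>)"
      by (intro integrable_abs dual_integrable mu my)
    fix w
    have "(\<Sum>i<n. \<Sum>j<k. \<bar>u i j w * y i j w\<bar>) \<le>
        (\<Sum>i<n. \<bar>lp_sum p k (\<lambda>j. u i j w)\<bar> * \<bar>lp_sum p' k (\<lambda>j. y i j w)\<bar>)"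
      using lp_sum_holder[OF p] by (intro sum_mono) (simp add: abs_mult lp_sum_nonneg)
    also have "\<dots> \<le> mixed_sum s p n k u w * mixed_sum s' p' n k y w"
      unfolding mixed_sum_def by (rule lp_sum_holder[OF s])
    finally show "(\<Sum>i<n. \<Sum>j<k. \<bar>u i j w * y i j w\<bar>) \<le>
      \<bar>mixed_sum s p n k u w * mixed_sum s' p' n k y w\<bar>"
      by linarith
  qed
  also have "\<dots> \<le> nrm X (mixed_sum s p n k u) * nrm (dual_space X) (mixed_sum s' p' n k y)"
    by (rule dual_holder[OF mu my])
  finally show ?thesis .
qed

text \<open>A norming element \<open>y'\<close> of the single function
  \<open>mixed_sum s p n k u\<close> is distributed over the matrix. At each point the weights are
  extremal for Hoelder's inequality, first over the rows and then within each row. Equality there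
  makes the pairings add up to the full one, while the dual mixed sum of the pieces stays below
  \<open>y'\<close>.\<close>

lemma mixed_norming:
  assumes sc: "section_continuous X" and s: "1 / s + 1 / s' = 1" and p: "1 / p + 1 / p' = 1"
    and u: "\<And>i j. i < n \<Longrightarrow> j < k \<Longrightarrow> u i j \<in> elts X"
  obtains y where "\<And>i j. i < n \<Longrightarrow> j < k \<Longrightarrow> y i j \<in> elts (dual_space X)"
    "nrm (dual_space X) (mixed_sum s' p' n k y) \<le> 1"
    "nrm X (mixed_sum s p n k u) \<le> (\<Sum>i<n. \<Sum>j<k. \<bar>pairing X (u i j) (y i j)\<bar>)"
proof -
  note pos = conjugate_exponent_pos[OF s] conjugate_exponent_pos[OF p]
  have mu: "mixed_sum s p n k u \<in> elts X" by (intro mixed_sum_mem pos u)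
  obtain y' where y': "y' \<in> elts (dual_space X)" "nrm (dual_space X) y' \<le> 1" "\<And>w. 0 \<le> y' w"
    and le: "nrm X (mixed_sum s p n k u) \<le> pairing X (mixed_sum s p n k u) y'"
    using norming_functional[OF sc mu] unfolding mixed_sum_def by (auto simp: lp_sum_nonneg)
  define b where "b w i = lp_dual s n (\<lambda>i. lp_sum p k (\<lambda>j. u i j w)) i" for w i
  define c where "c w i j = lp_dual p k (\<lambda>j. u i j w) j" for w i j
  \<comment> \<open>\<open>b\<close> distributes \<open>y'\<close> over the rows, \<open>c\<close>
    distributes each share within its row, and the sign makes every product with
    \<open>u i j\<close> nonnegative.\<close>
  define y where "y i j w = (y' w * b w i) * (c w i j * sgn (u i j w))" for i j w
  have b0: "0 \<le> b w i" and c0: "0 \<le> c w i j" for w i j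
    unfolding b_def c_def by (auto intro: lp_dual_nonneg)
  have inner: "lp_sum p' k (\<lambda>j. y i j w) \<le> y' w * b w i" for i w
  proof -
    have "lp_sum p' k (\<lambda>j. y i j w) = \<bar>y' w * b w i\<bar> * lp_sum p' k (\<lambda>j. c w i j * sgn (u i j w))"
      unfolding y_def using pos by (intro lp_sum_scale)
    also have "\<dots> \<le> \<bar>y' w * b w i\<bar> * 1"
    proof (rule mult_left_mono)
      have "lp_sum p' k (\<lambda>j. c w i j * sgn (u i j w)) \<le> lp_sum p' k (c w i)"
        using c0 by (intro lp_sum_mono) (auto simp: abs_mult abs_sgn_eq)
      also have "\<dots> \<le> 1" unfolding c_def by (rule lp_dual(2)[OF p])
      finally show "lp_sum p' k (\<lambda>j. c w i j * sgn (u i j w)) \<le> 1" .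
    qed simp
    finally show ?thesis using y'(3) b0 by simp
  qed
  have outer: "mixed_sum s' p' n k y w \<le> y' w" for w
  proof -
    have "mixed_sum s' p' n k y w \<le> lp_sum s' n (\<lambda>i. y' w * b w i)"
      unfolding mixed_sum_def using inner b0 y'(3) by (intro lp_sum_mono) (simp add: lp_sum_nonneg)
    also have "\<dots> = \<bar>y' w\<bar> * lp_sum s' n (b w)" using pos by (intro lp_sum_scale)
    also have "\<dots> \<le> \<bar>y' w\<bar> * 1"
      unfolding b_def by (intro mult_left_mono lp_dual(2)[OF s]) simp
    finally show ?thesis using y'(3) by simp
  qed
  have ym: "y i j \<in> borel_measurable (msr X)" if ij: "i < n" "j < k" for i j
  proof -
    have [measurable]: "y' \<in> borel_measurable (msr X)" by (rule dual_meas[OF y'(1)])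
    have um: "u i j \<in> borel_measurable (msr X)" if "i < n" "j < k" for i j
      using u that elts_meas by blast
    have [measurable]: "(\<lambda>w. b w i) \<in> borel_measurable (msr X)"
      unfolding b_def using um ij by (intro lp_dual_measurable lp_sum_measurable) auto
    have [measurable]: "(\<lambda>w. c w i j) \<in> borel_measurable (msr X)"
      unfolding c_def using um ij by (intro lp_dual_measurable) auto
    have [measurable]: "u i j \<in> borel_measurable (msr X)" by (rule um[OF ij])
    show ?thesis unfolding y_def by measurable
  qed
  have yd: "y i j \<in> elts (dual_space X)" if ij: "i < n" "j < k" for i j
  proof (rule fun_idealD(3)[OF dual_ideal y'(1)])
    show "y i j \<in> borel_measurable (msr X)" by (rule ym[OF ij])
    have "\<bar>y i j w\<bar> \<le> \<bar>y' w\<bar>" for w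
    proof -
      have "\<bar>y i j w\<bar> \<le> lp_sum p' k (\<lambda>j. y i j w)" by (rule le_lp_sum[OF pos(4) ij(2)])
      also have "\<dots> \<le> mixed_sum s' p' n k y w"
        unfolding mixed_sum_def
        using le_lp_sum[OF pos(2) ij(1), of "\<lambda>i. lp_sum p' k (\<lambda>j. y i j w)"] by linarith
      finally show ?thesis using outer[of w] by linarith
    qed
    then show "AE w in msr X. \<bar>y i j w\<bar> \<le> \<bar>y' w\<bar>" by simp
  qed
  have my: "mixed_sum s' p' n k y \<in> elts (dual_space X)"
    by (intro fun_ideal_mixed_sum[OF dual_ideal] pos yd)
  have "nrm (dual_space X) (mixed_sum s' p' n k y) \<le> 1"
  proof (rule dual_norm_le)
    fix v assume v: "v \<in> elts X"
    have "(\<integral>w. \<bar>v w * mixed_sum s' p' n k y w\<bar> \<partial>msr X) \<le> (\<integral>w. \<bar>v w * y' w\<bar> \<partial>msr X)"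
    proof (intro integral_mono integrable_abs dual_integrable my y' v)
      fix w
      have "0 \<le> mixed_sum s' p' n k y w" by (simp add: mixed_sum_def lp_sum_nonneg)
      then show "\<bar>v w * mixed_sum s' p' n k y w\<bar> \<le> \<bar>v w * y' w\<bar>"
        using outer[of w] y'(3)[of w] by (simp add: abs_mult mult_left_mono)
    qed
    also have "\<dots> \<le> nrm X v * nrm (dual_space X) y'" by (rule dual_holder[OF v y'(1)])
    also have "\<dots> \<le> nrm X v * 1" by (intro mult_left_mono y' norm_nonneg v)
    finally show "(\<integral>w. \<bar>v w * mixed_sum s' p' n k y w\<bar> \<partial>msr X) \<le> 1 * nrm X v" by simp
  qed simp
  moreover have "nrm X (mixed_sum s p n k u) \<le> (\<Sum>i<n. \<Sum>j<k. \<bar>pairing X (u i j) (y i j)\<bar>)"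
  proof -
    have "mixed_sum s p n k u w * y' w = (\<Sum>i<n. \<Sum>j<k. u i j w * y i j w)" for w
    proof -
      have "(\<Sum>j<k. u i j w * y i j w) = y' w * (\<bar>lp_sum p k (\<lambda>j. u i j w)\<bar> * b w i)" for i
      proof -
        have "u i j w * y i j w = (y' w * b w i) * (\<bar>u i j w\<bar> * c w i j)" for j
          unfolding y_def by (simp add: abs_sgn mult_ac)
        then have "(\<Sum>j<k. u i j w * y i j w) = (y' w * b w i) * (\<Sum>j<k. \<bar>u i j w\<bar> * c w i j)"
          by (simp add: sum_distrib_left)
        also have "(\<Sum>j<k. \<bar>u i j w\<bar> * c w i j) = lp_sum p k (\<lambda>j. u i j w)"
          unfolding c_def by (rule lp_dual(1)[OF p])
        finally show ?thesis by (simp add: lp_sum_nonneg)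
      qed
      then have "(\<Sum>i<n. \<Sum>j<k. u i j w * y i j w) =
        y' w * (\<Sum>i<n. \<bar>lp_sum p k (\<lambda>j. u i j w)\<bar> * b w i)"
        by (simp add: sum_distrib_left)
      also have "(\<Sum>i<n. \<bar>lp_sum p k (\<lambda>j. u i j w)\<bar> * b w i) = mixed_sum s p n k u w"
        unfolding b_def mixed_sum_def by (rule lp_dual(1)[OF s])
      finally show ?thesis by simp
    qed
    then have "pairing X (mixed_sum s p n k u) y' = (\<integral>w. (\<Sum>i<n. \<Sum>j<k. u i j w * y i j w) \<partial>msr X)"
      by (simp add: pairing_def)
    also have "\<dots> = (\<Sum>i<n. \<Sum>j<k. pairing X (u i j) (y i j))"
      unfolding pairing_def by (intro integral_double_sum dual_integrable yd u)
    also have "\<dots> \<le> (\<Sum>i<n. \<Sum>j<k. \<bar>pairing X (u i j) (y i j)\<bar>)"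
      by (intro sum_mono) simp
    finally show ?thesis using le by linarith
  qed
  ultimately show ?thesis using that[of y] yd by blast
qed

end

section \<open>Spaces of $r$-integrable functions\<close>

lemma powr_add_le:
  fixes a b r :: real
  assumes "0 \<le> a" "0 \<le> b" "0 \<le> r"
  shows "(a + b) powr r \<le> 2 powr r * (a powr r + b powr r)"
proof -
  have "(a + b) powr r \<le> (2 * max a b) powr r" using assms by (intro powr_mono2) auto
  also have "\<dots> = 2 powr r * max a b powr r" using assms by (simp add: powr_mult)
  also have "max a b powr r \<le> a powr r + b powr r" by (simp add: max_def)
  finally show ?thesis by simp
qed

lemma powr_le_imp_le:
  fixes a b r :: real
  assumes "a powr r \<le> b powr r" "0 \<le> a" "0 \<le> b" "0 < r"
  shows "a \<le> b"
proof -
  have le: "(a powr r) powr (1 / r) \<le> (b powr r) powr (1 / r)"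
    by (rule powr_mono2) (use assms in auto)
  have "(c powr r) powr (1 / r) = c" if "0 \<le> c" for c
    using that assms(4) by (simp add: powr_powr)
  then show ?thesis using assms(2,3) le by (simp only:)
qed

lemma Lr_space_simps [simp]:
  "msr (Lr_space r M) = M"
  "elts (Lr_space r M) = {h \<in> borel_measurable M. integrable M (\<lambda>w. \<bar>h w\<bar> powr r)}"
  "nrm (Lr_space r M) h = (\<integral>w. \<bar>h w\<bar> powr r \<partial>M) powr (1 / r)"
  by (simp_all add: Lr_space_def)

lemma Lr_ideal:
  assumes r: "0 < r"
  shows "fun_ideal M (elts (Lr_space r M))"
proof -
  have *: "integrable M (\<lambda>w. \<bar>u w\<bar> powr r)"
    if "integrable M F" "u \<in> borel_measurable M" "AE w in M. \<bar>u w\<bar> powr r \<le> F w" for u F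
    by (rule Bochner_Integration.integrable_bound[OF that(1)]) (use that in \<open>auto elim!:
      eventually_mono\<close>)
  have int_add: "integrable M (\<lambda>w. \<bar>u w + v w\<bar> powr r)"
    if "u \<in> elts (Lr_space r M)" "v \<in> elts (Lr_space r M)" for u v
  proof (rule *)
    show "integrable M (\<lambda>w. 2 powr r * (\<bar>u w\<bar> powr r + \<bar>v w\<bar> powr r))" using that by simp
    have "\<bar>u w + v w\<bar> powr r \<le> 2 powr r * (\<bar>u w\<bar> powr r + \<bar>v w\<bar> powr r)" for w
    proof -
      have "\<bar>u w + v w\<bar> powr r \<le> (\<bar>u w\<bar> + \<bar>v w\<bar>) powr r" using r by (intro powr_mono2) auto
      also have "\<dots> \<le> 2 powr r * (\<bar>u w\<bar> powr r + \<bar>v w\<bar> powr r)" using r by (intro powr_add_le) auto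
      finally show ?thesis .
    qed
    then show "AE w in M. \<bar>u w + v w\<bar> powr r \<le> 2 powr r * (\<bar>u w\<bar> powr r + \<bar>v w\<bar> powr r)" by simp
  qed (use that in auto)
  have int_scale: "integrable M (\<lambda>w. \<bar>a * u w\<bar> powr r)" if "u \<in> elts (Lr_space r M)" for u a
    using that by (simp add: abs_mult powr_mult)
  have solid: "u \<in> elts (Lr_space r M)"
    if "v \<in> elts (Lr_space r M)" "u \<in> borel_measurable M" "AE w in M. \<bar>u w\<bar> \<le> \<bar>v w\<bar>" for u v
  proof -
    have "AE w in M. \<bar>u w\<bar> powr r \<le> \<bar>v w\<bar> powr r"
      using that(3) r by (auto elim!: eventually_mono intro: powr_mono2)
    then show ?thesis using *[of "\<lambda>w. \<bar>v w\<bar> powr r" u] that by simp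
  qed
  have "fun_subspace (elts (Lr_space r M))"
    unfolding fun_subspace_def
  proof (intro conjI ballI allI)
    fix u v assume uv: "u \<in> elts (Lr_space r M)" "v \<in> elts (Lr_space r M)"
    then show "(\<lambda>w. u w + v w) \<in> elts (Lr_space r M)" using int_add[OF uv] by auto
    fix a show "(\<lambda>w. a * u w) \<in> elts (Lr_space r M)" using uv int_scale[OF uv(1), of a] by auto
  qed simp
  moreover have "elts (Lr_space r M) \<subseteq> borel_measurable M" by auto
  ultimately show ?thesis unfolding fun_ideal_def using solid by blast
qed

lemma mixed_sum_powr:
  assumes "0 < r"
  shows "mixed_sum (ennreal r) q n k x w powr r = (\<Sum>i<n. lp_sum q k (\<lambda>j. x i j w) powr r)"
  unfolding mixed_sum_def by (simp add: lp_sum_powr[OF assms] lp_sum_nonneg)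

lemma mixed_sum_nonneg: "0 \<le> mixed_sum s q n k x w"
  unfolding mixed_sum_def by (rule lp_sum_nonneg)

lemma mixed_sum_mult:
  assumes "0 < s" "0 < q"
  shows "mixed_sum s q n k (\<lambda>i j w. c w * x i j w) w = \<bar>c w\<bar> * mixed_sum s q n k x w"
  unfolding mixed_sum_def using assms by (simp add: lp_sum_scale)

lemma mixed_sum_cong:
  assumes "\<And>i j. i < n \<Longrightarrow> j < k \<Longrightarrow> \<bar>x i j w\<bar> = \<bar>y i j w\<bar>"
  shows "mixed_sum s q n k x w = mixed_sum s q n k y w"
proof -
  have "lp_sum q k (\<lambda>j. x i j w) = lp_sum q k (\<lambda>j. y i j w)" if "i < n" for i
    using assms[OF that] by (rule lp_sum_cong)
  then show ?thesis unfolding mixed_sum_def by (intro lp_sum_cong) simp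
qed

lemma Lr_norm_powr:
  assumes "0 < r"
  shows "nrm (Lr_space r M) h powr r = (\<integral>w. \<bar>h w\<bar> powr r \<partial>M)"
  using assms by (simp add: powr_powr)

text \<open>The outer exponent is that of the space, so the \<open>r\<close>-th power of the norm
  decouples into the rows. This is how a condition on single rows becomes one on matrices.\<close>

lemma Lr_norm_mixed_powr:
  assumes r: "0 < r" and q: "0 < q"
    and x: "\<And>i j. i < n \<Longrightarrow> j < k \<Longrightarrow> x i j \<in> elts (Lr_space r M)"
  shows "nrm (Lr_space r M) (mixed_sum (ennreal r) q n k x) powr r =
    (\<Sum>i<n. nrm (Lr_space r M) (\<lambda>w. lp_sum q k (\<lambda>j. x i j w)) powr r)"
proof -
  have row: "(\<lambda>w. lp_sum q k (\<lambda>j. x i j w)) \<in> elts (Lr_space r M)" if "i < n" for i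
    using that x by (intro fun_ideal_lp_sum[OF Lr_ideal[OF r]] q) auto
  have "(\<integral>w. \<bar>mixed_sum (ennreal r) q n k x w\<bar> powr r \<partial>M) =
      (\<integral>w. (\<Sum>i<n. \<bar>lp_sum q k (\<lambda>j. x i j w)\<bar> powr r) \<partial>M)"
    by (simp add: mixed_sum_powr[OF r] mixed_sum_nonneg lp_sum_nonneg)
  also have "\<dots> = (\<Sum>i<n. (\<integral>w. \<bar>lp_sum q k (\<lambda>j. x i j w)\<bar> powr r \<partial>M))"
    using row by (intro Bochner_Integration.integral_sum) auto
  finally show ?thesis unfolding Lr_norm_powr[OF r] .
qed

text \<open>Multiplication by a fixed function can be pulled out of mixed sums pointwise, so the
  outer factors act on one function each and only the regular factor has to be treated row by
  row.\<close>

lemma factorization_imp_mixed_bound: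
  assumes X: "banach_function_space X" and Y: "banach_function_space Y"
    and r: "1 \<le> r" and p: "0 < p" and q: "0 < q"
    and T: "bounded_operator X Y T"
    and Mf: "bounded_operator X (Lr_space r (msr X)) (mult_op f)"
    and Mg: "bounded_operator (Lr_space r (msr Y)) Y (mult_op g)"
    and S: "pq_regular p q (Lr_space r (msr X)) (Lr_space r (msr Y)) S"
    and fac: "\<And>x. x \<in> elts X \<Longrightarrow> AE w in msr Y. T x w = mult_op g (S (mult_op f x)) w"
  shows "\<exists>K>0. \<forall>n m. \<forall>x :: nat \<Rightarrow> nat \<Rightarrow> 'a \<Rightarrow> real. (\<forall>i<n. \<forall>j<m. x i j \<in> elts X) \<longrightarrow>
         nrm Y (mixed_sum (ennreal r) p n m (\<lambda>i j. T (x i j)))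
           \<le> K * nrm X (mixed_sum (ennreal r) q n m x)"
proof -
  interpret X: banach_function_space X by (rule X)
  interpret Y: banach_function_space Y by (rule Y)
  let ?LX = "Lr_space r (msr X)" and ?LY = "Lr_space r (msr Y)"
  have r0: "0 < r" and er: "0 < ennreal r" using r by auto
  obtain C1 where C1: "\<And>x. x \<in> elts X \<Longrightarrow> nrm ?LX (mult_op f x) \<le> C1 * nrm X x"
    and fX: "\<And>x. x \<in> elts X \<Longrightarrow> mult_op f x \<in> elts ?LX"
    using Mf unfolding bounded_operator_def linear_map_def by blast
  obtain C2 where C2: "\<And>h. h \<in> elts ?LY \<Longrightarrow> nrm Y (mult_op g h) \<le> C2 * nrm ?LY h"
    and gL: "\<And>h. h \<in> elts ?LY \<Longrightarrow> mult_op g h \<in> elts Y"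
    using Mg unfolding bounded_operator_def linear_map_def by blast
  obtain K where K: "K > 0" "\<And>n x. (\<forall>i<n. x i \<in> elts ?LX) \<Longrightarrow>
        nrm ?LY (\<lambda>w. lp_sum p n (\<lambda>i. S (x i) w)) \<le> K * nrm ?LX (\<lambda>w. lp_sum q n (\<lambda>i. x i w))"
    and SL: "\<And>h. h \<in> elts ?LX \<Longrightarrow> S h \<in> elts ?LY"
    using S unfolding pq_regular_def linear_map_def by blast
  have TX: "T x \<in> elts Y" if "x \<in> elts X" for x
    using T that unfolding bounded_operator_def linear_map_def by blast
  \<comment> \<open>The bounds \<open>C1\<close> and \<open>C2\<close> carry no sign;
    \<open>\<bar>C\<bar> + 1\<close> makes the product positive, as the conclusion demands.\<close>
  define KK where "KK = (\<bar>C2\<bar> + 1) * (K * (\<bar>C1\<bar> + 1))"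
  have "nrm Y (mixed_sum (ennreal r) p n k (\<lambda>i j. T (x i j))) \<le>
    KK * nrm X (mixed_sum (ennreal r) q n k x)"
    if x: "\<forall>i<n. \<forall>j<k. x i j \<in> elts X" for n k and x :: "nat \<Rightarrow> nat \<Rightarrow> 'a \<Rightarrow> real"
  proof -
    define u where "u i j = S (mult_op f (x i j))" for i j
    define v where "v i j = mult_op f (x i j)" for i j
    have v: "v i j \<in> elts ?LX" if "i < n" "j < k" for i j using x that fX by (auto simp: v_def)
    have u: "u i j \<in> elts ?LY" if "i < n" "j < k" for i j
      unfolding u_def using SL v[OF that] unfolding v_def by blast
    have mu: "mixed_sum (ennreal r) p n k u \<in> elts ?LY"
      using u by (intro fun_ideal_mixed_sum[OF Lr_ideal] er p r0) auto
    have mx: "mixed_sum (ennreal r) q n k x \<in> elts X"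
      using x by (intro X.mixed_sum_mem er q) auto
    have mT: "mixed_sum (ennreal r) p n k (\<lambda>i j. T (x i j)) \<in> elts Y"
      using x TX by (intro Y.mixed_sum_mem er p) auto
    have "AE w in msr Y. \<forall>z\<in>{..<n} \<times> {..<k}. T (x (fst z) (snd z)) w =
      mult_op g (u (fst z) (snd z)) w"
      unfolding u_def using x by (intro AE_finite_allI fac) auto
    then have eq: "AE w in msr Y. \<bar>mixed_sum (ennreal r) p n k (\<lambda>i j. T (x i j)) w\<bar> =
        \<bar>mult_op g (mixed_sum (ennreal r) p n k u) w\<bar>"
    proof eventually_elim
      case (elim w)
      have "mixed_sum (ennreal r) p n k (\<lambda>i j. T (x i j)) w =
        mixed_sum (ennreal r) p n k (\<lambda>i j w. g w * u i j w) w"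
        using elim by (intro mixed_sum_cong) (auto simp: mult_op_def)
      then show ?case
        using mixed_sum_nonneg[of "ennreal r" p n k u w]
          by (simp add: mixed_sum_mult[OF er p] mult_op_def abs_mult)
    qed
    have reg: "nrm ?LY (mixed_sum (ennreal r) p n k u) \<le>
      K * nrm ?LX (mixed_sum (ennreal r) q n k v)"
    proof -
      have "nrm ?LY (mixed_sum (ennreal r) p n k u) powr r =
          (\<Sum>i<n. nrm ?LY (\<lambda>w. lp_sum p k (\<lambda>j. u i j w)) powr r)"
        using u by (intro Lr_norm_mixed_powr r0 p)
      also have "\<dots> \<le> (\<Sum>i<n. (K * nrm ?LX (\<lambda>w. lp_sum q k (\<lambda>j. v i j w))) powr r)"
      proof (intro sum_mono powr_mono2)
        fix i assume i: "i \<in> {..<n}"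
        have "\<forall>j<k. v i j \<in> elts ?LX" using v i by auto
        from K(2)[OF this]
        show "nrm ?LY (\<lambda>w. lp_sum p k (\<lambda>j. u i j w)) \<le> K * nrm ?LX (\<lambda>w. lp_sum q k (\<lambda>j. v i j w))"
          unfolding u_def v_def .
      qed (use r0 in auto)
      also have "\<dots> = K powr r * (\<Sum>i<n. nrm ?LX (\<lambda>w. lp_sum q k (\<lambda>j. v i j w)) powr r)"
        using K(1) by (simp add: powr_mult sum_distrib_left)
      also have "\<dots> = K powr r * nrm ?LX (mixed_sum (ennreal r) q n k v) powr r"
        using v by (subst Lr_norm_mixed_powr[OF r0 q]) auto
      also have "\<dots> = (K * nrm ?LX (mixed_sum (ennreal r) q n k v)) powr r"
        using K(1) by (simp add: powr_mult)
      finally show ?thesis by (rule powr_le_imp_le) (use r0 K(1) in auto)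
    qed
    have vx: "nrm ?LX (mixed_sum (ennreal r) q n k v) =
      nrm ?LX (mult_op f (mixed_sum (ennreal r) q n k x))"
    proof -
      have "mixed_sum (ennreal r) q n k v w = \<bar>mult_op f (mixed_sum (ennreal r) q n k x) w\<bar>" for w
        using mixed_sum_mult[OF er q, of n k f x w] mixed_sum_nonneg[of "ennreal r" q n k x w]
        unfolding v_def mult_op_def by (simp add: abs_mult)
      then show ?thesis by simp
    qed
    have "nrm Y (mixed_sum (ennreal r) p n k (\<lambda>i j. T (x i j))) =
      nrm Y (mult_op g (mixed_sum (ennreal r) p n k u))"
      by (rule Y.norm_cong[OF mT gL[OF mu] eq])
    also have "\<dots> \<le> C2 * nrm ?LY (mixed_sum (ennreal r) p n k u)" by (rule C2[OF mu])
    also have "\<dots> \<le> (\<bar>C2\<bar> + 1) * (K * nrm ?LX (mixed_sum (ennreal r) q n k v))"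
      using reg by (intro mult_mono) auto
    also have "\<dots> \<le> (\<bar>C2\<bar> + 1) * (K * ((\<bar>C1\<bar> + 1) * nrm X (mixed_sum (ennreal r) q n k x)))"
    proof -
      have "nrm ?LX (mixed_sum (ennreal r) q n k v) \<le> C1 * nrm X (mixed_sum (ennreal r) q n k x)"
        unfolding vx by (rule C1[OF mx])
      also have "\<dots> \<le> (\<bar>C1\<bar> + 1) * nrm X (mixed_sum (ennreal r) q n k x)"
        using X.norm_nonneg[OF mx] by (intro mult_right_mono) auto
      finally show ?thesis using K(1) by (intro mult_left_mono) auto
    qed
    finally show ?thesis using K(1) by (simp add: KK_def mult_ac)
  qed
  moreover have "KK > 0" using K(1) unfolding KK_def by (intro mult_pos_pos) auto
  ultimately show ?thesis by blast
qed

section \<open>Convexity and concavity\<close>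

text \<open>The case of two entries, the \<open>r\<close>-th roots of \<open>a\<close> and
  \<open>b\<close>, of the comparison of \<open>r\<close>-sums with sums.\<close>

lemma root_add_le:
  fixes a b r :: real
  assumes "0 \<le> a" "0 \<le> b" "1 \<le> r"
  shows "(a + b) powr (1 / r) \<le> a powr (1 / r) + b powr (1 / r)"
proof -
  let ?a = "\<lambda>i::nat. if i = 0 then a powr (1 / r) else b powr (1 / r)"
  have "lp_sum (ennreal r) 2 ?a = (a + b) powr (1 / r)"
    using assms by (simp add: lp_sum_ennreal powr_powr numeral_2_eq_2)
  then show ?thesis using lp_sum_le_l1[OF assms(3), of 2 ?a] by (simp add: numeral_2_eq_2)
qed

lemma sum_append:
  fixes F :: "'c \<Rightarrow> real" and N N' :: nat
  shows "(\<Sum>k<N + N'. F (if k < N then a k else b (k - N))) = (\<Sum>k<N. F (a k)) + (\<Sum>k<N'. F (b k))"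
  by (induction N') auto

lemma powr_inverse_cancel: "0 < r \<Longrightarrow> 0 \<le> (a::real) \<Longrightarrow> (a powr (1 / r)) powr r = a"
  and powr_cancel_inverse: "0 < r \<Longrightarrow> 0 \<le> (a::real) \<Longrightarrow> (a powr r) powr (1 / r) = a"
  by (simp_all add: powr_powr)

section \<open>Prices of coverings and packings by \<open>r\<close>-th powers\<close>

context banach_function_space
begin

text \<open>An upper price of \<open>u\<close>. Families are allowed, instead of a single power,
  because they can be concatenated: prices then add, and the triples built from them form a convex
  cone.\<close>

definition convex_cover :: "real \<Rightarrow> ('a \<Rightarrow> real) \<Rightarrow> real \<Rightarrow> bool" where
  "convex_cover r u s \<longleftrightarrow> (\<exists>(N::nat) a. (\<forall>k<N. a k \<in> elts X) \<and>
     (AE w in msr X. u w \<le> (\<Sum>k<N. \<bar>a k w\<bar> powr r)) \<and> (\<Sum>k<N. nrm X (a k) powr r) \<le> s)"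

text \<open>The mirror image of \<open>convex_cover\<close>: the family sits below \<open>v\<close>,
  and \<open>s\<close> bounds its total from below.\<close>

definition concave_pack :: "real \<Rightarrow> ('a \<Rightarrow> real) \<Rightarrow> real \<Rightarrow> bool" where
  "concave_pack r v s \<longleftrightarrow> (\<exists>(N::nat) b. (\<forall>k<N. b k \<in> elts X) \<and>
     (AE w in msr X. (\<Sum>k<N. \<bar>b k w\<bar> powr r) \<le> v w) \<and> s \<le> (\<Sum>k<N. nrm X (b k) powr r))"

lemma append_family:
  fixes a a' :: "nat \<Rightarrow> 'a \<Rightarrow> real" and N N' :: nat
  assumes "\<forall>k<N. a k \<in> elts X" "\<forall>k<N'. a' k \<in> elts X"
  obtains c where "\<forall>k<N + N'. c k \<in> elts X"
    "\<And>w. (\<Sum>k<N + N'. \<bar>c k w\<bar> powr r) = (\<Sum>k<N. \<bar>a k w\<bar> powr r) + (\<Sum>k<N'. \<bar>a' k w\<bar> powr r)"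
    "(\<Sum>k<N + N'. nrm X (c k) powr r) = (\<Sum>k<N. nrm X (a k) powr r) + (\<Sum>k<N'. nrm X (a' k) powr r)"
proof -
  define c where "c k = (if k < N then a k else a' (k - N))" for k
  have "\<forall>k<N + N'. c k \<in> elts X" using assms by (auto simp: c_def)
  moreover have "(\<Sum>k<N + N'. \<bar>c k w\<bar> powr r) = (\<Sum>k<N. \<bar>a k w\<bar> powr r) + (\<Sum>k<N'. \<bar>a' k w\<bar> powr r)"
    for w
    unfolding c_def by (rule sum_append[where F = "\<lambda>x. \<bar>x w\<bar> powr r"])
  moreover have "(\<Sum>k<N + N'. nrm X (c k) powr r) =
    (\<Sum>k<N. nrm X (a k) powr r) + (\<Sum>k<N'. nrm X (a' k) powr r)"
    unfolding c_def by (rule sum_append[where F = "\<lambda>x. nrm X x powr r"])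
  ultimately show ?thesis by (rule that)
qed

lemma scale_family:
  fixes a :: "nat \<Rightarrow> 'a \<Rightarrow> real" and N :: nat
  assumes "\<forall>k<N. a k \<in> elts X" "0 < t" "0 < r"
  obtains c where "\<forall>k<N. c k \<in> elts X"
    "\<And>w. (\<Sum>k<N. \<bar>c k w\<bar> powr r) = t * (\<Sum>k<N. \<bar>a k w\<bar> powr r)"
    "(\<Sum>k<N. nrm X (c k) powr r) = t * (\<Sum>k<N. nrm X (a k) powr r)"
proof -
  define c where "c k = (\<lambda>w. t powr (1 / r) * a k w)" for k
  have "\<bar>c k w\<bar> powr r = t * \<bar>a k w\<bar> powr r" for k w
    using assms(2,3) by (simp add: c_def abs_mult powr_mult powr_powr)
  moreover have "nrm X (c k) powr r = t * nrm X (a k) powr r" if "k < N" for k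
    using norm_scale[of "a k" "t powr (1 / r)"] assms that norm_nonneg
    by (simp add: c_def powr_mult powr_powr)
  moreover have "\<forall>k<N. c k \<in> elts X" using assms(1) by (auto simp: c_def scale_mem)
  ultimately show ?thesis by (intro that[of c]) (simp_all add: sum_distrib_left)
qed

lemma convex_cover_add:
  assumes "convex_cover r u s" "convex_cover r u' s'"
  shows "convex_cover r (\<lambda>w. u w + u' w) (s + s')"
proof -
  obtain N :: nat and a where a: "\<forall>k<N. a k \<in> elts X" "AE w in msr X. u w \<le> (\<Sum>k<N. \<bar>a k w\<bar> powr r)"
    "(\<Sum>k<N. nrm X (a k) powr r) \<le> s" using assms(1) unfolding convex_cover_def by blast
  obtain N' :: nat and a'
    where a': "\<forall>k<N'. a' k \<in> elts X" "AE w in msr X. u' w \<le> (\<Sum>k<N'. \<bar>a' k w\<bar> powr r)"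
    "(\<Sum>k<N'. nrm X (a' k) powr r) \<le> s'" using assms(2) unfolding convex_cover_def by blast
  obtain c where c: "\<forall>k<N + N'. c k \<in> elts X"
    "\<And>w. (\<Sum>k<N + N'. \<bar>c k w\<bar> powr r) = (\<Sum>k<N. \<bar>a k w\<bar> powr r) + (\<Sum>k<N'. \<bar>a' k w\<bar> powr r)"
    "(\<Sum>k<N + N'. nrm X (c k) powr r) = (\<Sum>k<N. nrm X (a k) powr r) + (\<Sum>k<N'. nrm X (a' k) powr r)"
    using append_family[OF a(1) a'(1)] by blast
  have "AE w in msr X. u w + u' w \<le> (\<Sum>k<N + N'. \<bar>c k w\<bar> powr r)"
    unfolding c(2) using a(2) a'(2) by eventually_elim simp
  then show ?thesis unfolding convex_cover_def
    using c(1,3) a(3) a'(3) by (intro exI[of _ "N + N'"] exI[of _ c]) auto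
qed

lemma concave_pack_add:
  assumes "concave_pack r u s" "concave_pack r u' s'"
  shows "concave_pack r (\<lambda>w. u w + u' w) (s + s')"
proof -
  obtain N :: nat and a where a: "\<forall>k<N. a k \<in> elts X" "AE w in msr X. (\<Sum>k<N. \<bar>a k w\<bar> powr r) \<le> u w"
    "s \<le> (\<Sum>k<N. nrm X (a k) powr r)" using assms(1) unfolding concave_pack_def by blast
  obtain N' :: nat and a'
    where a': "\<forall>k<N'. a' k \<in> elts X" "AE w in msr X. (\<Sum>k<N'. \<bar>a' k w\<bar> powr r) \<le> u' w"
    "s' \<le> (\<Sum>k<N'. nrm X (a' k) powr r)" using assms(2) unfolding concave_pack_def by blast
  obtain c where c: "\<forall>k<N + N'. c k \<in> elts X"
    "\<And>w. (\<Sum>k<N + N'. \<bar>c k w\<bar> powr r) = (\<Sum>k<N. \<bar>a k w\<bar> powr r) + (\<Sum>k<N'. \<bar>a' k w\<bar> powr r)"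
    "(\<Sum>k<N + N'. nrm X (c k) powr r) = (\<Sum>k<N. nrm X (a k) powr r) + (\<Sum>k<N'. nrm X (a' k) powr r)"
    using append_family[OF a(1) a'(1)] by blast
  have "AE w in msr X. (\<Sum>k<N + N'. \<bar>c k w\<bar> powr r) \<le> u w + u' w"
    unfolding c(2) using a(2) a'(2) by eventually_elim simp
  then show ?thesis unfolding concave_pack_def
    using c(1,3) a(3) a'(3) by (intro exI[of _ "N + N'"] exI[of _ c]) auto
qed

lemma convex_cover_scale:
  assumes "convex_cover r u s" "0 < t" "0 < r"
  shows "convex_cover r (\<lambda>w. t * u w) (t * s)"
proof -
  obtain N :: nat and a where a: "\<forall>k<N. a k \<in> elts X" "AE w in msr X. u w \<le> (\<Sum>k<N. \<bar>a k w\<bar> powr r)"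
    "(\<Sum>k<N. nrm X (a k) powr r) \<le> s" using assms(1) unfolding convex_cover_def by blast
  obtain c where c: "\<forall>k<N. c k \<in> elts X"
    "\<And>w. (\<Sum>k<N. \<bar>c k w\<bar> powr r) = t * (\<Sum>k<N. \<bar>a k w\<bar> powr r)"
    "(\<Sum>k<N. nrm X (c k) powr r) = t * (\<Sum>k<N. nrm X (a k) powr r)"
    using scale_family[OF a(1) assms(2,3)] by blast
  have "AE w in msr X. t * u w \<le> (\<Sum>k<N. \<bar>c k w\<bar> powr r)"
    unfolding c(2) using a(2) assms(2) by (auto elim!: eventually_mono)
  then show ?thesis unfolding convex_cover_def
    using c(1,3) a(3) assms(2) by (intro exI[of _ N] exI[of _ c]) auto
qed

lemma concave_pack_scale:
  assumes "concave_pack r u s" "0 < t" "0 < r"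
  shows "concave_pack r (\<lambda>w. t * u w) (t * s)"
proof -
  obtain N :: nat and a where a: "\<forall>k<N. a k \<in> elts X" "AE w in msr X. (\<Sum>k<N. \<bar>a k w\<bar> powr r) \<le> u w"
    "s \<le> (\<Sum>k<N. nrm X (a k) powr r)" using assms(1) unfolding concave_pack_def by blast
  obtain c where c: "\<forall>k<N. c k \<in> elts X"
    "\<And>w. (\<Sum>k<N. \<bar>c k w\<bar> powr r) = t * (\<Sum>k<N. \<bar>a k w\<bar> powr r)"
    "(\<Sum>k<N. nrm X (c k) powr r) = t * (\<Sum>k<N. nrm X (a k) powr r)"
    using scale_family[OF a(1) assms(2,3)] by blast
  have "AE w in msr X. (\<Sum>k<N. \<bar>c k w\<bar> powr r) \<le> t * u w"
    unfolding c(2) using a(2) assms(2) by (auto elim!: eventually_mono)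
  then show ?thesis unfolding concave_pack_def
    using c(1,3) a(3) assms(2) by (intro exI[of _ N] exI[of _ c]) auto
qed

lemma convex_cover_single:
  "a \<in> elts X \<Longrightarrow> AE w in msr X. u w \<le> \<bar>a w\<bar> powr r \<Longrightarrow> nrm X a powr r \<le> s \<Longrightarrow> convex_cover r u s"
  unfolding convex_cover_def by (intro exI[of _ 1] exI[of _ "\<lambda>_. a"]) simp

lemma concave_pack_single:
  "a \<in> elts X \<Longrightarrow> AE w in msr X. \<bar>a w\<bar> powr r \<le> u w \<Longrightarrow> s \<le> nrm X a powr r \<Longrightarrow> concave_pack r u s"
  unfolding concave_pack_def by (intro exI[of _ 1] exI[of _ "\<lambda>_. a"]) simp

lemma convex_cover_zero: "convex_cover r (\<lambda>_. 0) 0"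
  unfolding convex_cover_def by (intro exI[of _ 0]) simp

lemma concave_pack_zero: "concave_pack r (\<lambda>_. 0) 0"
  unfolding concave_pack_def by (intro exI[of _ 0]) simp

text \<open>The lattice \<open>r\<close>-sum of a covering family is one function that covers as
  well, and convexity bounds its norm. The \<open>M\<close> of the definition carries no sign, hence
  the constant \<open>\<bar>M\<bar> powr r\<close>.\<close>

lemma r_convex_bound:
  assumes "r_convex r X" "1 \<le> r"
  obtains M where "0 \<le> M" "\<And>u s. convex_cover r u s \<Longrightarrow>
     \<exists>z\<in>elts X. (\<forall>w. 0 \<le> z w) \<and> (AE w in msr X. u w \<le> z w powr r) \<and> nrm X z powr r \<le> M * s"
proof -
  have r: "0 < r" "0 < ennreal r" using assms(2) by auto
  obtain M where M: "\<And>n x. (\<forall>i<n. x i \<in> elts X) \<Longrightarrow>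
        nrm X (\<lambda>w. lp_sum (ennreal r) n (\<lambda>i. x i w)) \<le> M * (\<Sum>i<n. nrm X (x i) powr r) powr (1 / r)"
    using assms unfolding r_convex_def by (auto simp: lp_sum_ennreal)
  have "\<exists>z\<in>elts X. (\<forall>w. 0 \<le> z w) \<and> (AE w in msr X. u w \<le> z w powr r) \<and>
    nrm X z powr r \<le> \<bar>M\<bar> powr r * s"
    if cc: "convex_cover r u s" for u s
  proof -
    obtain N :: nat and a
      where a: "\<forall>k<N. a k \<in> elts X" "AE w in msr X. u w \<le> (\<Sum>k<N. \<bar>a k w\<bar> powr r)"
      "(\<Sum>k<N. nrm X (a k) powr r) \<le> s" using cc unfolding convex_cover_def by blast
    let ?z = "\<lambda>w. lp_sum (ennreal r) N (\<lambda>k. a k w)"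
    have z: "?z \<in> elts X" using a(1) r by (intro lp_sum_mem) auto
    have "nrm X ?z \<le> \<bar>M\<bar> * (\<Sum>k<N. nrm X (a k) powr r) powr (1 / r)"
      by (rule order_trans[OF M[OF a(1)]]) (intro mult_right_mono, auto)
    then have "nrm X ?z powr r \<le> (\<bar>M\<bar> * (\<Sum>k<N. nrm X (a k) powr r) powr (1 / r)) powr r"
      using r norm_nonneg[OF z] by (intro powr_mono2) auto
    also have "\<dots> = \<bar>M\<bar> powr r * (\<Sum>k<N. nrm X (a k) powr r)"
      using r by (simp add: powr_mult powr_inverse_cancel sum_nonneg)
    also have "\<dots> \<le> \<bar>M\<bar> powr r * s" using a(3) by (intro mult_left_mono) auto
    finally show ?thesis
      using z a(2) lp_sum_powr[OF r(1)] by (intro bexI[of _ ?z]) (auto simp: lp_sum_nonneg)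
  qed
  then show ?thesis using that[of "\<bar>M\<bar> powr r"] by auto
qed

lemma r_concave_bound:
  assumes "r_concave r X" "1 \<le> r"
  obtains M where "0 \<le> M" "\<And>u s. concave_pack r u s \<Longrightarrow>
     \<exists>z\<in>elts X. (\<forall>w. 0 \<le> z w) \<and> (AE w in msr X. z w powr r \<le> u w) \<and> s \<le> M * nrm X z powr r"
proof -
  have r: "0 < r" "0 < ennreal r" using assms(2) by auto
  obtain M where M: "\<And>n x. (\<forall>i<n. x i \<in> elts X) \<Longrightarrow>
        (\<Sum>i<n. nrm X (x i) powr r) powr (1 / r) \<le> M * nrm X (\<lambda>w. lp_sum (ennreal r) n (\<lambda>i. x i w))"
    using assms unfolding r_concave_def by (auto simp: lp_sum_ennreal)
  have "\<exists>z\<in>elts X. (\<forall>w. 0 \<le> z w) \<and> (AE w in msr X. z w powr r \<le> u w) \<and>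
    s \<le> \<bar>M\<bar> powr r * nrm X z powr r"
    if cc: "concave_pack r u s" for u s
  proof -
    obtain N :: nat and a
      where a: "\<forall>k<N. a k \<in> elts X" "AE w in msr X. (\<Sum>k<N. \<bar>a k w\<bar> powr r) \<le> u w"
      "s \<le> (\<Sum>k<N. nrm X (a k) powr r)" using cc unfolding concave_pack_def by blast
    let ?z = "\<lambda>w. lp_sum (ennreal r) N (\<lambda>k. a k w)"
    have z: "?z \<in> elts X" using a(1) r by (intro lp_sum_mem) auto
    have "(\<Sum>k<N. nrm X (a k) powr r) powr (1 / r) \<le> \<bar>M\<bar> * nrm X ?z"
      using norm_nonneg[OF z] by (intro order_trans[OF M[OF a(1)]] mult_right_mono) auto
    then have "((\<Sum>k<N. nrm X (a k) powr r) powr (1 / r)) powr r \<le> (\<bar>M\<bar> * nrm X ?z) powr r"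
      using r by (intro powr_mono2) auto
    then have "(\<Sum>k<N. nrm X (a k) powr r) \<le> \<bar>M\<bar> powr r * nrm X ?z powr r"
      using r norm_nonneg[OF z] by (simp add: powr_mult powr_inverse_cancel sum_nonneg)
    then have "s \<le> \<bar>M\<bar> powr r * nrm X ?z powr r" using a(3) by simp
    then show ?thesis
      using z a(2) lp_sum_powr[OF r(1)] by (intro bexI[of _ ?z]) (auto simp: lp_sum_nonneg)
  qed
  then show ?thesis using that[of "\<bar>M\<bar> powr r"] by auto
qed

text \<open>The \<open>r\<close>-concavification of \<open>X\<close>, home of the
  \<open>r\<close>-th powers. It is a vector space because the \<open>r\<close>-th root is
  subadditive for \<open>1 \<le> r\<close>.\<close>

definition power_ideal :: "real \<Rightarrow> ('a \<Rightarrow> real) set" where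
  "power_ideal r = {u \<in> borel_measurable (msr X). (\<lambda>w. \<bar>u w\<bar> powr (1 / r)) \<in> elts X}"

lemma power_ideal:
  assumes r: "1 \<le> r"
  shows "fun_ideal (msr X) (power_ideal r)"
proof -
  have solid: "u \<in> power_ideal r"
    if v: "v \<in> elts X"
      and u: "u \<in> borel_measurable (msr X)" "AE w in msr X. \<bar>u w\<bar> powr (1 / r) \<le> \<bar>v w\<bar>" for u v
    unfolding power_ideal_def using u by (auto intro!: ideal_mem[OF v])
  have root: "(\<lambda>w. \<bar>u w\<bar> powr (1 / r)) \<in> elts X" "u \<in> borel_measurable (msr X)"
    if "u \<in> power_ideal r" for u
    using that unfolding power_ideal_def by auto
  have "fun_subspace (power_ideal r)"
    unfolding fun_subspace_def
  proof (intro conjI ballI allI)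
    show "(\<lambda>_. 0) \<in> power_ideal r" by (rule solid[OF zero_mem]) auto
    fix u v assume u: "u \<in> power_ideal r" and v: "v \<in> power_ideal r"
    show "(\<lambda>w. u w + v w) \<in> power_ideal r"
    proof (rule solid[OF add_mem[OF root(1)[OF u] root(1)[OF v]]])
      have "\<bar>u w + v w\<bar> powr (1 / r) \<le> \<bar>\<bar>u w\<bar> powr (1 / r) + \<bar>v w\<bar> powr (1 / r)\<bar>" for w
      proof -
        have "\<bar>u w + v w\<bar> powr (1 / r) \<le> (\<bar>u w\<bar> + \<bar>v w\<bar>) powr (1 / r)"
          using r by (intro powr_mono2) auto
        also have "\<dots> \<le> \<bar>u w\<bar> powr (1 / r) + \<bar>v w\<bar> powr (1 / r)" using r by (intro root_add_le) auto
        finally show ?thesis by simp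
      qed
      then show "AE w in msr X. \<bar>u w + v w\<bar> powr (1 / r) \<le>
        \<bar>\<bar>u w\<bar> powr (1 / r) + \<bar>v w\<bar> powr (1 / r)\<bar>" by simp
    qed (use root(2)[OF u] root(2)[OF v] in simp)
    fix a
    show "(\<lambda>w. a * u w) \<in> power_ideal r"
      by (rule solid[OF scale_mem[OF root(1)[OF u], of "\<bar>a\<bar> powr (1 / r)"]])
        (use root(2)[OF u] in \<open>auto simp: abs_mult powr_mult\<close>)
  qed
  moreover have "u \<in> power_ideal r"
    if v: "v \<in> power_ideal r" and u: "u \<in> borel_measurable (msr X)"
      and le: "AE w in msr X. \<bar>u w\<bar> \<le> \<bar>v w\<bar>" for u v
    by (rule solid[OF root(1)[OF v] u]) (use le r in \<open>auto elim!: eventually_mono intro!: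
      powr_mono2\<close>)
  ultimately show ?thesis unfolding fun_ideal_def using root(2) by blast
qed

lemma power_mem: "0 < r \<Longrightarrow> x \<in> elts X \<Longrightarrow> (\<lambda>w. \<bar>x w\<bar> powr r) \<in> power_ideal r"
  unfolding power_ideal_def using elts_meas[of x] abs_mem[of x] by (simp add: powr_powr)

lemma power_weak_unit:
  assumes r: "0 < r" and e: "weak_unit (msr X) (elts X) e"
  shows "weak_unit (msr X) (power_ideal r) (\<lambda>w. e w powr r)"
proof -
  have e': "e \<in> elts X" "\<And>w. 0 \<le> e w" "\<And>v. v \<in> elts X \<Longrightarrow> AE w in msr X. e w = 0 \<longrightarrow> v w = 0"
    using e unfolding weak_unit_def by auto
  have "AE w in msr X. e w powr r = 0 \<longrightarrow> v w = 0" if "v \<in> power_ideal r" for v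
  proof -
    have "(\<lambda>w. \<bar>v w\<bar> powr (1 / r)) \<in> elts X" using that unfolding power_ideal_def by auto
    from e'(3)[OF this] show ?thesis by eventually_elim simp
  qed
  then show ?thesis unfolding weak_unit_def using power_mem[OF r e'(1)] e'(2) by simp
qed

end

section \<open>The weights\<close>

locale mixed_bounded_operator = X: banach_function_space X + Y: banach_function_space Y
  for X :: "'a fun_space" and Y :: "'b fun_space" +
  fixes T :: "('a \<Rightarrow> real) \<Rightarrow> 'b \<Rightarrow> real" and r :: real and p q :: ennreal and K :: real
  assumes r: "1 \<le> r" and p: "0 < p" and q: "0 < q" and K: "0 \<le> K"
    and T: "linear_map X Y T"
    and bound: "\<And>n k x. \<forall>i<n. \<forall>j<k. x i j \<in> elts X \<Longrightarrow>
      nrm Y (mixed_sum (ennreal r) p n k (\<lambda>i j. T (x i j))) \<le> K * nrm X (mixed_sum (ennreal r) q n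
        k x)"
    and convex: "r_convex r X" and concave: "r_concave r Y" and continuous: "section_continuous X"
begin

lemma r0: "0 < r" "0 < ennreal r" using r by auto

lemma T_mem: "x \<in> elts X \<Longrightarrow> T x \<in> elts Y"
  and T_add: "x \<in> elts X \<Longrightarrow> z \<in> elts X \<Longrightarrow> AE w in msr Y. T (\<lambda>u. x u + z u) w = T x w + T z w"
  and T_scale: "x \<in> elts X \<Longrightarrow> AE w in msr Y. T (\<lambda>u. a * x u) w = a * T x w"
  using T unfolding linear_map_def by auto

lemma T_zero: "AE w in msr Y. T (\<lambda>_. 0) w = 0"
  using T_scale[OF X.zero_mem, of 0] by simp

text \<open>\<open>\<alpha>\<close> lies above the sum \<open>A\<close> of a matrix and
  \<open>\<beta>\<close> below the corresponding sum \<open>B\<close>. The inequalities leave room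
  for a.e. exceptions and for stacking matrices of different shape.\<close>

definition mixed_pair :: "('a \<Rightarrow> real) \<Rightarrow> ('b \<Rightarrow> real) \<Rightarrow> bool" where
  "mixed_pair \<alpha> \<beta> \<longleftrightarrow> (\<exists>(n::nat) k x. (\<forall>i<n. \<forall>j<k. x i j \<in> elts X) \<and>
     (AE w in msr X. (\<Sum>i<n. lp_sum q k (\<lambda>j. x i j w) powr r) \<le> \<alpha> w) \<and>
     (AE w in msr Y. \<beta> w \<le> (\<Sum>i<n. lp_sum p k (\<lambda>j. T (x i j) w) powr r)))"

text \<open>\<open>A\<close> and \<open>B\<close> are the \<open>r\<close>-th powers of two mixed
  sums, to which the norm estimate of the locale applies. The last conclusion replaces
  \<open>\<alpha>\<close> by a genuine \<open>r\<close>-th power, whose price is known.\<close>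

lemma mixed_pair_bound:
  assumes "mixed_pair \<alpha> \<beta>"
  obtains a b where "a \<in> elts X" "b \<in> elts Y" "\<And>w. 0 \<le> a w" "\<And>w. 0 \<le> b w" "nrm Y b \<le> K * nrm X a"
    "AE w in msr X. a w powr r \<le> \<alpha> w" "AE w in msr Y. \<beta> w \<le> b w powr r"
    "mixed_pair (\<lambda>w. a w powr r) \<beta>"
proof -
  obtain n k :: nat and x where x: "\<forall>i<n. \<forall>j<k. x i j \<in> elts X"
    "AE w in msr X. (\<Sum>i<n. lp_sum q k (\<lambda>j. x i j w) powr r) \<le> \<alpha> w"
    "AE w in msr Y. \<beta> w \<le> (\<Sum>i<n. lp_sum p k (\<lambda>j. T (x i j) w) powr r)"
    using assms unfolding mixed_pair_def by blast
  let ?a = "mixed_sum (ennreal r) q n k x" and ?b = "mixed_sum (ennreal r) p n k (\<lambda>i j. T (x i j))"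
  have a: "?a \<in> elts X" using x(1) r0 q by (intro X.mixed_sum_mem) auto
  have b: "?b \<in> elts Y" using x(1) r0 p T_mem by (intro Y.mixed_sum_mem) auto
  have "mixed_pair (\<lambda>w. ?a w powr r) \<beta>"
    unfolding mixed_pair_def mixed_sum_powr[OF r0(1)] using x(1,3) by blast
  then show ?thesis
    using that[of ?a ?b] a b x(2,3) bound[OF x(1)]
      by (simp add: mixed_sum_powr[OF r0(1)] mixed_sum_nonneg)
qed

lemma mixed_pair_single:
  assumes "\<forall>j<k. x j \<in> elts X"
  shows "mixed_pair (\<lambda>w. lp_sum q k (\<lambda>j. x j w) powr r) (\<lambda>w. lp_sum p k (\<lambda>j. T (x j) w) powr r)"
  unfolding mixed_pair_def
    by (rule exI[of _ 1], rule exI[of _ k], rule exI[of _ "\<lambda>_. x"]) (use assms in simp)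

lemma mixed_pair_zero: "mixed_pair (\<lambda>_. 0) (\<lambda>_. 0)"
  unfolding mixed_pair_def by (rule exI[of _ 0]) auto

lemma mixed_pair_scale:
  assumes "mixed_pair \<alpha> \<beta>" and t: "0 < t"
  shows "mixed_pair (\<lambda>w. t * \<alpha> w) (\<lambda>w. t * \<beta> w)"
proof -
  obtain n k :: nat and x where x: "\<forall>i<n. \<forall>j<k. x i j \<in> elts X"
    "AE w in msr X. (\<Sum>i<n. lp_sum q k (\<lambda>j. x i j w) powr r) \<le> \<alpha> w"
    "AE w in msr Y. \<beta> w \<le> (\<Sum>i<n. lp_sum p k (\<lambda>j. T (x i j) w) powr r)"
    using assms unfolding mixed_pair_def by blast
  define c where "c = t powr (1 / r)"
  have c: "c > 0" "c powr r = t" using t r0 by (auto simp: c_def powr_inverse_cancel)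
  define y where "y i j = (\<lambda>w. c * x i j w)" for i j
  have "\<forall>i<n. \<forall>j<k. y i j \<in> elts X" using x(1) by (auto simp: y_def X.scale_mem)
  moreover have "AE w in msr X. (\<Sum>i<n. lp_sum q k (\<lambda>j. y i j w) powr r) \<le> t * \<alpha> w"
    using x(2)
  proof eventually_elim
    case (elim w)
    have "(\<Sum>i<n. lp_sum q k (\<lambda>j. y i j w) powr r) = t * (\<Sum>i<n. lp_sum q k (\<lambda>j. x i j w) powr r)"
      unfolding y_def using c
        by (simp add: lp_sum_scale[OF q] powr_mult lp_sum_nonneg sum_distrib_left)
    then show ?case using elim t by simp
  qed
  moreover have "AE w in msr Y. t * \<beta> w \<le> (\<Sum>i<n. lp_sum p k (\<lambda>j. T (y i j) w) powr r)"
  proof -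
    have "AE w in msr Y. \<forall>z\<in>{..<n} \<times> {..<k}. T (y (fst z) (snd z)) w = c * T (x (fst z) (snd z)) w"
      unfolding y_def using x(1) by (intro AE_finite_allI T_scale) auto
    then show ?thesis using x(3)
    proof eventually_elim
      case (elim w)
      have "lp_sum p k (\<lambda>j. T (y i j) w) = lp_sum p k (\<lambda>j. c * T (x i j) w)" if "i < n" for i
        using elim(1) that by (intro lp_sum_cong) auto
      then have "(\<Sum>i<n. lp_sum p k (\<lambda>j. T (y i j) w) powr r) =
        t * (\<Sum>i<n. lp_sum p k (\<lambda>j. T (x i j) w) powr r)"
        using c by (simp add: lp_sum_scale[OF p] powr_mult lp_sum_nonneg sum_distrib_left)
      then show ?case using elim(2) t by simp
    qed
  qed
  ultimately show ?thesis unfolding mixed_pair_def by blast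
qed

text \<open>Matrices with different numbers of columns are padded with zeros before they are stacked.\<close>

lemma mixed_pair_add:
  assumes "mixed_pair \<alpha> \<beta>" "mixed_pair \<alpha>' \<beta>'"
  shows "mixed_pair (\<lambda>w. \<alpha> w + \<alpha>' w) (\<lambda>w. \<beta> w + \<beta>' w)"
proof -
  obtain n k :: nat and x where x: "\<forall>i<n. \<forall>j<k. x i j \<in> elts X"
    "AE w in msr X. (\<Sum>i<n. lp_sum q k (\<lambda>j. x i j w) powr r) \<le> \<alpha> w"
    "AE w in msr Y. \<beta> w \<le> (\<Sum>i<n. lp_sum p k (\<lambda>j. T (x i j) w) powr r)"
    using assms(1) unfolding mixed_pair_def by blast
  obtain n' k' :: nat and x' where x': "\<forall>i<n'. \<forall>j<k'. x' i j \<in> elts X"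
    "AE w in msr X. (\<Sum>i<n'. lp_sum q k' (\<lambda>j. x' i j w) powr r) \<le> \<alpha>' w"
    "AE w in msr Y. \<beta>' w \<le> (\<Sum>i<n'. lp_sum p k' (\<lambda>j. T (x' i j) w) powr r)"
    using assms(2) unfolding mixed_pair_def by blast
  define l where "l = max k k'"
  define z where "z i j = (if j < k then x i j else (\<lambda>_. 0))" for i j
  define z' where "z' i j = (if j < k' then x' i j else (\<lambda>_. 0))" for i j
  define y where "y i = (if i < n then z i else z' (i - n))" for i
  have "\<forall>i<n + n'. \<forall>j<l. y i j \<in> elts X"
    using x(1) x'(1) X.zero_mem by (auto simp: y_def z_def z'_def)
  moreover have "AE w in msr X. (\<Sum>i<n + n'. lp_sum q l (\<lambda>j. y i j w) powr r) \<le> \<alpha> w + \<alpha>' w"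
    using x(2) x'(2)
  proof eventually_elim
    case (elim w)
    have "lp_sum q l (\<lambda>j. z i j w) = lp_sum q k (\<lambda>j. x i j w)"
      "lp_sum q l (\<lambda>j. z' i j w) = lp_sum q k' (\<lambda>j. x' i j w)" for i
      by (subst lp_sum_append_zero[OF q, of k l] lp_sum_append_zero[OF q, of k' l];
          auto simp: l_def z_def z'_def intro!: lp_sum_cong)+
    then show ?case
      using elim sum_append[where F = "\<lambda>x. lp_sum q l (\<lambda>j. x j w) powr r" and a = z and b = z'
        and N = n and N' = n']
      by (simp add: y_def)
  qed
  moreover have "AE w in msr Y. \<beta> w + \<beta>' w \<le> (\<Sum>i<n + n'. lp_sum p l (\<lambda>j. T (y i j) w) powr r)"
    using x(3) x'(3) T_zero
  proof eventually_elim
    case (elim w)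
    have "lp_sum p l (\<lambda>j. T (z i j) w) = lp_sum p k (\<lambda>j. T (x i j) w)"
      "lp_sum p l (\<lambda>j. T (z' i j) w) = lp_sum p k' (\<lambda>j. T (x' i j) w)" for i
      using elim(3)
      by (subst lp_sum_append_zero[OF p, of k l] lp_sum_append_zero[OF p, of k' l];
          auto simp: l_def z_def z'_def intro!: lp_sum_cong)+
    then show ?case
      using elim sum_append[where F = "\<lambda>x. lp_sum p l (\<lambda>j. T (x j) w) powr r" and a = z and b = z'
        and N = n and N' = n']
      by (simp add: y_def)
  qed
  ultimately show ?thesis unfolding mixed_pair_def by blast
qed

end

section \<open>The domain of the functional on the \<open>Y\<close> side and the separation
  argument\<close>

context mixed_bounded_operator
begin

text \<open>The functions whose modulus can be paid for in the cone: by a matrix, at the expense of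
  \<open>\<alpha>\<close> on the \<open>X\<close> side, and by a multiple of
  \<open>e^r\<close>.\<close>

definition dominated :: "('b \<Rightarrow> real) \<Rightarrow> ('b \<Rightarrow> real) set" where
  "dominated e = {v \<in> borel_measurable (msr Y). \<exists>\<alpha> \<beta> t. mixed_pair \<alpha> \<beta> \<and> 0 \<le> t \<and>
     (AE w in msr Y. \<bar>v w\<bar> \<le> \<beta> w + t * e w powr r)}"

lemma dominated_ideal: "fun_ideal (msr Y) (dominated e)"
proof -
  have "(\<lambda>_. 0) \<in> dominated e"
  proof -
    show ?thesis unfolding dominated_def
      by (intro CollectI conjI exI[of _ "\<lambda>_. 0"] exI[of _ "0::real"] mixed_pair_zero) auto
  qed
  moreover have "(\<lambda>w. u w + v w) \<in> dominated e" if uv: "u \<in> dominated e" "v \<in> dominated e" for u v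
  proof -
    obtain \<alpha> \<beta> t where a: "mixed_pair \<alpha> \<beta>" "0 \<le> t" "AE w in msr Y. \<bar>u w\<bar> \<le> \<beta> w + t * e w powr r"
      using uv(1) unfolding dominated_def by blast
    obtain \<alpha>' \<beta>' t'
      where a': "mixed_pair \<alpha>' \<beta>'" "0 \<le> t'" "AE w in msr Y. \<bar>v w\<bar> \<le> \<beta>' w + t' * e w powr r"
      using uv(2) unfolding dominated_def by blast
    have "AE w in msr Y. \<bar>u w + v w\<bar> \<le> (\<beta> w + \<beta>' w) + (t + t') * e w powr r"
      using a(3) a'(3) by eventually_elim (simp add: distrib_right)
    moreover have "(\<lambda>w. u w + v w) \<in> borel_measurable (msr Y)" using uv unfolding dominated_def
      by auto
    ultimately show ?thesis
      unfolding dominated_def using mixed_pair_add[OF a(1) a'(1)] a(2) a'(2)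
      by (auto intro!: exI[of _ "\<lambda>w. \<alpha> w + \<alpha>' w"] exI[of _ "\<lambda>w. \<beta> w + \<beta>' w"] exI[of _ "t + t'"])
  qed
  moreover have "(\<lambda>w. c * u w) \<in> dominated e" if u: "u \<in> dominated e" for u c
  proof -
    obtain \<alpha> \<beta> t where a: "mixed_pair \<alpha> \<beta>" "0 \<le> t" "AE w in msr Y. \<bar>u w\<bar> \<le> \<beta> w + t * e w powr r"
      using u unfolding dominated_def by blast
    let ?c = "\<bar>c\<bar> + 1"
    have "AE w in msr Y. \<bar>c * u w\<bar> \<le> ?c * \<beta> w + (?c * t) * e w powr r"
      using a(3)
    proof eventually_elim
      case (elim w)
      have "\<bar>c * u w\<bar> \<le> ?c * \<bar>u w\<bar>" by (simp add: abs_mult mult_right_mono)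
      also have "\<dots> \<le> ?c * (\<beta> w + t * e w powr r)" by (intro mult_left_mono elim) simp
      finally show ?case by (simp add: algebra_simps)
    qed
    moreover have "(\<lambda>w. c * u w) \<in> borel_measurable (msr Y)" using u unfolding dominated_def by auto
    moreover have "mixed_pair (\<lambda>w. ?c * \<alpha> w) (\<lambda>w. ?c * \<beta> w)"
      by (rule mixed_pair_scale[OF a(1)]) simp
    moreover have "0 \<le> ?c * t" using a(2) by simp
    ultimately show ?thesis unfolding dominated_def by blast
  qed
  moreover have "u \<in> dominated e"
    if v: "v \<in> dominated e" and u: "u \<in> borel_measurable (msr Y)"
      and le: "AE w in msr Y. \<bar>u w\<bar> \<le> \<bar>v w\<bar>" for u v
  proof -
    obtain \<alpha> \<beta> t where a: "mixed_pair \<alpha> \<beta>" "0 \<le> t" "AE w in msr Y. \<bar>v w\<bar> \<le> \<beta> w + t * e w powr r"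
      using v unfolding dominated_def by blast
    have "AE w in msr Y. \<bar>u w\<bar> \<le> \<beta> w + t * e w powr r"
      using a(3) le by eventually_elim simp
    then show ?thesis unfolding dominated_def using a(1,2) u by blast
  qed
  moreover have "dominated e \<subseteq> borel_measurable (msr Y)" by (auto simp: dominated_def)
  ultimately show ?thesis
    unfolding fun_ideal_def fun_subspace_def by (intro conjI ballI allI impI)
qed

lemma root_bound:
  assumes "0 \<le> y" "0 \<le> b" "0 \<le> t" "0 \<le> e" "y powr r \<le> b powr r + t * e powr r"
  shows "y \<le> b + t powr (1 / r) * e"
proof -
  have "y = (y powr r) powr (1 / r)" using assms r0 by (simp add: powr_cancel_inverse)
  also have "\<dots> \<le> (b powr r + t * e powr r) powr (1 / r)"
    using assms r0 by (intro powr_mono2) auto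
  also have "\<dots> \<le> (b powr r) powr (1 / r) + (t * e powr r) powr (1 / r)"
    using assms r by (intro root_add_le) auto
  also have "\<dots> = b + t powr (1 / r) * e"
    using assms r0 by (simp add: powr_cancel_inverse powr_mult)
  finally show ?thesis .
qed

lemma dominated_unit:
  assumes e: "weak_unit (msr Y) (elts Y) e"
  shows "weak_unit (msr Y) (dominated e) (\<lambda>w. e w powr r)"
proof -
  have e': "e \<in> elts Y" "\<And>w. 0 \<le> e w" "\<And>v. v \<in> elts Y \<Longrightarrow> AE w in msr Y. e w = 0 \<longrightarrow> v w = 0"
    using e unfolding weak_unit_def by auto
  have "(\<lambda>w. e w powr r) \<in> dominated e"
  proof -
    have "AE w in msr Y. \<bar>e w powr r\<bar> \<le> 0 + 1 * e w powr r" by simp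
    moreover have "(\<lambda>w. e w powr r) \<in> borel_measurable (msr Y)" using Y.elts_meas[OF e'(1)] by simp
    ultimately show ?thesis unfolding dominated_def
      by (intro CollectI conjI exI[of _ "\<lambda>_. 0"] exI[of _ "1::real"] mixed_pair_zero) auto
  qed
  moreover have "AE w in msr Y. e w powr r = 0 \<longrightarrow> v w = 0" if v: "v \<in> dominated e" for v
  proof -
    obtain \<alpha> \<beta> t where a: "mixed_pair \<alpha> \<beta>" "0 \<le> t" "AE w in msr Y. \<bar>v w\<bar> \<le> \<beta> w + t * e w powr r"
      using v unfolding dominated_def by blast
    obtain a0 b where b: "a0 \<in> elts X" "b \<in> elts Y" "\<And>w. 0 \<le> a0 w" "\<And>w. 0 \<le> b w"
      "nrm Y b \<le> K * nrm X a0" "AE w in msr X. a0 w powr r \<le> \<alpha> w" "AE w in msr Y. \<beta> w \<le> b w powr r"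
      "mixed_pair (\<lambda>w. a0 w powr r) \<beta>"
      by (rule mixed_pair_bound[OF a(1)], rule that)
    show ?thesis
      using a(3) b(7) e'(3)[OF b(2)]
    proof eventually_elim
      case (elim w)
      show ?case
      proof
        assume "e w powr r = 0"
        then have "e w = 0" "b w = 0" using elim(3) by auto
        then show "v w = 0" using elim by simp
      qed
    qed
  qed
  ultimately show ?thesis unfolding weak_unit_def by simp
qed

text \<open>The weights appear as densities, before \<open>r\<close>-th roots are taken. The lower
  bound in the last conclusion is restricted to \<open>\<bar>y\<bar> \<le> c * e\<close> because
  only then is \<open>|y|^r\<close> certain to lie in the domain of the second functional; general
  functions are reached later by truncation.\<close>

theorem weights:
  assumes e: "weak_unit (msr Y) (elts Y) e"
  obtains f d C where "f \<in> borel_measurable (msr X)" "\<And>w. 0 \<le> f w"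
    "d \<in> borel_measurable (msr Y)" "\<And>w. 0 \<le> d w" "\<And>w. e w = 0 \<Longrightarrow> d w = 0"
    "\<And>x. x \<in> elts X \<Longrightarrow> integrable (msr X) (\<lambda>w. \<bar>x w\<bar> powr r * f w)"
    "\<And>x. x \<in> elts X \<Longrightarrow> (\<integral>w. \<bar>x w\<bar> powr r * f w \<partial>msr X) \<le> C * nrm X x powr r"
    "\<And>k x. \<forall>j<k. x j \<in> elts X \<Longrightarrow>
       (\<integral>\<^sup>+w. ennreal (lp_sum p k (\<lambda>j. T (x j) w) powr r * d w) \<partial>msr Y) \<le>
       ennreal (\<integral>w. lp_sum q k (\<lambda>j. x j w) powr r * f w \<partial>msr X)"
    "\<And>y c. y \<in> elts Y \<Longrightarrow> AE w in msr Y. \<bar>y w\<bar> \<le> c * e w \<Longrightarrow>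
       ennreal (nrm Y y powr r) \<le> (\<integral>\<^sup>+w. ennreal (\<bar>y w\<bar> powr r * d w) \<partial>msr Y)"
proof -
  let ?E = "X.power_ideal r" and ?I = "dominated e"
  note E_ideal = X.power_ideal[OF r] and I_ideal = dominated_ideal[of e]
  have e': "e \<in> elts Y" "\<And>w. 0 \<le> e w" using e unfolding weak_unit_def by auto
  obtain MX where MX: "0 \<le> MX" "\<And>u s. X.convex_cover r u s \<Longrightarrow>
     \<exists>z\<in>elts X. (\<forall>w. 0 \<le> z w) \<and> (AE w in msr X. u w \<le> z w powr r) \<and> nrm X z powr r \<le> MX * s"
    using X.r_convex_bound[OF convex r] by blast
  obtain MY where MY: "0 \<le> MY" "\<And>u s. Y.concave_pack r u s \<Longrightarrow>
     \<exists>z\<in>elts Y. (\<forall>w. 0 \<le> z w) \<and> (AE w in msr Y. z w powr r \<le> u w) \<and> s \<le> MY * nrm Y z powr r"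
    using Y.r_concave_bound[OF concave r] by blast
  \<comment> \<open>Both constants are read off the check that 0 has no negative price: there
    \<open>||y||^r\<close> is at most \<open>2^r (K^r ||z||^r + t ||e||^r)\<close>, while
    \<open>MX\<close> and \<open>MY\<close> come from replacing families by single
    functions.\<close>
  define K1 where "K1 = MY * (2 powr r * (K powr r * MX))"
  define K2 where "K2 = MY * (2 powr r * nrm Y e powr r)"
  have K12: "0 \<le> K1" "0 \<le> K2" unfolding K1_def K2_def using MX MY by auto
  \<comment> \<open>Pairs of functions are encoded as functions on the disjoint sum, so that one
    application of Hahn-Banach yields both functionals together.\<close>
  define V where "V = {h :: 'a + 'b \<Rightarrow> real. (\<lambda>w. h (Inl w)) \<in> ?E \<and> (\<lambda>w. h (Inr w)) \<in> ?I}"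
  define C where "C = {(h :: 'a + 'b \<Rightarrow> real, c). \<exists>u s \<alpha> \<beta> v s' t. X.convex_cover r u s \<and>
    mixed_pair \<alpha> \<beta> \<and>
     Y.concave_pack r v s' \<and> 0 \<le> t \<and> (AE w in msr X. h (Inl w) \<le> u w - \<alpha> w) \<and>
     (AE w in msr Y. h (Inr w) \<le> \<beta> w - v w + t * e w powr r) \<and> K1 * s - s' + K2 * t \<le> c}"
  have CI: "(h, c) \<in> C" if "X.convex_cover r u s" "mixed_pair \<alpha> \<beta>" "Y.concave_pack r v s'" "0 \<le> t"
    "AE w in msr X. h (Inl w) \<le> u w - \<alpha> w" "AE w in msr Y. h (Inr w) \<le> \<beta> w - v w + t * e w powr r"
    "K1 * s - s' + K2 * t \<le> c" for h c u s \<alpha> \<beta> v s' t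
    unfolding C_def mem_Collect_eq prod.case
    by (rule exI[of _ u], rule exI[of _ s], rule exI[of _ \<alpha>], rule exI[of _ \<beta>], rule exI[of _ v],
        rule exI[of _ s'], rule exI[of _ t], intro conjI that)
  have V: "fun_subspace V"
    using fun_subspaceD[OF fun_idealD(1)[OF E_ideal]] fun_subspaceD[OF fun_idealD(1)[OF I_ideal]]
    unfolding fun_subspace_def V_def by simp
  have V_split: "case_sum u v \<in> V \<longleftrightarrow> u \<in> ?E \<and> v \<in> ?I" for u v unfolding V_def by simp
  obtain m where lin: "linear_on_fun V m" and mle: "\<And>v c. v \<in> V \<Longrightarrow> (v, c) \<in> C \<Longrightarrow> m v \<le> c"
  proof (rule cone_functional[OF V, of C])
    show "\<exists>c. (h, c) \<in> C" if h: "h \<in> V" for h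
    proof -
      let ?u = "\<lambda>w. h (Inl w)" and ?v = "\<lambda>w. h (Inr w)"
      have u: "?u \<in> ?E" and v: "?v \<in> ?I" using h unfolding V_def by auto
      obtain \<alpha> \<beta> t where a: "mixed_pair \<alpha> \<beta>" "0 \<le> t" "AE w in msr Y. \<bar>?v w\<bar> \<le> \<beta> w + t * e w powr r"
        using v unfolding dominated_def by blast
      obtain x b where x: "x \<in> elts X" "b \<in> elts Y" "\<And>w. 0 \<le> x w" "\<And>w. 0 \<le> b w"
        "nrm Y b \<le> K * nrm X x"
        "AE w in msr X. x w powr r \<le> \<alpha> w" "AE w in msr Y. \<beta> w \<le> b w powr r"
          "mixed_pair (\<lambda>w. x w powr r) \<beta>"
        by (rule mixed_pair_bound[OF a(1)], rule that)
      have "(\<lambda>w. \<bar>?u w\<bar> powr (1 / r)) \<in> elts X" using u unfolding X.power_ideal_def by auto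
      then have "X.convex_cover r (\<lambda>w. \<bar>?u w\<bar>) (nrm X (\<lambda>w. \<bar>?u w\<bar> powr (1 / r)) powr r)"
        by (rule X.convex_cover_single) (simp_all add: powr_inverse_cancel r0)
      \<comment> \<open>Using the matrix for \<open>\<beta>\<close> subtracts \<open>x^r\<close> on
        the \<open>X\<close> side. Covering \<open>x^r\<close> in addition to \<open>|u|\<close>
        buys it back.\<close>
      moreover have "X.convex_cover r (\<lambda>w. x w powr r) (nrm X x powr r)"
        by (rule X.convex_cover_single[OF x(1)]) (use x(3) in simp_all)
      ultimately have "X.convex_cover r (\<lambda>w. \<bar>?u w\<bar> + x w powr r)
          (nrm X (\<lambda>w. \<bar>?u w\<bar> powr (1 / r)) powr r + nrm X x powr r)" by (rule X.convex_cover_add)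
      then have "(h, K1 * (nrm X (\<lambda>w. \<bar>?u w\<bar> powr (1 / r)) powr r + nrm X x powr r) - 0 +
        K2 * t) \<in> C"
      proof (rule CI[OF _ x(8) Y.concave_pack_zero a(2)])
        show "AE w in msr Y. h (Inr w) \<le> \<beta> w - 0 + t * e w powr r"
          using a(3) by eventually_elim simp
      qed auto
      then show ?thesis by blast
    qed
    show "(\<lambda>_. 0, 0) \<in> C"
      by (rule CI[OF X.convex_cover_zero mixed_pair_zero Y.concave_pack_zero order_refl]) auto
    show "0 \<le> c" if C: "(\<lambda>_. 0, c) \<in> C" for c
    proof -
      obtain u s \<alpha> \<beta> v s' t
        where H: "X.convex_cover r u s" "mixed_pair \<alpha> \<beta>" "Y.concave_pack r v s'" "0 \<le> t"
        "AE w in msr X. 0 \<le> u w - \<alpha> w" "AE w in msr Y. 0 \<le> \<beta> w - v w + t * e w powr r"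
        "K1 * s - s' + K2 * t \<le> c" using C unfolding C_def by blast
      obtain z where z: "z \<in> elts X" "\<And>w. 0 \<le> z w" "AE w in msr X. u w \<le> z w powr r"
        "nrm X z powr r \<le> MX * s"
        using MX(2)[OF H(1)] by blast
      obtain y where y: "y \<in> elts Y" "\<And>w. 0 \<le> y w" "AE w in msr Y. y w powr r \<le> v w"
        "s' \<le> MY * nrm Y y powr r"
        using MY(2)[OF H(3)] by blast
      obtain a b where ab: "a \<in> elts X" "b \<in> elts Y" "\<And>w. 0 \<le> a w" "\<And>w. 0 \<le> b w"
        "nrm Y b \<le> K * nrm X a"
        "AE w in msr X. a w powr r \<le> \<alpha> w" "AE w in msr Y. \<beta> w \<le> b w powr r"
        "mixed_pair (\<lambda>w. a w powr r) \<beta>"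
        by (rule mixed_pair_bound[OF H(2)], rule that)
      \<comment> \<open>Over 0 the data satisfy \<open>a^r \<le> \<alpha> \<le> u \<le> z^r\<close>
        and \<open>y^r \<le> v \<le> b^r + t e^r\<close>. The operator bound for \<open>b\<close>
        against \<open>a\<close> links the two chains.\<close>
      have az: "nrm X a \<le> nrm X z"
      proof (rule X.norm_mono[OF ab(1) z(1)])
        show "AE w in msr X. \<bar>a w\<bar> \<le> \<bar>z w\<bar>"
          using H(5) z(3) ab(6)
        proof eventually_elim
          case (elim w)
          then have "a w powr r \<le> z w powr r" by linarith
          then have "a w \<le> z w" by (rule powr_le_imp_le) (use ab(3) z(2) r0 in auto)
          then show ?case using ab(3)[of w] by simp
        qed
      qed
      let ?t = "t powr (1 / r)"
      have te: "(\<lambda>w. ?t * e w) \<in> elts Y" by (rule Y.scale_mem[OF e'(1)])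
      have "nrm Y y \<le> nrm Y (\<lambda>w. b w + ?t * e w)"
      proof (rule Y.norm_mono[OF y(1) Y.add_mem[OF ab(2) te]])
        show "AE w in msr Y. \<bar>y w\<bar> \<le> \<bar>b w + ?t * e w\<bar>"
          using H(6) y(3) ab(7)
        proof eventually_elim
          case (elim w)
          then have "y w powr r \<le> b w powr r + t * e w powr r" by linarith
          then have "y w \<le> b w + ?t * e w" by (intro root_bound) (use y(2) ab(4) H(4) e'(2) in auto)
          then show ?case using y(2)[of w] by simp
        qed
      qed
      also have "\<dots> \<le> nrm Y b + ?t * nrm Y e"
        using Y.norm_triangle[OF ab(2) te] Y.norm_scale[OF e'(1), of ?t] by simp
      also have "\<dots> \<le> K * nrm X z + ?t * nrm Y e"
        using ab(5) mult_left_mono[OF az K] by simp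
      finally have "nrm Y y powr r \<le> (K * nrm X z + ?t * nrm Y e) powr r"
        using Y.norm_nonneg[OF y(1)] r0 by (intro powr_mono2) auto
      also have "\<dots> \<le> 2 powr r * ((K * nrm X z) powr r + (?t * nrm Y e) powr r)"
        using K r0 X.norm_nonneg[OF z(1)] Y.norm_nonneg[OF e'(1)] by (intro powr_add_le) auto
      also have "\<dots> = 2 powr r * (K powr r * nrm X z powr r + t * nrm Y e powr r)"
        using K H(4) X.norm_nonneg[OF z(1)] Y.norm_nonneg[OF e'(1)]
        by (simp add: powr_mult powr_inverse_cancel[OF r0(1)])
      also have "\<dots> \<le> 2 powr r * (K powr r * (MX * s) + t * nrm Y e powr r)"
        using z(4) by (intro mult_left_mono add_right_mono) auto
      finally have "MY * nrm Y y powr r \<le>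
        MY * (2 powr r * (K powr r * (MX * s) + t * nrm Y e powr r))"
        using MY(1) by (rule mult_left_mono)
      also have "\<dots> = K1 * s + K2 * t" by (simp add: K1_def K2_def algebra_simps)
      finally show ?thesis using y(4) H(7) by linarith
    qed
    show "(\<lambda>w. l * h w, l * c) \<in> C" if C: "(h, c) \<in> C" and l: "0 < l" for h c l
    proof -
      obtain u s \<alpha> \<beta> v s' t
        where H: "X.convex_cover r u s" "mixed_pair \<alpha> \<beta>" "Y.concave_pack r v s'" "0 \<le> t"
        "AE w in msr X. h (Inl w) \<le> u w - \<alpha> w"
          "AE w in msr Y. h (Inr w) \<le> \<beta> w - v w + t * e w powr r"
        "K1 * s - s' + K2 * t \<le> c" using C unfolding C_def by blast
      show ?thesis
      proof (rule CI[OF X.convex_cover_scale[OF H(1) l r0(1)] mixed_pair_scale[OF H(2) l]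
            Y.concave_pack_scale[OF H(3) l r0(1)], of "l * t"])
        show "AE w in msr X. l * h (Inl w) \<le> l * u w - l * \<alpha> w"
          using H(5) l by (auto elim!: eventually_mono simp flip: right_diff_distrib)
        show "AE w in msr Y. l * h (Inr w) \<le> l * \<beta> w - l * v w + l * t * e w powr r"
          using H(6)
        proof eventually_elim
          case (elim w)
          show ?case using mult_left_mono[OF elim, of l] l by (simp add: algebra_simps)
        qed
        show "K1 * (l * s) - l * s' + K2 * (l * t) \<le> l * c"
          using mult_left_mono[OF H(7), of l] l by (simp add: algebra_simps)
      qed (use H(4) l in auto)
    qed
    show "(\<lambda>w. h w + h' w, c + c') \<in> C" if C: "(h, c) \<in> C" "(h', c') \<in> C" for h h' c c'
    proof -
      obtain u s \<alpha> \<beta> v s' t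
        where H: "X.convex_cover r u s" "mixed_pair \<alpha> \<beta>" "Y.concave_pack r v s'" "0 \<le> t"
        "AE w in msr X. h (Inl w) \<le> u w - \<alpha> w"
          "AE w in msr Y. h (Inr w) \<le> \<beta> w - v w + t * e w powr r"
        "K1 * s - s' + K2 * t \<le> c" using C(1) unfolding C_def by blast
      obtain u1 s1 \<alpha>1 \<beta>1 v1 s1' t1
        where H1: "X.convex_cover r u1 s1" "mixed_pair \<alpha>1 \<beta>1" "Y.concave_pack r v1 s1'" "0 \<le> t1"
        "AE w in msr X. h' (Inl w) \<le> u1 w - \<alpha>1 w"
          "AE w in msr Y. h' (Inr w) \<le> \<beta>1 w - v1 w + t1 * e w powr r"
        "K1 * s1 - s1' + K2 * t1 \<le> c'" using C(2) unfolding C_def by blast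
      show ?thesis
      proof (rule CI[OF X.convex_cover_add[OF H(1) H1(1)] mixed_pair_add[OF H(2) H1(2)]
            Y.concave_pack_add[OF H(3) H1(3)], of "t + t1"])
        show "AE w in msr X. h (Inl w) + h' (Inl w) \<le> u w + u1 w - (\<alpha> w + \<alpha>1 w)"
          using H(5) H1(5) by eventually_elim simp
        show "AE w in msr Y. h (Inr w) + h' (Inr w) \<le>
          \<beta> w + \<beta>1 w - (v w + v1 w) + (t + t1) * e w powr r"
          using H(6) H1(6) by eventually_elim (simp add: distrib_right)
        show "K1 * (s + s1) - (s' + s1') + K2 * (t + t1) \<le> c + c'"
          using H(7) H1(7) by (simp add: algebra_simps)
      qed (use H(4) H1(4) in auto)
    qed
  qed blast
  have zero_E: "(\<lambda>_. 0) \<in> ?E" and zero_I: "(\<lambda>_. 0) \<in> ?I"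
    using fun_subspaceD(1)[OF fun_idealD(1)] E_ideal I_ideal by auto
  define l where "l u = m (case_sum u (\<lambda>_. 0))" for u
  define \<mu> where "\<mu> v = m (case_sum (\<lambda>_. 0) v)" for v
  have m_add: "m (\<lambda>z. h z + h' z) = m h + m h'" if "h \<in> V" "h' \<in> V" for h h'
    using linear_on_funD(1)[OF lin that] .
  have m_scale: "m (\<lambda>z. a * h z) = a * m h" if "h \<in> V" for h a
    using linear_on_funD(2)[OF lin that] .
  have lin_l: "linear_on_fun ?E l"
    unfolding linear_on_fun_def
  proof (intro conjI ballI allI)
    fix u u' assume u: "u \<in> ?E" "u' \<in> ?E"
    have "l (\<lambda>w. u w + u' w) = m (\<lambda>z. case_sum u (\<lambda>_. 0) z + case_sum u' (\<lambda>_. 0) z)"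
      unfolding l_def by (rule arg_cong[of _ _ m]) (auto split: sum.split)
    also have "\<dots> = l u + l u'" unfolding l_def by (rule m_add) (simp_all add: V_split u zero_I)
    finally show "l (\<lambda>w. u w + u' w) = l u + l u'" .
    fix a :: real
    have "l (\<lambda>w. a * u w) = m (\<lambda>z. a * case_sum u (\<lambda>_. 0) z)"
      unfolding l_def by (rule arg_cong[of _ _ m]) (auto split: sum.split)
    also have "\<dots> = a * l u" unfolding l_def by (rule m_scale) (simp add: V_split u zero_I)
    finally show "l (\<lambda>w. a * u w) = a * l u" .
  qed
  have lin_\<mu>: "linear_on_fun ?I \<mu>"
    unfolding linear_on_fun_def
  proof (intro conjI ballI allI)
    fix u u' assume u: "u \<in> ?I" "u' \<in> ?I"
    have "\<mu> (\<lambda>w. u w + u' w) = m (\<lambda>z. case_sum (\<lambda>_. 0) u z + case_sum (\<lambda>_. 0) u' z)"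
      unfolding \<mu>_def by (rule arg_cong[of _ _ m]) (auto split: sum.split)
    also have "\<dots> = \<mu> u + \<mu> u'" unfolding \<mu>_def by (rule m_add) (simp_all add: V_split u zero_E)
    finally show "\<mu> (\<lambda>w. u w + u' w) = \<mu> u + \<mu> u'" .
    fix a :: real
    have "\<mu> (\<lambda>w. a * u w) = m (\<lambda>z. a * case_sum (\<lambda>_. 0) u z)"
      unfolding \<mu>_def by (rule arg_cong[of _ _ m]) (auto split: sum.split)
    also have "\<dots> = a * \<mu> u" unfolding \<mu>_def by (rule m_scale) (simp add: V_split u zero_E)
    finally show "\<mu> (\<lambda>w. a * u w) = a * \<mu> u" .
  qed
  have m_split: "m (case_sum u v) = l u + \<mu> v" if "u \<in> ?E" "v \<in> ?I" for u v
  proof -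
    have "m (case_sum u v) = m (\<lambda>z. case_sum u (\<lambda>_. 0) z + case_sum (\<lambda>_. 0) v z)"
      by (rule arg_cong[of _ _ m]) (auto split: sum.split)
    also have "\<dots> = l u + \<mu> v"
      unfolding l_def \<mu>_def by (rule m_add) (simp_all add: V_split that zero_E zero_I)
    finally show ?thesis .
  qed
  have neg: "l (\<lambda>w. - u w) = - l u" if "u \<in> ?E" for u
    using linear_on_funD(2)[OF lin_l that, of "-1"] by simp
  have neg': "\<mu> (\<lambda>w. - u w) = - \<mu> u" if "u \<in> ?I" for u
    using linear_on_funD(2)[OF lin_\<mu> that, of "-1"] by simp
  have l0: "l (\<lambda>_. 0) = 0" and \<mu>0: "\<mu> (\<lambda>_. 0) = 0"
    using linear_on_funD(2)[OF lin_l zero_E, of 0] linear_on_funD(2)[OF lin_\<mu> zero_I, of 0] by auto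
  note E_neg = fun_subspace_neg[OF fun_idealD(1)[OF E_ideal]]
  note I_neg = fun_subspace_neg[OF fun_idealD(1)[OF I_ideal]]
  \<comment> \<open>Each property of \<open>l\<close> and \<open>\<mu>\<close> below comes from one
    simple element of the cone: no data at all for positivity, a single covering function, a single
    packed function, or a matrix with one row.\<close>
  have upper: "l u + \<mu> v \<le> c" if "u \<in> ?E" "v \<in> ?I" "(case_sum u v, c) \<in> C" for u v c
    using mle[of "case_sum u v" c] that V_split m_split by simp
  have l_pos: "0 \<le> l u" if u: "u \<in> ?E" "AE w in msr X. 0 \<le> u w" for u
  proof -
    have "l (\<lambda>w. - u w) + \<mu> (\<lambda>_. 0) \<le> 0"
      by (rule upper[OF E_neg[OF u(1)] zero_I],
          rule CI[OF X.convex_cover_zero mixed_pair_zero Y.concave_pack_zero order_refl]) (use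
            u(2) in auto)
    then show ?thesis using neg[OF u(1)] \<mu>0 by simp
  qed
  have \<mu>_pos: "0 \<le> \<mu> u" if u: "u \<in> ?I" "AE w in msr Y. 0 \<le> u w" for u
  proof -
    have "l (\<lambda>_. 0) + \<mu> (\<lambda>w. - u w) \<le> 0"
      by (rule upper[OF zero_E I_neg[OF u(1)]],
          rule CI[OF X.convex_cover_zero mixed_pair_zero Y.concave_pack_zero order_refl]) (use
            u(2) in auto)
    then show ?thesis using neg'[OF u(1)] l0 by simp
  qed
  have l_le: "l (\<lambda>w. \<bar>x w\<bar> powr r) \<le> K1 * nrm X x powr r" if x: "x \<in> elts X" for x
  proof -
    have "X.convex_cover r (\<lambda>w. \<bar>x w\<bar> powr r) (nrm X x powr r)"
      by (rule X.convex_cover_single[OF x]) auto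
    then have "l (\<lambda>w. \<bar>x w\<bar> powr r) + \<mu> (\<lambda>_. 0) \<le> K1 * nrm X x powr r"
      by (intro upper X.power_mem r0 x zero_I CI[OF _ mixed_pair_zero Y.concave_pack_zero
        order_refl]) auto
    then show ?thesis using \<mu>0 by simp
  qed
  have \<mu>_ge: "nrm Y y powr r \<le> \<mu> (\<lambda>w. \<bar>y w\<bar> powr r)" if y: "y \<in> elts Y" "(\<lambda>w. \<bar>y w\<bar> powr r) \<in> ?I"
    for y
  proof -
    have "Y.concave_pack r (\<lambda>w. \<bar>y w\<bar> powr r) (nrm Y y powr r)"
      by (rule Y.concave_pack_single[OF y(1)]) auto
    then have "l (\<lambda>_. 0) + \<mu> (\<lambda>w. - (\<bar>y w\<bar> powr r)) \<le> - (nrm Y y powr r)"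
      by (intro upper zero_E I_neg y(2) CI[OF X.convex_cover_zero mixed_pair_zero _ order_refl])
        auto
    then show ?thesis using l0 neg'[OF y(2)] by simp
  qed
  have row_E: "(\<lambda>w. lp_sum q k (\<lambda>j. x j w) powr r) \<in> ?E" if "\<forall>j<k. x j \<in> elts X" for k x
  proof -
    have "(\<lambda>w. lp_sum q k (\<lambda>j. x j w)) \<in> elts X" using that q by (intro X.lp_sum_mem) auto
    from X.power_mem[OF r0(1) this] show ?thesis by (simp add: lp_sum_nonneg)
  qed
  have row_I: "(\<lambda>w. lp_sum p k (\<lambda>j. T (x j) w) powr r) \<in> ?I" if x: "\<forall>j<k. x j \<in> elts X" for k x
  proof -
    have "(\<lambda>w. lp_sum p k (\<lambda>j. T (x j) w)) \<in> elts Y" using x p T_mem by (intro Y.lp_sum_mem) auto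
    then have "(\<lambda>w. lp_sum p k (\<lambda>j. T (x j) w) powr r) \<in> borel_measurable (msr Y)"
      using Y.elts_meas by simp
    moreover have "AE w in msr Y. \<bar>lp_sum p k (\<lambda>j. T (x j) w) powr r\<bar> \<le>
      lp_sum p k (\<lambda>j. T (x j) w) powr r + 0 * e w powr r"
      by simp
    ultimately show ?thesis
      unfolding dominated_def using mixed_pair_single[OF x] order_refl[of "0::real"] by blast
  qed
  have \<mu>_le_l: "\<mu> (\<lambda>w. lp_sum p k (\<lambda>j. T (x j) w) powr r) \<le> l (\<lambda>w. lp_sum q k (\<lambda>j. x j w) powr r)"
    if x: "\<forall>j<k. x j \<in> elts X" for k x
  proof -
    have "l (\<lambda>w. - (lp_sum q k (\<lambda>j. x j w) powr r)) + \<mu> (\<lambda>w. lp_sum p k (\<lambda>j. T (x j) w) powr r) \<le> 0"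
      by (intro upper E_neg row_E row_I x CI[OF X.convex_cover_zero mixed_pair_single[OF x]
        Y.concave_pack_zero order_refl]) auto
    then show ?thesis using neg[OF row_E[OF x]] by simp
  qed
  obtain eX where eX: "weak_unit (msr X) (elts X) eX" using X.ex_weak_unit by blast
  interpret MX: sigma_finite_measure "msr X" by (rule X.sigma_finite)
  interpret MY: sigma_finite_measure "msr Y" by (rule Y.sigma_finite)
  interpret l: positive_functional "msr X" ?E "\<lambda>w. eX w powr r" l
    by unfold_locales (use E_ideal X.power_weak_unit[OF r0(1) eX] lin_l l_pos in auto)
  interpret \<mu>: positive_functional "msr Y" ?I "\<lambda>w. e w powr r" \<mu>
    by unfold_locales (use I_ideal dominated_unit[OF e] lin_\<mu> \<mu>_pos in auto)
  obtain f where f: "f \<in> borel_measurable (msr X)" "\<And>w. 0 \<le> f w"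
    and fl: "\<And>v. v \<in> ?E \<Longrightarrow> AE w in msr X. 0 \<le> v w \<Longrightarrow>
      has_bochner_integral (msr X) (\<lambda>w. v w * f w) (l v)"
  proof (rule l.representation)
    fix v G and \<epsilon> :: real
    assume v: "v \<in> ?E" "AE w in msr X. 0 \<le> v w"
      and G: "range G \<subseteq> sets (msr X)" "incseq G" "(\<Union>k::nat. G k) = space (msr X)" and \<epsilon>: "\<epsilon> > 0"
    define z where "z = (\<lambda>w. \<bar>v w\<bar> powr (1 / r))"
    have z: "z \<in> elts X" using v(1) unfolding z_def X.power_ideal_def by auto
    \<comment> \<open>Chosen so that the tail contributes at most
      \<open>K1 * \<delta>^r \<le> \<epsilon>\<close>; the summand 1 covers
      \<open>K1 = 0\<close>.\<close>
    define \<delta> where "\<delta> = (\<epsilon> / (K1 + 1)) powr (1 / r)"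
    have \<delta>: "\<delta> > 0" "K1 * \<delta> powr r \<le> \<epsilon>"
      using \<epsilon> K12 unfolding \<delta>_def by (auto simp: powr_inverse_cancel[OF r0(1)] field_simps)
    obtain k where k: "nrm X (\<lambda>w. z w - indicator (G k) w * z w) < \<delta>"
      using continuous z G \<delta>(1) unfolding section_continuous_def exhausts_def by blast
    have Gk: "G k \<in> sets (msr X)" using G(1) by auto
    have Gv: "(\<lambda>w. indicator (G k) w * v w) \<in> ?E" by (rule l.F_indicator[OF v(1) Gk])
    have zG: "(\<lambda>w. z w - indicator (G k) w * z w) \<in> elts X"
      by (intro X.diff_mem X.indicator_mem z Gk)
    \<comment> \<open>\<open>v\<close> is the \<open>r\<close>-th power of \<open>z\<close>. On
      \<open>G k\<close> the first summand is \<open>v\<close>, off \<open>G k\<close> the second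
      one is, so a small norm of the tail of \<open>z\<close> gives a small value of
      \<open>l\<close>.\<close>
    have "l v \<le> l (\<lambda>w. indicator (G k) w * v w + \<bar>z w - indicator (G k) w * z w\<bar> powr r)"
    proof (rule l.m_mono[OF v(1) l.F_add[OF Gv X.power_mem[OF r0(1) zG]]])
      show "AE w in msr X. v w \<le> indicator (G k) w * v w + \<bar>z w - indicator (G k) w * z w\<bar> powr r"
        using v(2) by eventually_elim (auto simp: z_def powr_inverse_cancel[OF r0(1)] split:
          split_indicator)
    qed
    also have "\<dots> = l (\<lambda>w. indicator (G k) w * v w) + l (\<lambda>w. \<bar>z w - indicator (G k) w * z w\<bar> powr r)"
      by (rule l.m_add[OF Gv X.power_mem[OF r0(1) zG]])
    also have "l (\<lambda>w. \<bar>z w - indicator (G k) w * z w\<bar> powr r) \<le> K1 * \<delta> powr r"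
      using k X.norm_nonneg[OF zG] K12 r0
      by (intro order_trans[OF l_le[OF zG]] mult_left_mono powr_mono2) auto
    finally show "\<exists>k. l v \<le> l (\<lambda>w. indicator (G k) w * v w) + \<epsilon>" using \<delta>(2)
      by (intro exI[of _ k]) linarith
  qed blast
  obtain d where d: "d \<in> borel_measurable (msr Y)" "\<And>w. 0 \<le> d w" "\<And>w. e w powr r = 0 \<Longrightarrow> d w = 0"
    and d_le: "\<And>v. v \<in> ?I \<Longrightarrow> AE w in msr Y. 0 \<le> v w \<Longrightarrow>
      (\<integral>\<^sup>+w. ennreal (v w * d w) \<partial>msr Y) \<le> ennreal (\<mu> v)"
    and d_ge: "\<And>v \<epsilon>. v \<in> ?I \<Longrightarrow> AE w in msr Y. 0 \<le> v w \<Longrightarrow> \<epsilon> > 0 \<Longrightarrow>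
       \<exists>G. range G \<subseteq> sets (msr Y) \<and> incseq G \<and> (\<Union>k. G k) = space (msr Y) \<and>
         (\<forall>k::nat. ennreal (\<mu> (\<lambda>w. indicator (G k) w * v w)) \<le> (\<integral>\<^sup>+w. ennreal (v w * d w) \<partial>msr Y)
           + ennreal \<epsilon>)"
    using \<mu>.normal_part by blast
  have norm_le: "ennreal (nrm Y y powr r) \<le> (\<integral>\<^sup>+w. ennreal (\<bar>y w\<bar> powr r * d w) \<partial>msr Y)"
    if y: "y \<in> elts Y" and yI: "(\<lambda>w. \<bar>y w\<bar> powr r) \<in> ?I" for y
  proof -
    let ?J = "\<integral>\<^sup>+w. ennreal (\<bar>y w\<bar> powr r * d w) \<partial>msr Y"
    have "?J \<le> ennreal (\<mu> (\<lambda>w. \<bar>y w\<bar> powr r))" by (rule d_le[OF yI]) simp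
    then have "?J < \<infinity>" by (rule le_less_trans) simp
    then obtain J where J: "?J = ennreal J" "0 \<le> J" by (cases ?J) auto
    have "nrm Y y powr r \<le> J"
    proof (rule field_le_epsilon)
      fix \<epsilon> :: real assume \<epsilon>: "\<epsilon> > 0"
      \<comment> \<open>The sets are fixed by \<open>y\<close> and \<open>\<epsilon>\<close>, and
        their bound holds for all \<open>k\<close>. Hence \<open>k\<close> may be chosen afterwards,
        by norm continuity of \<open>Y\<close>, so that truncating \<open>y\<close> costs less than
        \<open>\<delta>\<close>.\<close>
      obtain G where G: "range G \<subseteq> sets (msr Y)" "incseq G" "(\<Union>k::nat. G k) = space (msr Y)"
        "\<And>k. ennreal (\<mu> (\<lambda>w. indicator (G k) w * \<bar>y w\<bar> powr r)) \<le> ?J + ennreal \<epsilon>"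
        using d_ge[OF yI _ \<epsilon>] by auto
      have "nrm Y y \<le> (J + \<epsilon>) powr (1 / r)"
      proof (rule field_le_epsilon)
        fix \<delta> :: real assume "\<delta> > 0"
        then obtain k where k: "nrm Y (\<lambda>w. y w - indicator (G k) w * y w) < \<delta>"
          using Y.r_concave_section_continuous[OF r concave] y G(1-3)
          unfolding section_continuous_def exhausts_def by blast
        let ?y = "\<lambda>w. indicator (G k) w * y w"
        have Gk: "G k \<in> sets (msr Y)" using G(1) by auto
        have yk: "?y \<in> elts Y" by (rule Y.indicator_mem[OF y Gk])
        have eq: "(\<lambda>w. \<bar>?y w\<bar> powr r) = (\<lambda>w. indicator (G k) w * \<bar>y w\<bar> powr r)"
          by (auto split: split_indicator)
        have "nrm Y ?y powr r \<le> \<mu> (\<lambda>w. indicator (G k) w * \<bar>y w\<bar> powr r)"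
          using \<mu>_ge[OF yk] \<mu>.F_indicator[OF yI Gk] unfolding eq by blast
        then have "ennreal (nrm Y ?y powr r) \<le> ?J + ennreal \<epsilon>"
          using G(4)[of k] by (meson ennreal_leI order_trans)
        also have "\<dots> = ennreal (J + \<epsilon>)" using J \<epsilon> by simp
        finally have "nrm Y ?y powr r \<le> J + \<epsilon>" using J \<epsilon> by (subst (asm) ennreal_le_iff) auto
        also have "\<dots> = ((J + \<epsilon>) powr (1 / r)) powr r" using J \<epsilon> r0
          by (simp add: powr_inverse_cancel)
        finally have "nrm Y ?y \<le> (J + \<epsilon>) powr (1 / r)"
          by (rule powr_le_imp_le) (use Y.norm_nonneg[OF yk] r0 in auto)
        moreover have "nrm Y y \<le> nrm Y ?y + nrm Y (\<lambda>w. y w - ?y w)"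
          using Y.norm_triangle[OF yk Y.diff_mem[OF y yk]] by simp
        ultimately show "nrm Y y \<le> (J + \<epsilon>) powr (1 / r) + \<delta>" using k by linarith
      qed
      then have "nrm Y y powr r \<le> ((J + \<epsilon>) powr (1 / r)) powr r"
        using r0 Y.norm_nonneg[OF y] by (intro powr_mono2) auto
      then show "nrm Y y powr r \<le> J + \<epsilon>" using J \<epsilon> r0 by (simp add: powr_inverse_cancel)
    qed
    then show ?thesis unfolding J(1) by (rule ennreal_leI)
  qed
  show ?thesis
  proof (rule that[of f d K1])
    show "d w = 0" if "e w = 0" for w using d(3) that by simp
    fix x assume x: "x \<in> elts X"
    have hb: "has_bochner_integral (msr X) (\<lambda>w. \<bar>x w\<bar> powr r * f w) (l (\<lambda>w. \<bar>x w\<bar> powr r))"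
      by (intro fl X.power_mem r0 x) simp
    then show "integrable (msr X) (\<lambda>w. \<bar>x w\<bar> powr r * f w)" by (simp add: has_bochner_integral_iff)
    show "(\<integral>w. \<bar>x w\<bar> powr r * f w \<partial>msr X) \<le> K1 * nrm X x powr r"
      using hb l_le[OF x] by (simp add: has_bochner_integral_iff)
  next
    fix k and x :: "nat \<Rightarrow> 'a \<Rightarrow> real" assume x: "\<forall>j<k. x j \<in> elts X"
    have "(\<integral>\<^sup>+w. ennreal (lp_sum p k (\<lambda>j. T (x j) w) powr r * d w) \<partial>msr Y) \<le>
        ennreal (\<mu> (\<lambda>w. lp_sum p k (\<lambda>j. T (x j) w) powr r))" by (rule d_le[OF row_I[OF x]]) simp
    also have "\<dots> \<le> ennreal (l (\<lambda>w. lp_sum q k (\<lambda>j. x j w) powr r))"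
      by (rule ennreal_leI[OF \<mu>_le_l[OF x]])
    also have "l (\<lambda>w. lp_sum q k (\<lambda>j. x j w) powr r) =
      (\<integral>w. lp_sum q k (\<lambda>j. x j w) powr r * f w \<partial>msr X)"
      by (rule has_bochner_integral_integral_eq[symmetric], rule fl[OF row_E[OF x]]) simp
    finally show "(\<integral>\<^sup>+w. ennreal (lp_sum p k (\<lambda>j. T (x j) w) powr r * d w) \<partial>msr Y) \<le>
        ennreal (\<integral>w. lp_sum q k (\<lambda>j. x j w) powr r * f w \<partial>msr X)" .
  next
    fix y c assume y: "y \<in> elts Y" "AE w in msr Y. \<bar>y w\<bar> \<le> c * e w"
    have "(\<lambda>w. \<bar>y w\<bar> powr r) \<in> ?I"
    proof (rule \<mu>.F_ideal[OF \<mu>.F_scale[OF \<mu>.e_F, of "\<bar>c\<bar> powr r"]])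
      show "(\<lambda>w. \<bar>y w\<bar> powr r) \<in> borel_measurable (msr Y)" using Y.elts_meas[OF y(1)] by simp
      show "AE w in msr Y. \<bar>\<bar>y w\<bar> powr r\<bar> \<le> \<bar>\<bar>c\<bar> powr r * e w powr r\<bar>"
        using y(2)
      proof eventually_elim
        case (elim w)
        have "\<bar>y w\<bar> \<le> \<bar>c\<bar> * e w" using elim e'(2)[of w] mult_right_mono[of c "\<bar>c\<bar>" "e w"]
          by linarith
        then have "\<bar>y w\<bar> powr r \<le> (\<bar>c\<bar> * e w) powr r" using r0 by (intro powr_mono2) auto
        then show ?case using e'(2)[of w] by (simp add: powr_mult)
      qed
    qed
    then show "ennreal (nrm Y y powr r) \<le> (\<integral>\<^sup>+w. ennreal (\<bar>y w\<bar> powr r * d w) \<partial>msr Y)"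
      by (rule norm_le[OF y(1)])
  qed (use f d in auto)
qed

end

section \<open>The factorization\<close>

lemma lp_sum_single:
  assumes "0 < p"
  shows "lp_sum p 1 a = \<bar>a 0\<bar>"
  using assms
  by (cases rule: exponent_cases) (simp_all add: lp_sum_top_Suc lp_sum_ennreal powr_powr)

text \<open>Fatou's lemma. It replaces convergence of integrals for the limits on the
  \<open>Y\<close> side, where no dominating function is at hand.\<close>

lemma nn_integral_AE_limit_le:
  fixes F :: "nat \<Rightarrow> 'c \<Rightarrow> real" and G :: "'c \<Rightarrow> real"
  assumes F: "\<And>k. F k \<in> borel_measurable M"
    and lim: "AE w in M. (\<lambda>k. F k w) \<longlonglongrightarrow> G w"
    and le: "\<And>k. (\<integral>\<^sup>+w. ennreal (F k w) \<partial>M) \<le> C k" and C: "C \<longlonglongrightarrow> c"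
  shows "(\<integral>\<^sup>+w. ennreal (G w) \<partial>M) \<le> c"
proof -
  have "(\<integral>\<^sup>+w. ennreal (G w) \<partial>M) = (\<integral>\<^sup>+w. liminf (\<lambda>k. ennreal (F k w)) \<partial>M)"
    using lim
  proof (intro nn_integral_cong_AE, eventually_elim)
    case (elim w)
    have "(\<lambda>k. ennreal (F k w)) \<longlonglongrightarrow> ennreal (G w)" using elim by (intro tendsto_ennrealI)
    then show ?case by (simp add: lim_imp_Liminf)
  qed
  also have "\<dots> \<le> liminf (\<lambda>k. \<integral>\<^sup>+w. ennreal (F k w) \<partial>M)"
    using F by (intro nn_integral_liminf) auto
  also have "\<dots> \<le> liminf C" by (intro Liminf_mono always_eventually allI le)
  also have "\<dots> = c" using C by (intro lim_imp_Liminf) auto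
  finally show ?thesis .
qed

text \<open>The rate is tuned to the weight \<open>\<rho> = 2^r\<close>: multiplied by
  \<open>\<rho>^k\<close> the integrals are at most \<open>2^(-k)\<close>, so the weighted series is
  finite a.e. by a bound \<open>B\<close>, and the increments are at most
  \<open>B^(1/r) 2^(-k)\<close>.\<close>

lemma fast_Cauchy_convergent_AE:
  fixes u :: "nat \<Rightarrow> 'c \<Rightarrow> real"
  assumes r: "0 < r" and u: "\<And>k. u k \<in> borel_measurable M"
    and le: "\<And>k. (\<integral>\<^sup>+w. ennreal (\<bar>u (Suc k) w - u k w\<bar> powr r) \<partial>M) \<le>
      ennreal ((1 / (2 * 2 powr r)) ^ k)"
  shows "AE w in M. convergent (\<lambda>k. u k w)"
proof -
  define \<rho> where "\<rho> = (2::real) powr r"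
  have \<rho>: "\<rho> > 0" by (simp add: \<rho>_def)
  let ?\<Delta> = "\<lambda>k w. \<bar>u (Suc k) w - u k w\<bar> powr r"
  have "(\<integral>\<^sup>+w. (\<Sum>k. ennreal (\<rho> ^ k * ?\<Delta> k w)) \<partial>M) = (\<Sum>k. \<integral>\<^sup>+w. ennreal (\<rho> ^ k * ?\<Delta> k w) \<partial>M)"
    using u by (intro nn_integral_suminf) measurable
  also have "\<dots> \<le> (\<Sum>k. ennreal ((1 / 2) ^ k))"
  proof (intro suminf_le allI)
    fix k
    have "(\<integral>\<^sup>+w. ennreal (\<rho> ^ k * ?\<Delta> k w) \<partial>M) = ennreal (\<rho> ^ k) * (\<integral>\<^sup>+w. ennreal (?\<Delta> k w) \<partial>M)"
      using u \<rho> by (subst nn_integral_cmult[symmetric]) (auto simp: ennreal_mult)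
    also have "\<dots> \<le> ennreal (\<rho> ^ k) * ennreal ((1 / (2 * \<rho>)) ^ k)"
      using le[of k] unfolding \<rho>_def by (intro mult_left_mono) auto
    also have "\<dots> = ennreal ((1 / 2) ^ k)"
      using \<rho> by (subst ennreal_mult[symmetric]) (auto simp flip: power_mult_distrib)
    finally show "(\<integral>\<^sup>+w. ennreal (\<rho> ^ k * ?\<Delta> k w) \<partial>M) \<le> ennreal ((1 / 2) ^ k)" .
  qed auto
  also have "\<dots> = ennreal (\<Sum>k. (1 / 2) ^ k)"
    by (intro suminf_ennreal2) (auto intro: summable_geometric)
  finally have "(\<integral>\<^sup>+w. (\<Sum>k. ennreal (\<rho> ^ k * ?\<Delta> k w)) \<partial>M) \<noteq> \<infinity>"
    by (auto simp: top_unique)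
  then have "AE w in M. (\<Sum>k. ennreal (\<rho> ^ k * ?\<Delta> k w)) \<noteq> \<infinity>"
    using u by (intro nn_integral_PInf_AE) measurable
  then show ?thesis
  proof eventually_elim
    case (elim w)
    then obtain B where B: "0 \<le> B" "(\<Sum>k. ennreal (\<rho> ^ k * ?\<Delta> k w)) = ennreal B"
      by (cases "\<Sum>k. ennreal (\<rho> ^ k * ?\<Delta> k w)") auto
    have step: "\<bar>u (Suc k) w - u k w\<bar> \<le> B powr (1 / r) * (1 / 2) ^ k" for k
    proof -
      have "ennreal (\<rho> ^ k * ?\<Delta> k w) \<le> ennreal B"
        unfolding B(2)[symmetric] using sum_le_suminf[of "\<lambda>k. ennreal (\<rho> ^ k * ?\<Delta> k w)" "{k}"]
          by simp
      then have "\<rho> ^ k * ?\<Delta> k w \<le> B" using B(1) by (subst (asm) ennreal_le_iff) auto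
      moreover have "\<rho> ^ k = (2 ^ k) powr r"
      proof -
        have "(2 ^ k :: real) powr r = (2 powr real k) powr r" by (simp add: powr_realpow)
        also have "\<dots> = (2 powr r) powr real k" by (simp only: powr_powr mult.commute)
        also have "\<dots> = \<rho> ^ k" unfolding \<rho>_def by (simp add: powr_realpow)
        finally show ?thesis by simp
      qed
      ultimately have "(2 ^ k * \<bar>u (Suc k) w - u k w\<bar>) powr r \<le> (B powr (1 / r)) powr r"
        using B(1) r by (simp add: powr_mult powr_inverse_cancel)
      then have "2 ^ k * \<bar>u (Suc k) w - u k w\<bar> \<le> B powr (1 / r)"
        by (rule powr_le_imp_le) (use r in auto)
      then show ?thesis by (simp add: field_simps power_divide)
    qed
    have "summable (\<lambda>k. B powr (1 / r) * (1 / 2 :: real) ^ k)"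
      by (intro summable_mult summable_geometric) simp
    then have "summable (\<lambda>k. u (Suc k) w - u k w)"
    proof (rule summable_comparison_test')
      show "norm (u (Suc k) w - u k w) \<le> B powr (1 / r) * (1 / 2) ^ k" for k
        using step[of k] by simp
    qed
    then have "convergent (\<lambda>n. \<Sum>k<n. u (Suc k) w - u k w)" by (simp add: summable_iff_convergent)
    then have "convergent (\<lambda>n. u n w - u 0 w)"
      by (simp only: sum_lessThan_telescope[of "\<lambda>k. u k w"])
    then have "convergent (\<lambda>n. (u n w - u 0 w) + u 0 w)" by (intro convergent_add convergent_const)
    then show ?case by simp
  qed
qed

text \<open>\<open>\<phi>\<close> and \<open>d\<close> stand for \<open>f^r\<close> and, where it is
  nonzero, \<open>g^(-r)\<close>.\<close>

locale weighted_operator = mixed_bounded_operator +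
  fixes \<phi> :: "'a \<Rightarrow> real" and d :: "'b \<Rightarrow> real" and C :: real and eX :: "'a \<Rightarrow> real"
    and e :: "'b \<Rightarrow> real"
  assumes eX: "weak_unit (msr X) (elts X) eX" and e: "weak_unit (msr Y) (elts Y) e"
    and \<phi>_meas: "\<phi> \<in> borel_measurable (msr X)" and \<phi>_nonneg: "\<And>w. 0 \<le> \<phi> w"
    and d_meas: "d \<in> borel_measurable (msr Y)" and d_nonneg: "\<And>w. 0 \<le> d w"
    and d_support: "\<And>w. e w = 0 \<Longrightarrow> d w = 0"
    and \<phi>_integrable: "\<And>x. x \<in> elts X \<Longrightarrow> integrable (msr X) (\<lambda>w. \<bar>x w\<bar> powr r * \<phi> w)"
    and \<phi>_le: "\<And>x. x \<in> elts X \<Longrightarrow> (\<integral>w. \<bar>x w\<bar> powr r * \<phi> w \<partial>msr X) \<le> C * nrm X x powr r"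
    and weighted: "\<And>k x. \<forall>j<k. x j \<in> elts X \<Longrightarrow>
       (\<integral>\<^sup>+w. ennreal (lp_sum p k (\<lambda>j. T (x j) w) powr r * d w) \<partial>msr Y) \<le>
       ennreal (\<integral>w. lp_sum q k (\<lambda>j. x j w) powr r * \<phi> w \<partial>msr X)"
    and d_ge: "\<And>y c. y \<in> elts Y \<Longrightarrow> AE w in msr Y. \<bar>y w\<bar> \<le> c * e w \<Longrightarrow>
       ennreal (nrm Y y powr r) \<le> (\<integral>\<^sup>+w. ennreal (\<bar>y w\<bar> powr r * d w) \<partial>msr Y)"
begin

abbreviation "LX \<equiv> Lr_space r (msr X)"
abbreviation "LY \<equiv> Lr_space r (msr Y)"

definition f :: "'a \<Rightarrow> real" where "f w = \<phi> w powr (1 / r)"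
text \<open>Where \<open>d\<close> vanishes the weighted operator \<open>U\<close> carries no
  information; the value 0 is right because \<open>T x\<close> vanishes a.e. there too.\<close>

definition g :: "'b \<Rightarrow> real" where "g w = (if d w = 0 then 0 else inverse (d w powr (1 / r)))"
definition U :: "('a \<Rightarrow> real) \<Rightarrow> 'b \<Rightarrow> real" where "U x w = T x w * d w powr (1 / r)"

lemma f_meas [measurable]: "f \<in> borel_measurable (msr X)"
  unfolding f_def using \<phi>_meas by measurable

lemma g_meas [measurable]: "g \<in> borel_measurable (msr Y)"
  unfolding g_def using d_meas by measurable

lemma f_nonneg: "0 \<le> f w" by (simp add: f_def)

lemma e_mem: "e \<in> elts Y" and e_nonneg: "0 \<le> e w"
  and e_zero: "y \<in> elts Y \<Longrightarrow> AE w in msr Y. e w = 0 \<longrightarrow> y w = 0"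
  and eX_mem: "eX \<in> elts X" and eX_nonneg: "0 \<le> eX v"
    and eX_zero: "x \<in> elts X \<Longrightarrow> AE w in msr X. eX w = 0 \<longrightarrow> x w = 0"
  using e eX unfolding weak_unit_def by auto

section \<open>The two multiplication operators and the weighted operator \<open>U\<close>\<close>

lemma f_powr: "\<bar>a * f w\<bar> powr r = \<bar>a\<bar> powr r * \<phi> w"
  by (simp add: f_def abs_mult powr_mult powr_inverse_cancel[OF r0(1) \<phi>_nonneg])

lemma mult_f_mem: "x \<in> elts X \<Longrightarrow> mult_op f x \<in> elts LX"
  using \<phi>_integrable[of x] X.elts_meas[of x] f_powr[of "x _"]
  by (simp add: mult_op_def mult.commute[of "f _"])

lemma mult_f_bounded: "bounded_operator X LX (mult_op f)"
proof -
  have "nrm LX (mult_op f x) \<le> \<bar>C\<bar> powr (1 / r) * nrm X x" if x: "x \<in> elts X" for x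
  proof -
    have "(\<integral>w. \<bar>mult_op f x w\<bar> powr r \<partial>msr X) = (\<integral>w. \<bar>x w\<bar> powr r * \<phi> w \<partial>msr X)"
      using f_powr by (simp add: mult_op_def mult.commute[of "f _"])
    also have "\<dots> \<le> C * nrm X x powr r" by (rule \<phi>_le[OF x])
    also have "\<dots> \<le> \<bar>C\<bar> * nrm X x powr r" by (intro mult_right_mono) auto
    finally have "nrm LX (mult_op f x) \<le> (\<bar>C\<bar> * nrm X x powr r) powr (1 / r)"
      using r0 by (auto intro!: powr_mono2)
    also have "\<dots> = \<bar>C\<bar> powr (1 / r) * nrm X x"
      using X.norm_nonneg[OF x] by (simp add: powr_mult powr_cancel_inverse[OF r0(1)])
    finally show ?thesis .
  qed
  then have "\<exists>C. \<forall>x\<in>elts X. nrm LX (mult_op f x) \<le> C * nrm X x" by blast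
  moreover have "\<forall>x\<in>elts X. mult_op f x \<in> elts LX" using mult_f_mem by blast
  ultimately show ?thesis
    unfolding bounded_operator_def linear_map_def by (simp add: mult_op_def algebra_simps)
qed

text \<open>The lower bound is tested on \<open>e\<close> restricted to the zero set of
  \<open>d\<close>: the integral is 0, so this restriction has norm 0.\<close>

lemma d_positive: "AE w in msr Y. e w \<noteq> 0 \<longrightarrow> d w \<noteq> 0"
proof -
  let ?A = "{w \<in> space (msr Y). d w = 0}"
  have A: "?A \<in> sets (msr Y)" using d_meas by measurable
  let ?y = "\<lambda>w. indicator ?A w * e w"
  have y: "?y \<in> elts Y" by (rule Y.indicator_mem[OF e_mem A])
  have "ennreal (nrm Y ?y powr r) \<le> (\<integral>\<^sup>+w. ennreal (\<bar>?y w\<bar> powr r * d w) \<partial>msr Y)"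
    by (rule d_ge[OF y, of 1]) (auto simp: e_nonneg split: split_indicator)
  also have "\<dots> = (\<integral>\<^sup>+w. 0 \<partial>msr Y)"
    by (intro nn_integral_cong) (auto split: split_indicator)
  finally have "nrm Y ?y = 0" by (simp add: ennreal_eq_0_iff)
  then have "AE w in msr Y. ?y w = 0" using Y.norm_zero_iff[OF y] by simp
  then show ?thesis using AE_space by eventually_elim (auto split: split_indicator_asm)
qed

lemma g_powr_le: "\<bar>g w * h\<bar> powr r * d w \<le> \<bar>h\<bar> powr r"
proof (cases "d w = 0")
  case False
  then have "\<bar>g w\<bar> powr r * d w = 1"
    using d_nonneg[of w] r0 by (simp add: g_def powr_divide powr_inverse_cancel inverse_eq_divide)
  then have "\<bar>g w * h\<bar> powr r * d w = \<bar>h\<bar> powr r"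
    by (metis abs_mult mult.assoc mult.commute mult.right_neutral powr_mult abs_ge_zero)
  then show ?thesis by simp
qed simp

text \<open>That \<open>g h\<close> belongs to \<open>Y\<close> is part of the claim. Its
  truncations at multiples of \<open>e\<close> lie in \<open>Y\<close> and within reach of
  \<open>d_ge\<close>, with norms bounded by that of \<open>h\<close>; the monotone convergence
  property of the \<open>r\<close>-concave space then delivers both membership and bound.\<close>

lemma mult_g:
  assumes h: "h \<in> elts LY"
  shows "mult_op g h \<in> elts Y" "nrm Y (mult_op g h) \<le> nrm LY h"
proof -
  have [measurable]: "h \<in> borel_measurable (msr Y)" "e \<in> borel_measurable (msr Y)"
    using h Y.elts_meas[OF e_mem] by auto
  define s where "s k = (\<lambda>w. min \<bar>g w * h w\<bar> (real k * e w))" for k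
  have s_bound: "0 \<le> s k w" "s k w \<le> real k * e w" "s k w \<le> \<bar>g w * h w\<bar>" for k w
    using e_nonneg by (auto simp: s_def)
  have s: "s k \<in> elts Y" for k
  proof (rule Y.ideal_mem[OF Y.scale_mem[OF e_mem, of "real k"]])
    show "s k \<in> borel_measurable (msr Y)" unfolding s_def by measurable
    show "AE w in msr Y. \<bar>s k w\<bar> \<le> \<bar>real k * e w\<bar>"
      using s_bound e_nonneg by auto
  qed
  have sn: "nrm Y (s k) \<le> nrm LY h" for k
  proof -
    have "ennreal (nrm Y (s k) powr r) \<le> (\<integral>\<^sup>+w. ennreal (\<bar>s k w\<bar> powr r * d w) \<partial>msr Y)"
      by (rule d_ge[OF s, of _ "real k"]) (use s_bound in auto)
    also have "\<dots> \<le> (\<integral>\<^sup>+w. ennreal (\<bar>h w\<bar> powr r) \<partial>msr Y)"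
    proof (intro nn_integral_mono ennreal_leI)
      fix w
      have "\<bar>s k w\<bar> powr r * d w \<le> \<bar>g w * h w\<bar> powr r * d w"
        using s_bound[of k w] r0 d_nonneg by (intro mult_right_mono powr_mono2) auto
      then show "\<bar>s k w\<bar> powr r * d w \<le> \<bar>h w\<bar> powr r" using g_powr_le[of w "h w"] by linarith
    qed
    also have "\<dots> = ennreal (\<integral>w. \<bar>h w\<bar> powr r \<partial>msr Y)"
      using h by (intro nn_integral_eq_integral) auto
    finally have "nrm Y (s k) powr r \<le> (\<integral>w. \<bar>h w\<bar> powr r \<partial>msr Y)"
      by (subst (asm) ennreal_le_iff) auto
    also have "\<dots> = nrm LY h powr r" by (rule Lr_norm_powr[OF r0(1), symmetric])
    finally show ?thesis by (rule powr_le_imp_le) (use Y.norm_nonneg[OF s] r0 in auto)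
  qed
  obtain z where z: "z \<in> elts Y" "nrm Y z \<le> nrm LY h" "AE w in msr Y. (\<lambda>k. s k w) \<longlonglongrightarrow> z w"
  proof (rule Y.monotone_limit[OF r concave s])
    show "AE w in msr Y. s k w \<le> s (Suc k) w" for k
    proof (rule AE_I2)
      fix w
      have "real k * e w \<le> real (Suc k) * e w" using e_nonneg[of w] by (intro mult_right_mono) auto
      then show "s k w \<le> s (Suc k) w" unfolding s_def by (intro min.mono) auto
    qed
  qed (use s_bound sn in auto)
  have zg: "AE w in msr Y. z w = \<bar>mult_op g h w\<bar>"
    using z(3)
  proof eventually_elim
    case (elim w)
    have "(\<lambda>k. s k w) \<longlonglongrightarrow> \<bar>g w * h w\<bar>"
    proof (cases "e w = 0")
      case True
      \<comment> \<open>All truncations are 0 where \<open>e\<close> is, so \<open>g h\<close> must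
        vanish there as well; \<open>d_support\<close> provides this.\<close>
      then have "g w = 0" using d_support by (simp add: g_def)
      then show ?thesis using True by (simp add: s_def)
    next
      case False
      then have ew: "e w > 0" using e_nonneg[of w] by simp
      obtain n where n: "\<bar>g w * h w\<bar> < real n * e w" using reals_Archimedean3[OF ew] by blast
      have "s k w = \<bar>g w * h w\<bar>" if "k \<ge> n" for k
      proof -
        have "real n * e w \<le> real k * e w" using that ew by simp
        then show ?thesis using n unfolding s_def by simp
      qed
      then show ?thesis by (intro tendsto_eventually) (auto simp: eventually_sequentially)
    qed
    then show ?case using elim LIMSEQ_unique unfolding mult_op_def by blast
  qed
  have [measurable]: "mult_op g h \<in> borel_measurable (msr Y)" unfolding mult_op_def by measurable
  show gm: "mult_op g h \<in> elts Y"
    by (rule Y.ideal_mem[OF z(1)]) (use zg in \<open>auto elim: eventually_mono\<close>)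
  have "nrm Y (mult_op g h) = nrm Y z"
    by (rule Y.norm_cong[OF gm z(1)]) (use zg in \<open>auto elim: eventually_mono\<close>)
  then show "nrm Y (mult_op g h) \<le> nrm LY h" using z(2) by simp
qed

lemma mult_g_bounded: "bounded_operator LY Y (mult_op g)"
proof -
  have "\<exists>C. \<forall>h\<in>elts LY. nrm Y (mult_op g h) \<le> C * nrm LY h"
    using mult_g(2) by (intro exI[of _ 1]) (simp del: Lr_space_simps)
  moreover have "\<forall>h\<in>elts LY. mult_op g h \<in> elts Y" using mult_g(1) by blast
  ultimately show ?thesis
    unfolding bounded_operator_def linear_map_def by (simp add: mult_op_def algebra_simps)
qed

lemma U_meas: "x \<in> elts X \<Longrightarrow> U x \<in> borel_measurable (msr Y)"
  unfolding U_def using Y.elts_meas[OF T_mem] d_meas by measurable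

lemma U_bound:
  assumes x: "\<forall>j<k. x j \<in> elts X"
  shows "(\<integral>\<^sup>+w. ennreal (lp_sum p k (\<lambda>j. U (x j) w) powr r) \<partial>msr Y) \<le>
       ennreal (\<integral>w. lp_sum q k (\<lambda>j. f w * x j w) powr r \<partial>msr X)"
proof -
  have 1: "lp_sum p k (\<lambda>j. U (x j) w) powr r = lp_sum p k (\<lambda>j. T (x j) w) powr r * d w" for w
    unfolding U_def using lp_sum_scale[OF p, of k "d w powr (1 / r)" "\<lambda>j. T (x j) w"]
    by (simp add: mult.commute powr_mult lp_sum_nonneg powr_inverse_cancel[OF r0(1) d_nonneg])
  have 2: "lp_sum q k (\<lambda>j. f w * x j w) powr r = lp_sum q k (\<lambda>j. x j w) powr r * \<phi> w" for w
    unfolding f_def using lp_sum_scale[OF q, of k "\<phi> w powr (1 / r)" "\<lambda>j. x j w"]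
    by (simp add: mult.commute powr_mult lp_sum_nonneg powr_inverse_cancel[OF r0(1) \<phi>_nonneg])
  show ?thesis unfolding 1 2 by (rule weighted[OF x])
qed

lemma U_bound_single:
  assumes x: "x \<in> elts X"
  shows "(\<integral>\<^sup>+w. ennreal (\<bar>U x w\<bar> powr r) \<partial>msr Y) \<le> ennreal (\<integral>w. \<bar>f w * x w\<bar> powr r \<partial>msr X)"
  using U_bound[of 1 "\<lambda>_. x"] x
    by (simp add: lp_sum_single[OF p, unfolded One_nat_def] lp_sum_single[OF q, unfolded
      One_nat_def])

lemma U_lin:
  assumes x: "x \<in> elts X" "z \<in> elts X"
  shows "AE w in msr Y. U (\<lambda>w. a * x w + b * z w) w = a * U x w + b * U z w"
  using T_add[OF X.scale_mem[OF x(1), of a] X.scale_mem[OF x(2), of b]] T_scale[OF x(1), of a]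
    T_scale[OF x(2), of b]
  by eventually_elim (simp add: U_def algebra_simps)

text \<open>\<open>g\<close> undoes the weight wherever \<open>d\<close> is nonzero. The zero set of
  \<open>d\<close> lies a.e. in that of \<open>e\<close>, where \<open>T x\<close> vanishes.\<close>

lemma g_U:
  assumes x: "x \<in> elts X"
  shows "AE w in msr Y. T x w = g w * U x w"
  using d_positive e_zero[OF T_mem[OF x]]
proof eventually_elim
  case (elim w)
  then show ?case by (cases "d w = 0") (auto simp: g_def U_def)
qed

section \<open>Extension of the weighted operator from the range of \<open>mult_op f\<close> to all
  of \<open>L_r\<close>\<close>

definition \<psi> :: "'a \<Rightarrow> real" where "\<psi> w = (if f w \<noteq> 0 \<and> eX w \<noteq> 0 then 1 else 0)"

text \<open>\<open>mult_op f\<close> maps \<open>X\<close> onto a dense subspace of the functions in $L_r$ that vanish where \<open>\<psi>\<close>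
  does.  An almost everywhere limit \<open>y\<close> of images \<open>U (x k)\<close> plays the role of the value of the
  extension at \<open>h\<close>.\<close>

definition approximates :: "('a \<Rightarrow> real) \<Rightarrow> ('b \<Rightarrow> real) \<Rightarrow> (nat \<Rightarrow> 'a \<Rightarrow> real) \<Rightarrow> bool" where
  "approximates h y x \<longleftrightarrow> y \<in> borel_measurable (msr Y) \<and> (\<forall>k. x k \<in> elts X) \<and>
     (\<forall>k. AE w in msr X. \<bar>f w * x k w\<bar> \<le> \<bar>h w\<bar>) \<and>
     (\<lambda>k. \<integral>w. \<bar>h w * \<psi> w - f w * x k w\<bar> powr r \<partial>msr X) \<longlonglongrightarrow> 0 \<and>
     (AE w in msr Y. (\<lambda>k. U (x k) w) \<longlonglongrightarrow> y w)"

lemma \<psi>_meas [measurable]: "\<psi> \<in> borel_measurable (msr X)"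
proof -
  have [measurable]: "eX \<in> borel_measurable (msr X)" by (rule X.elts_meas[OF eX_mem])
  show ?thesis unfolding \<psi>_def by measurable
qed

lemma mult_f_mem': "x \<in> elts X \<Longrightarrow> (\<lambda>w. f w * x w) \<in> elts LX"
  using mult_f_mem unfolding mult_op_def .

lemmas LX_ideal = Lr_ideal[OF r0(1), of "msr X"]
lemmas LX_add = fun_subspaceD(2)[OF fun_idealD(1)[OF LX_ideal]]
lemmas LX_scale = fun_subspaceD(3)[OF fun_idealD(1)[OF LX_ideal]]

lemma error_mem:
  assumes h: "h \<in> elts LX" and x: "x \<in> elts X"
  shows "(\<lambda>w. h w * \<psi> w - f w * x w) \<in> elts LX"
proof -
  have "(\<lambda>w. h w * \<psi> w) \<in> elts LX"
  proof (rule fun_idealD(3)[OF LX_ideal h])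
    have [measurable]: "h \<in> borel_measurable (msr X)" using h by simp
    show "(\<lambda>w. h w * \<psi> w) \<in> borel_measurable (msr X)" by measurable
  qed (simp add: \<psi>_def)
  from LX_add[OF this LX_scale[OF mult_f_mem'[OF x], of "-1"]] show ?thesis by simp
qed

lemma integrable_LX: "u \<in> elts LX \<Longrightarrow> integrable (msr X) (\<lambda>w. \<bar>u w\<bar> powr r)"
  by simp

lemma integral_powr_add_le:
  assumes u: "u \<in> elts LX" and v: "v \<in> elts LX"
  shows "(\<integral>w. \<bar>u w + v w\<bar> powr r \<partial>msr X) \<le>
    2 powr r * ((\<integral>w. \<bar>u w\<bar> powr r \<partial>msr X) + (\<integral>w. \<bar>v w\<bar> powr r \<partial>msr X))"
proof -
  note iu = integrable_LX[OF u] and iv = integrable_LX[OF v]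
  have "(\<integral>w. \<bar>u w + v w\<bar> powr r \<partial>msr X) \<le> (\<integral>w. 2 powr r * (\<bar>u w\<bar> powr r + \<bar>v w\<bar> powr r) \<partial>msr X)"
  proof (rule integral_mono)
    show "integrable (msr X) (\<lambda>w. \<bar>u w + v w\<bar> powr r)" by (rule integrable_LX[OF LX_add[OF u v]])
    show "integrable (msr X) (\<lambda>w. 2 powr r * (\<bar>u w\<bar> powr r + \<bar>v w\<bar> powr r))" using iu iv by simp
    fix w
    have "\<bar>u w + v w\<bar> powr r \<le> (\<bar>u w\<bar> + \<bar>v w\<bar>) powr r" using r0 by (intro powr_mono2) auto
    also have "\<dots> \<le> 2 powr r * (\<bar>u w\<bar> powr r + \<bar>v w\<bar> powr r)" using r0 by (intro powr_add_le) auto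
    finally show "\<bar>u w + v w\<bar> powr r \<le> 2 powr r * (\<bar>u w\<bar> powr r + \<bar>v w\<bar> powr r)" .
  qed
  also have "\<dots> = 2 powr r * ((\<integral>w. \<bar>u w\<bar> powr r \<partial>msr X) + (\<integral>w. \<bar>v w\<bar> powr r \<partial>msr X))"
    using iu iv by simp
  finally show ?thesis .
qed

lemma integral_powr_scale:
  "(\<integral>w. \<bar>a * u w\<bar> powr r \<partial>msr X) = \<bar>a\<bar> powr r * (\<integral>w. \<bar>u w\<bar> powr r \<partial>msr X)"
  by (simp add: abs_mult powr_mult)

text \<open>The quotient \<open>h / f\<close> is cut off so that it lies below a multiple of
  \<open>eX\<close>. Dominated convergence makes the errors tend to 0, and a fast subsequence makes
  the images under \<open>U\<close> converge a.e.\<close>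

lemma ex_approximates:
  assumes h: "h \<in> elts LX"
  shows "\<exists>y x. approximates h y x"
proof -
  have [measurable]: "h \<in> borel_measurable (msr X)" "eX \<in> borel_measurable (msr X)"
    using h X.elts_meas[OF eX_mem] by auto
  \<comment> \<open>The cut-off is all or nothing, so \<open>f * xc n\<close> is either
    \<open>h\<close> or 0. This gives membership in \<open>X\<close> and the domination by
    \<open>\<bar>h\<bar>\<close> at the same time.\<close>
  define xc where "xc n w = (if f w \<noteq> 0 \<and> eX w \<noteq> 0 \<and>
    \<bar>h w\<bar> \<le> real n * (f w * eX w) then h w / f w else 0)" for n :: nat and w
  have fxc: "f w * xc n w = (if f w \<noteq> 0 \<and> eX w \<noteq> 0 \<and>
    \<bar>h w\<bar> \<le> real n * (f w * eX w) then h w else 0)" for n w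
    by (simp add: xc_def)
  have xc: "xc n \<in> elts X" for n
  proof (rule X.ideal_mem[OF X.scale_mem[OF eX_mem, of "real n"]])
    show "xc n \<in> borel_measurable (msr X)" unfolding xc_def by measurable
    have "\<bar>xc n w\<bar> \<le> \<bar>real n * eX w\<bar>" for w
    proof (cases "f w \<noteq> 0 \<and> eX w \<noteq> 0 \<and> \<bar>h w\<bar> \<le> real n * (f w * eX w)")
      case True
      then have "f w > 0" using f_nonneg[of w] by simp
      then have "\<bar>h w\<bar> / f w \<le> real n * eX w" using True by (simp add: field_simps)
      then show ?thesis using True \<open>f w > 0\<close> eX_nonneg[of w] by (simp add: xc_def)
    qed (auto simp: xc_def)
    then show "AE w in msr X. \<bar>xc n w\<bar> \<le> \<bar>real n * eX w\<bar>" by simp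
  qed
  define a where "a n = (\<integral>w. \<bar>h w * \<psi> w - f w * xc n w\<bar> powr r \<partial>msr X)" for n
  have a0: "0 \<le> a n" for n by (simp add: a_def)
  have "a \<longlonglongrightarrow> (\<integral>w. 0 \<partial>msr X)"
    unfolding a_def
  proof (rule integral_dominated_convergence[where w = "\<lambda>w. \<bar>h w\<bar> powr r"])
    show "integrable (msr X) (\<lambda>w. \<bar>h w\<bar> powr r)" by (rule integrable_LX[OF h])
    show "(\<lambda>w. \<bar>h w * \<psi> w - f w * xc n w\<bar> powr r) \<in> borel_measurable (msr X)" for n
      by (rule borel_measurable_integrable[OF integrable_LX[OF error_mem[OF h xc]]])
    show "AE w in msr X. (\<lambda>n. \<bar>h w * \<psi> w - f w * xc n w\<bar> powr r) \<longlonglongrightarrow> 0"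
    proof (rule AE_I2)
      fix w
      show "(\<lambda>n. \<bar>h w * \<psi> w - f w * xc n w\<bar> powr r) \<longlonglongrightarrow> 0"
      proof (cases "f w \<noteq> 0 \<and> eX w \<noteq> 0")
        case True
        then have "f w * eX w > 0" using f_nonneg[of w] eX_nonneg[of w] by simp
        then obtain N where N: "\<bar>h w\<bar> < real N * (f w * eX w)" using reals_Archimedean3 by blast
        have "\<bar>h w * \<psi> w - f w * xc n w\<bar> powr r = 0" if "n \<ge> N" for n
        proof -
          have "real N * (f w * eX w) \<le> real n * (f w * eX w)"
            using that \<open>f w * eX w > 0\<close> by (intro mult_right_mono) auto
          then show ?thesis using True N by (simp add: fxc \<psi>_def)
        qed
        then show ?thesis by (intro tendsto_eventually) (auto simp: eventually_sequentially)
      qed (auto simp: fxc \<psi>_def)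
    qed
    show "AE w in msr X. norm (\<bar>h w * \<psi> w - f w * xc n w\<bar> powr r) \<le> \<bar>h w\<bar> powr r" for n
      by (rule AE_I2) (auto simp: fxc \<psi>_def)
  qed simp
  then have alim: "a \<longlonglongrightarrow> 0" by simp
  \<comment> \<open>\<open>\<theta>\<close> is the rate of \<open>fast_Cauchy_convergent_AE\<close>.
    Two consecutive errors of size \<open>\<theta> * \<theta>^k\<close> and the loss
    \<open>2^r\<close> of the triangle inequality for \<open>r\<close>-th powers combine to exactly
    \<open>\<theta>^k\<close>.\<close>
  define \<theta> where "\<theta> = 1 / (2 * 2 powr r)"
  have \<theta>: "0 < \<theta>" "\<theta> \<le> 1" "2 powr r * (\<theta> + \<theta>) = 1"
    unfolding \<theta>_def using ge_one_powr_ge_zero[of 2 r] r0 by (auto simp: field_simps)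
  have "\<exists>n\<ge>k. a n \<le> \<theta> * \<theta> ^ k" for k
  proof -
    have "eventually (\<lambda>n. a n < \<theta> * \<theta> ^ k) sequentially"
      using order_tendstoD(2)[OF alim] \<theta>(1) by simp
    then obtain N where "\<And>n. n \<ge> N \<Longrightarrow> a n < \<theta> * \<theta> ^ k" by (auto simp: eventually_sequentially)
    then have "a (max N k) \<le> \<theta> * \<theta> ^ k" by (intro less_imp_le) simp
    then show ?thesis by (intro exI[of _ "max N k"]) simp
  qed
  then obtain n where n: "\<And>k. n k \<ge> k" "\<And>k. a (n k) \<le> \<theta> * \<theta> ^ k" by metis
  define x where "x k = xc (n k)" for k
  have x: "x k \<in> elts X" for k unfolding x_def by (rule xc)
  have step: "(\<integral>\<^sup>+w. ennreal (\<bar>U (x (Suc k)) w - U (x k) w\<bar> powr r) \<partial>msr Y) \<le> ennreal (\<theta> ^ k)" for k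
  proof -
    let ?v = "\<lambda>w. 1 * x (Suc k) w + (-1) * x k w"
    have v: "?v \<in> elts X" by (intro X.add_mem X.scale_mem x)
    have "(\<integral>\<^sup>+w. ennreal (\<bar>U (x (Suc k)) w - U (x k) w\<bar> powr r) \<partial>msr Y) =
      (\<integral>\<^sup>+w. ennreal (\<bar>U ?v w\<bar> powr r) \<partial>msr Y)"
      using U_lin[OF x x, of 1 "Suc k" "-1" k]
        by (intro nn_integral_cong_AE) (auto elim!: eventually_mono)
    also have "\<dots> \<le> ennreal (\<integral>w. \<bar>f w * ?v w\<bar> powr r \<partial>msr X)" by (rule U_bound_single[OF v])
    also have "\<dots> \<le> ennreal (\<theta> ^ k)"
    proof (rule ennreal_leI)
      let ?e = "\<lambda>k w. h w * \<psi> w - f w * x k w"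
      have e: "?e k \<in> elts LX" for k by (rule error_mem[OF h x])
      have "(\<integral>w. \<bar>f w * ?v w\<bar> powr r \<partial>msr X) = (\<integral>w. \<bar>?e k w + (-1) * ?e (Suc k) w\<bar> powr r \<partial>msr X)"
        by (simp add: algebra_simps)
      also have "\<dots> \<le>
        2 powr r * ((\<integral>w. \<bar>?e k w\<bar> powr r \<partial>msr X) + (\<integral>w. \<bar>(-1) * ?e (Suc k) w\<bar> powr r \<partial>msr X))"
        by (rule integral_powr_add_le[OF e LX_scale[OF e]])
      also have "\<dots> = 2 powr r * (a (n k) + a (n (Suc k)))"
        unfolding integral_powr_scale by (simp add: a_def x_def)
      also have "\<dots> \<le> 2 powr r * (\<theta> * \<theta> ^ k + \<theta> * \<theta> ^ k)"
      proof (intro mult_left_mono add_mono n(2))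
        have "a (n (Suc k)) \<le> \<theta> * \<theta> ^ Suc k" by (rule n(2))
        also have "\<dots> \<le> \<theta> * \<theta> ^ k" using \<theta> by (intro mult_left_mono power_decreasing) auto
        finally show "a (n (Suc k)) \<le> \<theta> * \<theta> ^ k" .
      qed simp
      also have "\<dots> = (2 powr r * (\<theta> + \<theta>)) * \<theta> ^ k" by (simp add: algebra_simps)
      also have "\<dots> = \<theta> ^ k" unfolding \<theta>(3) by simp
      finally show "(\<integral>w. \<bar>f w * ?v w\<bar> powr r \<partial>msr X) \<le> \<theta> ^ k" .
    qed
    finally show ?thesis .
  qed
  define y where "y w = lim (\<lambda>k. U (x k) w)" for w
  have "AE w in msr Y. convergent (\<lambda>k. U (x k) w)"
    by (rule fast_Cauchy_convergent_AE[OF r0(1) U_meas[OF x]]) (use step in \<open>simp add: \<theta>_def\<close>)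
  then have ylim: "AE w in msr Y. (\<lambda>k. U (x k) w) \<longlonglongrightarrow> y w"
    unfolding y_def by (simp add: convergent_LIMSEQ_iff)
  have ym: "y \<in> borel_measurable (msr Y)"
    unfolding y_def using U_meas[OF x] by (intro borel_measurable_lim_metric) auto
  have "(\<lambda>k. a (n k)) \<longlonglongrightarrow> 0"
  proof (rule filterlim_compose[OF alim])
    show "filterlim n at_top sequentially"
      by (rule filterlim_at_top_mono[OF filterlim_ident]) (use n(1) in auto)
  qed
  then have "approximates h y x"
    unfolding approximates_def using ym x ylim by (auto simp: a_def x_def fxc)
  then show ?thesis by blast
qed

text \<open>The \<open>Y\<close> side passes to the limit by Fatou. On the \<open>X\<close> side no
  limit is taken: the pointwise domination \<open>|f x_k| \<le> |h|\<close> in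
  \<open>approximates\<close> already bounds each term by the lattice sum of the
  \<open>h i\<close>.\<close>

lemma approximates_regular:
  assumes h: "\<And>i. i < n \<Longrightarrow> h i \<in> elts LX" and ap: "\<And>i. i < n \<Longrightarrow> approximates (h i) (y i) (x i)"
  shows "(\<integral>\<^sup>+w. ennreal (lp_sum p n (\<lambda>i. y i w) powr r) \<partial>msr Y) \<le>
    ennreal (\<integral>w. lp_sum q n (\<lambda>i. h i w) powr r \<partial>msr X)"
proof (rule nn_integral_AE_limit_le[OF _ _ _ tendsto_const])
  have x: "x i k \<in> elts X" if "i < n" for i k using ap[OF that] unfolding approximates_def by blast
  show "(\<lambda>w. lp_sum p n (\<lambda>i. U (x i k) w) powr r) \<in> borel_measurable (msr Y)" for k
  proof -
    have "(\<lambda>w. lp_sum p n (\<lambda>i. U (x i k) w)) \<in> borel_measurable (msr Y)"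
      using U_meas x by (intro lp_sum_measurable) auto
    then show ?thesis by simp
  qed
  have "AE w in msr Y. \<forall>i\<in>{..<n}. (\<lambda>k. U (x i k) w) \<longlonglongrightarrow> y i w"
    using ap unfolding approximates_def by (intro AE_finite_allI) auto
  then show "AE w in msr Y. (\<lambda>k. lp_sum p n (\<lambda>i. U (x i k) w) powr r) \<longlonglongrightarrow> lp_sum p n (\<lambda>i. y i w) powr r"
  proof eventually_elim
    case (elim w)
    have "(\<lambda>k. lp_sum p n (\<lambda>i. U (x i k) w)) \<longlonglongrightarrow> lp_sum p n (\<lambda>i. y i w)"
      using elim by (intro lp_sum_tendsto[OF p]) auto
    then show ?case
      using r0 by (intro tendsto_powr2 tendsto_const) (auto simp: lp_sum_nonneg intro:
        always_eventually)
  qed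
  show "(\<integral>\<^sup>+w. ennreal (lp_sum p n (\<lambda>i. U (x i k) w) powr r) \<partial>msr Y) \<le>
    ennreal (\<integral>w. lp_sum q n (\<lambda>i. h i w) powr r \<partial>msr X)" for k
  proof -
    have "(\<integral>\<^sup>+w. ennreal (lp_sum p n (\<lambda>i. U (x i k) w) powr r) \<partial>msr Y) \<le>
       ennreal (\<integral>w. lp_sum q n (\<lambda>i. f w * x i k w) powr r \<partial>msr X)"
      by (rule U_bound) (use x in auto)
    also have "\<dots> \<le> ennreal (\<integral>w. lp_sum q n (\<lambda>i. h i w) powr r \<partial>msr X)"
    proof (intro ennreal_leI integral_mono_AE)
      have "(\<lambda>w. lp_sum q n (\<lambda>i. f w * x i k w)) \<in> elts LX"
        by (rule fun_ideal_lp_sum[OF LX_ideal q]) (rule mult_f_mem'[OF x])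
      then show "integrable (msr X) (\<lambda>w. lp_sum q n (\<lambda>i. f w * x i k w) powr r)"
        using integrable_LX by (fastforce simp: lp_sum_nonneg simp del: Lr_space_simps)
      have "(\<lambda>w. lp_sum q n (\<lambda>i. h i w)) \<in> elts LX"
        by (rule fun_ideal_lp_sum[OF LX_ideal q]) (rule h)
      then show "integrable (msr X) (\<lambda>w. lp_sum q n (\<lambda>i. h i w) powr r)"
        using integrable_LX by (fastforce simp: lp_sum_nonneg simp del: Lr_space_simps)
      have "AE w in msr X. \<forall>i\<in>{..<n}. \<bar>f w * x i k w\<bar> \<le> \<bar>h i w\<bar>"
        using ap unfolding approximates_def by (intro AE_finite_allI) auto
      then show "AE w in msr X. lp_sum q n (\<lambda>i. f w * x i k w) powr r \<le>
        lp_sum q n (\<lambda>i. h i w) powr r"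
      proof eventually_elim
        case (elim w)
        then have "lp_sum q n (\<lambda>i. f w * x i k w) \<le> lp_sum q n (\<lambda>i. h i w)"
          by (intro lp_sum_mono) auto
        then show ?case using r0 by (intro powr_mono2) (auto simp: lp_sum_nonneg)
      qed
    qed
    finally show ?thesis .
  qed
qed

lemma approximates_mem:
  assumes h: "h \<in> elts LX" and ap: "approximates h y x"
  shows "y \<in> elts LY"
proof -
  have ym: "y \<in> borel_measurable (msr Y)" using ap unfolding approximates_def by blast
  have "(\<integral>\<^sup>+w. ennreal (\<bar>y w\<bar> powr r) \<partial>msr Y) \<le> ennreal (\<integral>w. \<bar>h w\<bar> powr r \<partial>msr X)"
    using approximates_regular[of 1 "\<lambda>_. h" "\<lambda>_. y" "\<lambda>_. x"] h ap
    by (simp add: lp_sum_single[OF p, unfolded One_nat_def] lp_sum_single[OF q, unfolded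
      One_nat_def] del: Lr_space_simps)
  also have "\<dots> < \<infinity>" by simp
  finally have "(\<integral>\<^sup>+w. ennreal (norm (\<bar>y w\<bar> powr r)) \<partial>msr Y) < \<infinity>" by simp
  then have "integrable (msr Y) (\<lambda>w. \<bar>y w\<bar> powr r)" using ym by (intro integrableI_bounded) auto
  then show ?thesis using ym by simp
qed

text \<open>The errors of the three sequences combine, so that \<open>f\<close> times the combined
  sequence \<open>v k\<close> tends to 0 in \<open>L_r\<close>, and the bound for \<open>U\<close>
  forces the combined limit to vanish. With \<open>a = 1\<close> and \<open>b = 0\<close> the lemma
  is uniqueness of the limit function.\<close>

lemma approximates_linear:
  assumes h: "h \<in> elts LX" "approximates h y x" and h': "h' \<in> elts LX" "approximates h' y' x'"
    and ap: "approximates (\<lambda>w. a * h w + b * h' w) y'' x''"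
  shows "AE w in msr Y. y'' w = a * y w + b * y' w"
proof -
  have x: "x k \<in> elts X" "x' k \<in> elts X" "x'' k \<in> elts X" for k
    using h(2) h'(2) ap unfolding approximates_def by auto
  define h'' where "h'' = (\<lambda>w. a * h w + b * h' w)"
  have h'': "h'' \<in> elts LX" unfolding h''_def by (intro LX_add LX_scale h h')
  define E where "E h x k = (\<lambda>w. h w * \<psi> w - f w * x k w)" for h and x :: "nat \<Rightarrow> 'a \<Rightarrow> real" and k
  have Em: "E h x k \<in> elts LX" "E h' x' k \<in> elts LX" "E h'' x'' k \<in> elts LX" for k
    unfolding E_def by (intro error_mem h h' h'' x)+
  have Elim: "(\<lambda>k. \<integral>w. \<bar>E h x k w\<bar> powr r \<partial>msr X) \<longlonglongrightarrow> 0" "(\<lambda>k. \<integral>w. \<bar>E h' x' k w\<bar> powr r \<partial>msr X) \<longlonglongrightarrow> 0"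
    "(\<lambda>k. \<integral>w. \<bar>E h'' x'' k w\<bar> powr r \<partial>msr X) \<longlonglongrightarrow> 0"
    using h(2) h'(2) ap unfolding approximates_def E_def h''_def by auto
  define z where "z k = (\<lambda>w. a * x k w + b * x' k w)" for k
  have z: "z k \<in> elts X" for k unfolding z_def by (intro X.add_mem X.scale_mem x)
  define v where "v k = (\<lambda>w. 1 * z k w + (-1) * x'' k w)" for k
  have v: "v k \<in> elts X" for k unfolding v_def by (intro X.add_mem X.scale_mem x z)
  have Uv: "AE w in msr Y. \<forall>k. U (v k) w = a * U (x k) w + b * U (x' k) w - U (x'' k) w"
  proof (subst AE_all_countable, rule allI)
    fix k
    have "AE w in msr Y. U (v k) w = 1 * U (z k) w + (-1) * U (x'' k) w"
      unfolding v_def by (rule U_lin[OF z x(3)])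
    moreover have "AE w in msr Y. U (z k) w = a * U (x k) w + b * U (x' k) w"
      unfolding z_def by (rule U_lin[OF x(1,2)])
    ultimately show "AE w in msr Y. U (v k) w = a * U (x k) w + b * U (x' k) w - U (x'' k) w"
      by eventually_elim simp
  qed
  \<comment> \<open>The nested factors \<open>2^r\<close> come from splitting the sum of three
    errors in two steps.\<close>
  define c where "c k = 2 powr r * (2 powr r * (\<bar>-a\<bar> powr r * (\<integral>w. \<bar>E h x k w\<bar> powr r \<partial>msr X) +
      \<bar>-b\<bar> powr r * (\<integral>w. \<bar>E h' x' k w\<bar> powr r \<partial>msr X)) + (\<integral>w. \<bar>E h'' x'' k w\<bar> powr r \<partial>msr X))" for k
  have "c \<longlonglongrightarrow> 2 powr r * (2 powr r * (\<bar>-a\<bar> powr r * 0 + \<bar>-b\<bar> powr r * 0) + 0)"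
    unfolding c_def by (intro tendsto_intros Elim)
  then have clim: "(\<lambda>k. ennreal (c k)) \<longlonglongrightarrow> ennreal 0" by (intro tendsto_ennrealI) simp
  have cle: "(\<integral>w. \<bar>f w * v k w\<bar> powr r \<partial>msr X) \<le> c k" for k
  proof -
    have "(\<integral>w. \<bar>f w * v k w\<bar> powr r \<partial>msr X) =
        (\<integral>w. \<bar>((-a) * E h x k w + (-b) * E h' x' k w) + E h'' x'' k w\<bar> powr r \<partial>msr X)"
      by (simp add: v_def z_def E_def h''_def algebra_simps)
    also have "\<dots> \<le> 2 powr r * ((\<integral>w. \<bar>(-a) * E h x k w + (-b) * E h' x' k w\<bar> powr r \<partial>msr X) +
        (\<integral>w. \<bar>E h'' x'' k w\<bar> powr r \<partial>msr X))"
      by (rule integral_powr_add_le[OF LX_add[OF LX_scale[OF Em(1)] LX_scale[OF Em(2)]] Em(3)])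
    also have "\<dots> \<le> c k"
      unfolding c_def integral_powr_scale[symmetric]
      by (intro mult_left_mono add_right_mono integral_powr_add_le LX_scale Em) simp
    finally show ?thesis .
  qed
  have "(\<integral>\<^sup>+w. ennreal (\<bar>a * y w + b * y' w - y'' w\<bar> powr r) \<partial>msr Y) \<le> ennreal 0"
  proof (rule nn_integral_AE_limit_le[OF _ _ _ clim])
    show "(\<lambda>w. \<bar>U (v k) w\<bar> powr r) \<in> borel_measurable (msr Y)" for k using U_meas[OF v, of k]
      by simp
    show "(\<integral>\<^sup>+w. ennreal (\<bar>U (v k) w\<bar> powr r) \<partial>msr Y) \<le> ennreal (c k)" for k
      using U_bound_single[OF v, of k] ennreal_leI[OF cle[of k]] by (rule order_trans)
    have "AE w in msr Y. (\<lambda>k. U (x k) w) \<longlonglongrightarrow> y w" "AE w in msr Y. (\<lambda>k. U (x' k) w) \<longlonglongrightarrow> y' w"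
      "AE w in msr Y. (\<lambda>k. U (x'' k) w) \<longlonglongrightarrow> y'' w"
      using h(2) h'(2) ap unfolding approximates_def by auto
    with Uv show "AE w in msr Y. (\<lambda>k. \<bar>U (v k) w\<bar> powr r) \<longlonglongrightarrow> \<bar>a * y w + b * y' w - y'' w\<bar> powr r"
    proof eventually_elim
      case (elim w)
      have "(\<lambda>k. \<bar>a * U (x k) w + b * U (x' k) w - U (x'' k) w\<bar> powr r) \<longlonglongrightarrow> \<bar>a * y w +
        b * y' w - y'' w\<bar> powr r"
        using r0 by (intro tendsto_powr2 tendsto_const tendsto_rabs tendsto_diff tendsto_add
          tendsto_mult elim(2-4)) auto
      then show ?case using elim(1) by simp
    qed
  qed
  moreover have "y \<in> borel_measurable (msr Y)" "y' \<in> borel_measurable (msr Y)"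
    "y'' \<in> borel_measurable (msr Y)"
    using h(2) h'(2) ap unfolding approximates_def by auto
  ultimately have "AE w in msr Y. ennreal (\<bar>a * y w + b * y' w - y'' w\<bar> powr r) = 0"
    by (subst nn_integral_0_iff_AE[symmetric]) auto
  then show ?thesis by eventually_elim (simp add: ennreal_eq_0_iff)
qed

text \<open>An arbitrary choice for each \<open>h\<close> separately. Uniqueness up to null sets
  turns it into a map that is linear a.e.\<close>

definition regular_extension :: "('a \<Rightarrow> real) \<Rightarrow> 'b \<Rightarrow> real" where
  "regular_extension h = (SOME y. \<exists>x. approximates h y x)"

lemma regular_extension: "h \<in> elts LX \<Longrightarrow> \<exists>x. approximates h (regular_extension h) x"
  unfolding regular_extension_def by (rule someI_ex[OF ex_approximates])

lemma regular_extension_regular: "pq_regular p q LX LY regular_extension"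
proof -
  have "regular_extension h \<in> elts LY" if "h \<in> elts LX" for h
    using approximates_mem[OF that] regular_extension[OF that] by blast
  moreover have "AE w in msr Y. regular_extension (\<lambda>u. h u + h' u) w =
    regular_extension h w + regular_extension h' w"
    if h: "h \<in> elts LX" "h' \<in> elts LX" for h h'
  proof -
    obtain x x' x'' where "approximates h (regular_extension h) x"
      "approximates h' (regular_extension h') x'"
      "approximates (\<lambda>u. h u + h' u) (regular_extension (\<lambda>u. h u + h' u)) x''"
      using regular_extension[OF h(1)] regular_extension[OF h(2)] regular_extension[OF LX_add[OF
        h]] by blast
    then show ?thesis using approximates_linear[OF h(1) _ h(2), of _ _ _ _ 1 1] by simp
  qed
  moreover have "AE w in msr Y. regular_extension (\<lambda>u. a * h u) w = a * regular_extension h w"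
    if h: "h \<in> elts LX" for h a
  proof -
    obtain x x'' where "approximates h (regular_extension h) x"
      "approximates (\<lambda>u. a * h u) (regular_extension (\<lambda>u. a * h u)) x''"
      using regular_extension[OF h] regular_extension[OF LX_scale[OF h]] by blast
    \<comment> \<open>Homogeneity is the case \<open>b = 0\<close>, with \<open>h\<close> filling
      both slots.\<close>
    then show ?thesis using approximates_linear[OF h _ h, of _ _ _ _ a 0] by simp
  qed
  ultimately have lin: "linear_map LX LY regular_extension"
    unfolding linear_map_def Lr_space_simps(1) by blast
  have "nrm LY (\<lambda>w. lp_sum p n (\<lambda>i. regular_extension (h i) w)) \<le>
    1 * nrm LX (\<lambda>w. lp_sum q n (\<lambda>i. h i w))"
    if h: "\<forall>i<n. h i \<in> elts LX" for n h
  proof -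
    define x where "x i = (SOME x. approximates (h i) (regular_extension (h i)) x)" for i
    have x: "approximates (h i) (regular_extension (h i)) (x i)" if "i < n" for i
    proof -
      have "h i \<in> elts LX" using h that by blast
      from regular_extension[OF this] show ?thesis unfolding x_def by (rule someI_ex)
    qed
    have m: "(\<lambda>w. lp_sum p n (\<lambda>i. regular_extension (h i) w)) \<in> elts LY"
      using h x approximates_mem by (intro fun_ideal_lp_sum[OF Lr_ideal[OF r0(1)] p]) blast
    then have i: "integrable (msr Y) (\<lambda>w. lp_sum p n (\<lambda>i. regular_extension (h i) w) powr r)"
      by (simp add: lp_sum_nonneg)
    have "ennreal (\<integral>w. lp_sum p n (\<lambda>i. regular_extension (h i) w) powr r \<partial>msr Y) =
        (\<integral>\<^sup>+w. ennreal (lp_sum p n (\<lambda>i. regular_extension (h i) w) powr r) \<partial>msr Y)"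
      using i by (intro nn_integral_eq_integral[symmetric]) auto
    also have "\<dots> \<le> ennreal (\<integral>w. lp_sum q n (\<lambda>i. h i w) powr r \<partial>msr X)"
      by (rule approximates_regular) (use h x in auto)
    finally have "(\<integral>w. lp_sum p n (\<lambda>i. regular_extension (h i) w) powr r \<partial>msr Y) \<le>
      (\<integral>w. lp_sum q n (\<lambda>i. h i w) powr r \<partial>msr X)"
      by (subst (asm) ennreal_le_iff) auto
    then show ?thesis using r0 by (auto simp: lp_sum_nonneg intro!: powr_mono2)
  qed
  then show ?thesis unfolding pq_regular_def using lin by (intro conjI exI[of _ 1]) auto
qed

text \<open>The constant sequence \<open>x\<close> approximates \<open>mult_op f x\<close>, because
  \<open>f x\<close> vanishes a.e. wherever \<open>\<psi>\<close> does. Uniqueness then identifies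
  the chosen limit with \<open>U x\<close>.\<close>

lemma regular_extension_mult_f:
  assumes x: "x \<in> elts X"
  shows "AE w in msr Y. regular_extension (mult_op f x) w = U x w"
proof -
  have m: "mult_op f x \<in> elts LX" by (rule mult_f_mem[OF x])
  have "AE w in msr X. \<bar>mult_op f x w * \<psi> w - f w * x w\<bar> powr r = 0"
    using eX_zero[OF x] by eventually_elim (auto simp: mult_op_def \<psi>_def)
  then have "(\<integral>w. \<bar>mult_op f x w * \<psi> w - f w * x w\<bar> powr r \<partial>msr X) = 0"
    by (rule integral_eq_zero_AE)
  then have a: "approximates (mult_op f x) (U x) (\<lambda>_. x)"
    unfolding approximates_def using U_meas[OF x] x by (simp add: mult_op_def)
  obtain x' where "approximates (mult_op f x) (regular_extension (mult_op f x)) x'"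
    using regular_extension[OF m] by blast
  then show ?thesis using approximates_linear[OF m a m a, of 1 0 "regular_extension (mult_op f x)"
    x'] by simp
qed

lemma factorization:
  "x \<in> elts X \<Longrightarrow> AE w in msr Y. T x w = mult_op g (regular_extension (mult_op f x)) w"
  using g_U[of x] regular_extension_mult_f[of x]
    by (auto elim!: eventually_rev_mp simp: mult_op_def)

end

section \<open>Equivalence of the three conditions\<close>

theorem theorem4p4:
  fixes X :: "'a fun_space" and Y :: "'b fun_space"
    and T :: "('a \<Rightarrow> real) \<Rightarrow> ('b \<Rightarrow> real)"
    and r :: real and r' p p' q :: ennreal
  assumes "1 \<le> r" and "1 / ennreal r + 1 / r' = 1"
    and "1 / p + 1 / p' = 1" and "0 < q"
    and "banach_function_space X" and "r_convex r X"
    and "banach_function_space Y" and "r_concave r Y"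
    and "order_continuous X" and "order_continuous (dual_space Y)"
    and "bounded_operator X Y T"
  shows
    "((\<exists>K>0. \<forall>n m. \<forall>(x :: nat \<Rightarrow> nat \<Rightarrow> 'a \<Rightarrow> real) (y' :: nat \<Rightarrow> nat \<Rightarrow> 'b \<Rightarrow> real).
         (\<forall>i<n. \<forall>j<m. x i j \<in> elts X \<and> y' i j \<in> elts (dual_space Y)) \<longrightarrow>
         (\<Sum>i<n. \<Sum>j<m. \<bar>pairing Y (T (x i j)) (y' i j)\<bar>)
           \<le> K * nrm X (mixed_sum (ennreal r) q n m x) * nrm (dual_space Y) (mixed_sum r' p' n m y'))
      \<longleftrightarrow>
      (\<exists>K>0. \<forall>n m. \<forall>x :: nat \<Rightarrow> nat \<Rightarrow> 'a \<Rightarrow> real.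
         (\<forall>i<n. \<forall>j<m. x i j \<in> elts X) \<longrightarrow>
         nrm Y (mixed_sum (ennreal r) p n m (\<lambda>i j. T (x i j)))
           \<le> K * nrm X (mixed_sum (ennreal r) q n m x)))
     \<and>
     ((\<exists>K>0. \<forall>n m. \<forall>x :: nat \<Rightarrow> nat \<Rightarrow> 'a \<Rightarrow> real.
         (\<forall>i<n. \<forall>j<m. x i j \<in> elts X) \<longrightarrow>
         nrm Y (mixed_sum (ennreal r) p n m (\<lambda>i j. T (x i j)))
           \<le> K * nrm X (mixed_sum (ennreal r) q n m x))
      \<longleftrightarrow>
      (\<exists>f \<in> borel_measurable (msr X). \<exists>g \<in> borel_measurable (msr Y). \<exists>That.
         bounded_operator X (Lr_space r (msr X)) (mult_op f) \<and>
         bounded_operator (Lr_space r (msr Y)) Y (mult_op g) \<and>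
         pq_regular p q (Lr_space r (msr X)) (Lr_space r (msr Y)) That \<and>
         (\<forall>x\<in>elts X. AE w in msr Y. T x w = mult_op g (That (mult_op f x)) w)))"
    (is "(?i \<longleftrightarrow> ?ii) \<and> (_ \<longleftrightarrow> ?iii)")
proof -
  interpret X: banach_function_space X by fact
  interpret Y: banach_function_space Y by fact
  note r = \<open>1 \<le> r\<close> and conj_r = assms(2) and conj_p = assms(3) and q = \<open>0 < q\<close>
  have p: "0 < p" by (rule conjugate_exponent_pos(1)[OF conj_p])
  have T: "linear_map X Y T" using assms(11) unfolding bounded_operator_def by blast
  then have T_mem: "T x \<in> elts Y" if "x \<in> elts X" for x using that unfolding linear_map_def by blast
  have scY: "section_continuous Y" by (rule Y.r_concave_section_continuous[OF r \<open>r_concave r Y\<close>])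
  have mixed_mem: "mixed_sum (ennreal r) q n m x \<in> elts X" if "\<forall>i<n. \<forall>j<m. x i j \<in> elts X" for n m x
    using that r by (intro X.mixed_sum_mem q) auto
  have "?ii" if ?i
  proof -
    obtain K where K: "K > 0"
      and bound: "\<And>n m (x :: nat \<Rightarrow> nat \<Rightarrow> 'a \<Rightarrow> real) (y' :: nat \<Rightarrow> nat \<Rightarrow> 'b \<Rightarrow> real).
         (\<forall>i<n. \<forall>j<m. x i j \<in> elts X \<and> y' i j \<in> elts (dual_space Y)) \<Longrightarrow>
         (\<Sum>i<n. \<Sum>j<m. \<bar>pairing Y (T (x i j)) (y' i j)\<bar>)
           \<le> K * nrm X (mixed_sum (ennreal r) q n m x) * nrm (dual_space Y) (mixed_sum r' p' n m
             y')"
      using \<open>?i\<close> by blast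
    have "nrm Y (mixed_sum (ennreal r) p n m (\<lambda>i j. T (x i j))) \<le>
      K * nrm X (mixed_sum (ennreal r) q n m x)"
      if x: "\<forall>i<n. \<forall>j<m. x i j \<in> elts X" for n m and x :: "nat \<Rightarrow> nat \<Rightarrow> 'a \<Rightarrow> real"
    proof -
      obtain y' where y': "\<And>i j. i < n \<Longrightarrow> j < m \<Longrightarrow> y' i j \<in> elts (dual_space Y)"
        "nrm (dual_space Y) (mixed_sum r' p' n m y') \<le> 1"
        and le: "nrm Y (mixed_sum (ennreal r) p n m (\<lambda>i j. T (x i j))) \<le>
          (\<Sum>i<n. \<Sum>j<m. \<bar>pairing Y (T (x i j)) (y' i j)\<bar>)"
      proof (rule Y.mixed_norming[OF scY conj_r conj_p])
        show "T (x i j) \<in> elts Y" if "i < n" "j < m" for i j using x T_mem that by blast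
      qed (rule that)
      note le
      also have "(\<Sum>i<n. \<Sum>j<m. \<bar>pairing Y (T (x i j)) (y' i j)\<bar>)
           \<le> K * nrm X (mixed_sum (ennreal r) q n m x) * nrm (dual_space Y) (mixed_sum r' p' n m
             y')"
        by (rule bound) (use x y' in blast)
      also have "\<dots> \<le> K * nrm X (mixed_sum (ennreal r) q n m x) * 1"
        using K X.norm_nonneg[OF mixed_mem[OF x]] by (intro mult_left_mono y') auto
      finally show ?thesis by simp
    qed
    then show ?ii using K by blast
  qed
  moreover have "?i" if ?ii
  proof -
    obtain K where K: "K > 0"
      and bound: "\<And>n m (x :: nat \<Rightarrow> nat \<Rightarrow> 'a \<Rightarrow> real). \<forall>i<n. \<forall>j<m. x i j \<in> elts X \<Longrightarrow>
         nrm Y (mixed_sum (ennreal r) p n m (\<lambda>i j. T (x i j))) \<le> K * nrm X (mixed_sum (ennreal r)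
           q n m x)"
      using \<open>?ii\<close> by blast
    have "(\<Sum>i<n. \<Sum>j<m. \<bar>pairing Y (T (x i j)) (y' i j)\<bar>)
           \<le> K * nrm X (mixed_sum (ennreal r) q n m x) * nrm (dual_space Y) (mixed_sum r' p' n m
             y')"
      if xy: "\<forall>i<n. \<forall>j<m. x i j \<in> elts X \<and> y' i j \<in> elts (dual_space Y)"
      for n m and x :: "nat \<Rightarrow> nat \<Rightarrow> 'a \<Rightarrow> real" and y' :: "nat \<Rightarrow> nat \<Rightarrow> 'b \<Rightarrow> real"
    proof -
      have "mixed_sum r' p' n m y' \<in> elts (dual_space Y)"
        using xy by (intro fun_ideal_mixed_sum[OF Y.dual_ideal] conjugate_exponent_pos(2)[OF conj_r]
            conjugate_exponent_pos(2)[OF conj_p]) auto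
      note nonneg = Y.dual_norm_nonneg[OF this]
      have "(\<Sum>i<n. \<Sum>j<m. \<bar>pairing Y (T (x i j)) (y' i j)\<bar>) \<le>
          nrm Y (mixed_sum (ennreal r) p n m (\<lambda>i j. T (x i j))) * nrm (dual_space Y) (mixed_sum r'
            p' n m y')"
        using xy T_mem by (intro Y.mixed_holder[OF conj_r conj_p]) auto
      also have "\<dots> \<le>
        (K * nrm X (mixed_sum (ennreal r) q n m x)) * nrm (dual_space Y) (mixed_sum r' p' n m y')"
        by (intro mult_right_mono bound nonneg) (use xy in blast)
      finally show ?thesis .
    qed
    then show ?i using K by blast
  qed
  moreover have "?iii" if ?ii
  proof -
    obtain K where K: "K > 0"
      and bound: "\<And>n m (x :: nat \<Rightarrow> nat \<Rightarrow> 'a \<Rightarrow> real). \<forall>i<n. \<forall>j<m. x i j \<in> elts X \<Longrightarrow>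
         nrm Y (mixed_sum (ennreal r) p n m (\<lambda>i j. T (x i j))) \<le> K * nrm X (mixed_sum (ennreal r)
           q n m x)"
      using \<open>?ii\<close> by blast
    have K0: "0 \<le> K" using K by simp
    interpret mixed_bounded_operator X Y T r p q K
      by unfold_locales
        (fact r p q K0 T bound \<open>r_convex r X\<close> \<open>r_concave r Y\<close>
          X.order_continuous_section_continuous[OF \<open>order_continuous X\<close>])+
    obtain eX where eX: "weak_unit (msr X) (elts X) eX" by (rule X.ex_weak_unit)
    obtain e where e: "weak_unit (msr Y) (elts Y) e" by (rule Y.ex_weak_unit)
    obtain \<phi> d C where "weighted_operator X Y T r p q K \<phi> d C eX e"
    proof (rule weights[OF e])
      fix \<phi> d C
      assume *: "\<phi> \<in> borel_measurable (msr X)" "\<And>w. 0 \<le> \<phi> w"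
        "d \<in> borel_measurable (msr Y)" "\<And>w. 0 \<le> d w" "\<And>w. e w = 0 \<Longrightarrow> d w = 0"
        "\<And>x. x \<in> elts X \<Longrightarrow> integrable (msr X) (\<lambda>w. \<bar>x w\<bar> powr r * \<phi> w)"
        "\<And>x. x \<in> elts X \<Longrightarrow> (\<integral>w. \<bar>x w\<bar> powr r * \<phi> w \<partial>msr X) \<le> C * nrm X x powr r"
        "\<And>k x. \<forall>j<k. x j \<in> elts X \<Longrightarrow>
           (\<integral>\<^sup>+w. ennreal (lp_sum p k (\<lambda>j. T (x j) w) powr r * d w) \<partial>msr Y) \<le>
           ennreal (\<integral>w. lp_sum q k (\<lambda>j. x j w) powr r * \<phi> w \<partial>msr X)"
        "\<And>y c. y \<in> elts Y \<Longrightarrow> AE w in msr Y. \<bar>y w\<bar> \<le> c * e w \<Longrightarrow>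
           ennreal (nrm Y y powr r) \<le> (\<integral>\<^sup>+w. ennreal (\<bar>y w\<bar> powr r * d w) \<partial>msr Y)"
      have "weighted_operator X Y T r p q K \<phi> d C eX e" by unfold_locales (fact eX e *)+
      then show thesis by (rule that)
    qed
    then interpret weighted_operator X Y T r p q K \<phi> d C eX e .
    show ?iii
      using f_meas g_meas mult_f_bounded mult_g_bounded regular_extension_regular factorization
        by blast
  qed
  moreover have "?ii" if ?iii
  proof -
    obtain f g S where "bounded_operator X (Lr_space r (msr X)) (mult_op f)"
      "bounded_operator (Lr_space r (msr Y)) Y (mult_op g)"
      "pq_regular p q (Lr_space r (msr X)) (Lr_space r (msr Y)) S"
      "\<And>x. x \<in> elts X \<Longrightarrow> AE w in msr Y. T x w = mult_op g (S (mult_op f x)) w"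
      using \<open>?iii\<close> by blast
    from factorization_imp_mixed_bound[OF \<open>banach_function_space X\<close> \<open>banach_function_space Y\<close> r p
      q assms(11) this]
    show ?ii .
  qed
  ultimately show ?thesis by blast
qed

end
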